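(* Let $A=(A_t,t\ge0)$ be a Markovian path in an exchangeable homogeneous fragmentation process $\Pi=(\Pi(t),t\ge0)$. For each $n\ge1$, denote by $\Pi^{\{n\}}(t)$ the block of $\Pi(t)$ containing $n$, $t\ge0$, let $\sigma_n=\inf\{t\ge0:n\notin A_t\}$, and consider the associated spinal partition $\Pi^A(0)=\{\Pi^{\{n\}}(\sigma_n),n\ge1\}$ of $\mathbb N$, with blocks $\Pi_i^A(0)$, $i\ge1$. Then, conditionally given $\Pi^A(0)$ and $(\sigma_n,n\ge1)$, the process $$\Pi^A(t)=\{\Pi^{\{n\}}(\sigma_n+t),n\ge1\}=\bigcup_{i\ge1}\Pi\big(\sigma_{\min\Pi_i^A(0)}+t\big)\cap\Pi_i^A(0),\qquad t\ge0,$$ is a fragmentation process starting from $\Pi^A(0)$, with the same transition kernel as $\Pi$.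
   Context: Exchangeable homogeneous fragmentation process. A right-continuous strong Markov process $\Pi=(\Pi(t),t\ge0)$ of refining partitions of $\mathbb N$ with $\Pi(0)=\{\mathbb N\}$, whose law is invariant under finite permutations of $\mathbb N$, and whose transition kernel satisfies the homogeneous branching property: conditionally given $\Pi(t)=\{B_i,i\ge1\}$, the partition $\Pi(t+s)$ has the same law as the partition of $\mathbb N$ whose blocks are the nonempty blocks of $B_i\cap\Pi^{(i)}(s)$, $i\ge1$, where the $\Pi^{(i)}$ are independent copies of $\Pi$. The trivial case $\Pi(t)=\{\mathbb N\}$ for all $t$ is excluded, so that $\Pi(\infty)=\lim_{t\to\infty}\Pi(t)$ is the partition into singletons (this is the convention used when $\sigma_n=\infty$). For a set $B$ and a partition $\Gamma$, $B\cap\Gamma=\Gamma\cap B$ denotes the restriction of $\Gamma$ to $B$. A fragmentation process starting from a partition $\{B_i,i\ge1\}$ with the same transition kernel as $\Pi$ is a process with the law of $\big(\bigcup_{i}B_i\cap\Pi^{(i)}(t),t\ge0\big)$, for independent copies $\Pi^{(i)}$ of $\Pi$. Markovian path. A process $A=(A_t,t\ge0)$ of subsets of $\mathbb N$ is a path in $\Pi$ if $A_t\in\Pi(t)$ for all $t\ge0$ and $A_t$ is decreasing for inclusion as $t$ increases. It is a Markovian path in $\Pi$ if it is adapted to some filtration $(\mathcal F_t,t\ge0)$ with respect to which $\Pi$ is Markovian, in such a way that for each $s\ge0$ the process $((A_t,\Pi(t)\cap A_s),t\ge s)$ and the restriction of $(\Pi(t),t\ge s)$ to $\mathbb N\setminus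 A_s$ are conditionally independent given $\mathcal F_s$. *)

theory Defs
  imports "HOL-Probability.Probability"
begin

text \<open>The type \<^typ>\<open>nat\<close> plays the role of the labels \<open>1, 2, 3, \<dots>\<close>, in their usual order.\<close>

definition block_of :: "nat set set \<Rightarrow> nat \<Rightarrow> nat set" where
  "block_of P n = (THE B. B \<in> P \<and> n \<in> B)"

definition restr :: "nat set \<Rightarrow> nat set set \<Rightarrow> nat set set" where
  "restr B P = (\<inter>) B ` P - {{}}"

text \<open>Partitions of arbitrary subsets of the naturals, so that restrictions to random sets live
  in the same space. For \<open>i = j\<close> the generator is the event that \<open>i\<close> belongs to the support;
  on partitions of all naturals the trace is the Borel sigma-algebra of the topology
  generated by the restrictions to finite sets.\<close>

definition partition_algebra :: "nat set set measure" where
  "partition_algebra = sigma {P. partition_on (\<Union>P) P}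
     {{P. partition_on (\<Union>P) P \<and> (\<exists>B\<in>P. i \<in> B \<and> j \<in> B)} | i j. True}"

definition subset_algebra :: "nat set measure" where
  "subset_algebra = sigma UNIV {{B. n \<in> B} | n. True}"

definition path_algebra :: "(real \<Rightarrow> nat set set) measure" where
  "path_algebra = PiM {0..} (\<lambda>_. partition_algebra)"

subsection \<open>Conditioning\<close>

definition has_cond_law ::
    "'a measure \<Rightarrow> 'a measure \<Rightarrow> ('a \<Rightarrow> 'b) \<Rightarrow> 'b measure \<Rightarrow> ('a \<Rightarrow> 'b measure) \<Rightarrow> bool" where
  "has_cond_law M G Y N \<kappa> \<longleftrightarrow>
     subalgebra M G \<and> Y \<in> M \<rightarrow>\<^sub>M N \<and>
     (\<forall>E\<in>sets N. AE \<omega> in M.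
        real_cond_exp M G (indicator (Y -` E \<inter> space M)) \<omega> = measure (\<kappa> \<omega>) E)"

definition cond_indep ::
    "'a measure \<Rightarrow> 'a measure \<Rightarrow> ('a \<Rightarrow> 'b) \<Rightarrow> 'b measure \<Rightarrow> ('a \<Rightarrow> 'c) \<Rightarrow> 'c measure \<Rightarrow> bool" where
  "cond_indep M G Y N Z L \<longleftrightarrow>
     subalgebra M G \<and> Y \<in> M \<rightarrow>\<^sub>M N \<and> Z \<in> M \<rightarrow>\<^sub>M L \<and>
     (\<forall>E\<in>sets N. \<forall>D\<in>sets L. AE \<omega> in M.
        real_cond_exp M G (indicator (Y -` E \<inter> Z -` D \<inter> space M)) \<omega> =
        real_cond_exp M G (indicator (Y -` E \<inter> space M)) \<omega> *
        real_cond_exp M G (indicator (Z -` D \<inter> space M)) \<omega>)"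

subsection \<open>Fragmentation processes\<close>

text \<open>The copy of the process used inside a block \<open>B\<close> is the one numbered by the least
  element \<open>Inf B\<close> of \<open>B\<close>; distinct blocks thus use independent copies.\<close>

definition fragment :: "nat set set \<Rightarrow> (nat \<Rightarrow> nat set set) \<Rightarrow> nat set set" where
  "fragment P w = (\<Union>B\<in>P. restr B (w (Inf B)))"

definition frag_kernel ::
    "'a measure \<Rightarrow> (real \<Rightarrow> 'a \<Rightarrow> nat set set) \<Rightarrow> real \<Rightarrow> nat set set \<Rightarrow> nat set set measure" where
  "frag_kernel M X s P =
     distr (PiM (UNIV :: nat set) (\<lambda>_. distr M partition_algebra (X s))) partition_algebra (fragment P)"

definition path_law :: "'a measure \<Rightarrow> (real \<Rightarrow> 'a \<Rightarrow> nat set set) \<Rightarrow> (real \<Rightarrow> nat set set) measure" where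
  "path_law M X = distr M path_algebra (\<lambda>\<omega>. \<lambda>t\<in>{0..}. X t \<omega>)"

text \<open>Law of a fragmentation process started from \<open>P\<close>, with the transition kernel of \<open>X\<close>.\<close>

definition frag_law ::
    "'a measure \<Rightarrow> (real \<Rightarrow> 'a \<Rightarrow> nat set set) \<Rightarrow> nat set set \<Rightarrow> (real \<Rightarrow> nat set set) measure" where
  "frag_law M X P =
     distr (PiM (UNIV :: nat set) (\<lambda>_. path_law M X)) path_algebra
       (\<lambda>w. \<lambda>t\<in>{0..}. fragment P (\<lambda>n. w n t))"

definition right_cont_partitions :: "(real \<Rightarrow> nat set set) \<Rightarrow> bool" where
  "right_cont_partitions x \<longleftrightarrow>
     (\<forall>t\<ge>0. \<forall>n. \<forall>\<^sub>F u in at_right t. restr {..n} (x u) = restr {..n} (x t))"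

definition natural_filtration :: "'a measure \<Rightarrow> (real \<Rightarrow> 'a \<Rightarrow> nat set set) \<Rightarrow> real \<Rightarrow> 'a measure" where
  "natural_filtration M X t =
     sigma (space M) {X s -` E \<inter> space M | s E. 0 \<le> s \<and> s \<le> t \<and> E \<in> sets partition_algebra}"

definition markov_wrt ::
    "'a measure \<Rightarrow> (real \<Rightarrow> 'a \<Rightarrow> nat set set) \<Rightarrow> (real \<Rightarrow> 'a measure) \<Rightarrow> bool" where
  "markov_wrt M X F \<longleftrightarrow>
     (\<forall>t\<ge>0. X t \<in> F t \<rightarrow>\<^sub>M partition_algebra) \<and>
     (\<forall>t\<ge>0. \<forall>s\<ge>0. has_cond_law M (F t) (X (t + s)) partition_algebra
        (\<lambda>\<omega>. frag_kernel M X s (X t \<omega>)))"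

definition strong_markov_wrt ::
    "'a measure \<Rightarrow> (real \<Rightarrow> 'a \<Rightarrow> nat set set) \<Rightarrow> (real \<Rightarrow> 'a measure) \<Rightarrow> bool" where
  "strong_markov_wrt M X F \<longleftrightarrow>
     (\<forall>t\<ge>0. X t \<in> F t \<rightarrow>\<^sub>M partition_algebra) \<and>
     (\<forall>T. stopping_time F T \<longrightarrow> (\<forall>\<omega>\<in>space M. 0 \<le> T \<omega>) \<longrightarrow>
        (\<forall>s\<ge>0. has_cond_law M (filtration.pre_sigma (space M) F T)
           (\<lambda>\<omega>. X (T \<omega> + s) \<omega>) partition_algebra (\<lambda>\<omega>. frag_kernel M X s (X (T \<omega>) \<omega>))))"

definition exchangeable :: "'a measure \<Rightarrow> (real \<Rightarrow> 'a \<Rightarrow> nat set set) \<Rightarrow> bool" where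
  "exchangeable M X \<longleftrightarrow>
     (\<forall>p S. finite S \<longrightarrow> p permutes S \<longrightarrow>
        path_law M (\<lambda>t \<omega>. (`) p ` X t \<omega>) = path_law M X)"

text \<open>The branching property is contained in the use of \<^const>\<open>frag_kernel\<close> as transition
  kernel in the strong Markov property.\<close>

definition fragmentation_process :: "'a measure \<Rightarrow> (real \<Rightarrow> 'a \<Rightarrow> nat set set) \<Rightarrow> bool" where
  "fragmentation_process M X \<longleftrightarrow>
     (\<forall>t\<ge>0. X t \<in> M \<rightarrow>\<^sub>M partition_algebra) \<and>
     (\<forall>\<omega>\<in>space M. X 0 \<omega> = {UNIV} \<and>
        (\<forall>s t. 0 \<le> s \<longrightarrow> s \<le> t \<longrightarrow> refines UNIV (X t \<omega>) (X s \<omega>)) \<and>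
        right_cont_partitions (\<lambda>t. X t \<omega>)) \<and>
     exchangeable M X \<and>
     strong_markov_wrt M X (natural_filtration M X) \<and>
     \<not> (AE \<omega> in M. \<forall>t\<ge>0. X t \<omega> = {UNIV})"

subsection \<open>Markovian paths and the spinal partition\<close>

definition path_in :: "'a measure \<Rightarrow> (real \<Rightarrow> 'a \<Rightarrow> nat set set) \<Rightarrow> (real \<Rightarrow> 'a \<Rightarrow> nat set) \<Rightarrow> bool" where
  "path_in M X A \<longleftrightarrow>
     (\<forall>\<omega>\<in>space M. (\<forall>t\<ge>0. A t \<omega> \<in> X t \<omega>) \<and> (\<forall>s t. 0 \<le> s \<longrightarrow> s \<le> t \<longrightarrow> A t \<omega> \<subseteq> A s \<omega>))"

definition markovian_path ::
    "'a measure \<Rightarrow> (real \<Rightarrow> 'a \<Rightarrow> nat set set) \<Rightarrow> (real \<Rightarrow> 'a \<Rightarrow> nat set) \<Rightarrow> bool" where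
  "markovian_path M X A \<longleftrightarrow> path_in M X A \<and>
     (\<exists>F. filtration (space M) F \<and> (\<forall>t. subalgebra M (F t)) \<and> markov_wrt M X F \<and>
        (\<forall>t\<ge>0. A t \<in> F t \<rightarrow>\<^sub>M subset_algebra) \<and>
        (\<forall>s\<ge>0. cond_indep M (F s)
           (\<lambda>\<omega>. \<lambda>t\<in>{s..}. (A t \<omega>, restr (A s \<omega>) (X t \<omega>)))
             (PiM {s..} (\<lambda>_. subset_algebra \<Otimes>\<^sub>M partition_algebra))
           (\<lambda>\<omega>. \<lambda>t\<in>{s..}. restr (- A s \<omega>) (X t \<omega>))
             (PiM {s..} (\<lambda>_. partition_algebra))))"

definition detach_time :: "(real \<Rightarrow> 'a \<Rightarrow> nat set) \<Rightarrow> nat \<Rightarrow> 'a \<Rightarrow> ereal" where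
  "detach_time A n \<omega> = (INF t \<in> {t. 0 \<le> t \<and> n \<notin> A t \<omega>}. ereal t)"

text \<open>At time infinity the process is, by convention, the partition into singletons (the almost
  sure limit).\<close>

definition at_ext_time :: "(real \<Rightarrow> 'a \<Rightarrow> nat set set) \<Rightarrow> ereal \<Rightarrow> 'a \<Rightarrow> nat set set" where
  "at_ext_time X r \<omega> = (if r = \<infinity> then range (\<lambda>n. {n}) else X (real_of_ereal r) \<omega>)"

definition spinal ::
    "(real \<Rightarrow> 'a \<Rightarrow> nat set set) \<Rightarrow> (real \<Rightarrow> 'a \<Rightarrow> nat set) \<Rightarrow> real \<Rightarrow> 'a \<Rightarrow> nat set set" where
  "spinal X A t \<omega> = range (\<lambda>n. block_of (at_ext_time X (detach_time A n \<omega> + ereal t) \<omega>) n)"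

definition spinal_algebra ::
    "'a measure \<Rightarrow> (real \<Rightarrow> 'a \<Rightarrow> nat set set) \<Rightarrow> (real \<Rightarrow> 'a \<Rightarrow> nat set) \<Rightarrow> 'a measure" where
  "spinal_algebra M X A =
     vimage_algebra (space M) (\<lambda>\<omega>. (spinal X A 0 \<omega>, \<lambda>n. detach_time A n \<omega>))
       (partition_algebra \<Otimes>\<^sub>M PiM (UNIV :: nat set) (\<lambda>_. (borel :: ereal measure)))"

end

theory Submission
  imports Defs
begin

text \<open>The idea is that a piece which splits off the path \<open>A\<close> at time \<open>s\<close> goes on independently
of everything that happens to the path afterwards, by the definition of a Markovian path, and that
it goes on as a fragmentation started from its state at time \<open>s\<close>, by the Markov property of \<open>X\<close>
in the filtration of the path. Replacing the pieces one after the other, in the order in which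
they split off, by independent fragmentations gives the claim. Three points need care.

Partitions and their laws are handled through the relation \<open>linked P a b\<close>, that \<open>a\<close> and \<open>b\<close> share
a block of \<open>P\<close>. A query is a finite set of triples \<open>(a, b, t)\<close> and asks whether \<open>a\<close> and \<open>b\<close> are
linked at time \<open>t\<close>, for all its triples at once; the corresponding events form a \<open>\<pi>\<close>-system that
generates the path space. For a fragmentation started from \<open>P\<close> the answer has an explicit
probability \<open>block_product\<close>: it vanishes unless \<open>P\<close> links all the pairs, and otherwise it is the
product, over the blocks of \<open>P\<close>, of the probabilities that the homogeneous process answers the part
of the query that lies in the block (\<open>measure_frag_law\<close>). This product is multiplicative when a
partition is assembled from pieces (\<open>block_product_split\<close>), which covers both the
composition of transition kernels and the assembly of the spinal partition from its detached pieces.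
The Markov property, stated for one time, extends to queries with several times in
\<open>markov_queries\<close>.

The detachment times are random and take uncountably many values. They are first rounded up to
a grid of mesh \<open>\<delta>\<close> with \<open>J\<close> steps, a label that stays longer being treated as never detached. On
the event that each label has a prescribed grid index, induction on the grid replaces the pieces one by
one by their conditional laws (\<open>detached_step\<close>, \<open>scheduled_pieces\<close>, \<open>grid_law\<close>).

Finally the grid is refined. The path inherits right-continuity from \<open>X\<close>: a label of \<open>A t\<close> that left
\<open>A\<close> immediately after \<open>t\<close> would be separated at once from the labels that stay, which right-continuity
of \<open>X\<close> forbids (\<open>A_right_cont\<close>). Hence \<open>n \<in> A t\<close> means \<open>t < detach_time A n\<close>, the rounded times
approach the true ones from the right, and every query about the rounded spinal process has eventually the right
answer (\<open>eventually_grid_linked\<close>). Dominated convergence gives the identity \<open>spine_law\<close> for queries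
on events \<open>detach_time A n < c n\<close>, and a monotone class argument turns it into the
conditional law.\<close>

section \<open>Partitions seen through pairs of labels\<close>

definition linked :: "nat set set \<Rightarrow> nat \<Rightarrow> nat \<Rightarrow> bool" where
  "linked P a b \<longleftrightarrow> (\<exists>B\<in>P. a \<in> B \<and> b \<in> B)"

lemma space_partition_algebra: "space partition_algebra = {P. partition_on (\<Union>P) P}"
  unfolding partition_algebra_def by (rule space_measure_of) auto

lemma sets_partition_algebra:
  "sets partition_algebra = sigma_sets {P. partition_on (\<Union>P) P}
     {{P. partition_on (\<Union>P) P \<and> linked P i j} | i j. True}"
  unfolding partition_algebra_def linked_def by (rule sets_measure_of) auto

lemma pred_linked [measurable]: "Measurable.pred partition_algebra (\<lambda>P. linked P a b)"
  unfolding pred_def sets_partition_algebra space_partition_algebra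
  by (rule sigma_sets.Basic) auto

lemma pred_linked_comp [measurable (raw)]:
  assumes "f \<in> N \<rightarrow>\<^sub>M partition_algebra"
  shows "Measurable.pred N (\<lambda>\<omega>. linked (f \<omega>) a b)"
  using measurable_compose[OF assms pred_linked] .

text \<open>The relation \<open>linked\<close> generates the \<open>\<sigma>\<close>-algebra, so that measurability of a random partition reduces
to that of countably many events.\<close>

lemma measurable_partition_algebraI:
  assumes "\<And>\<omega>. \<omega> \<in> space N \<Longrightarrow> partition_on (\<Union>(f \<omega>)) (f \<omega>)"
    and "\<And>i j. Measurable.pred N (\<lambda>\<omega>. linked (f \<omega>) i j)"
  shows "f \<in> N \<rightarrow>\<^sub>M partition_algebra"
proof (rule measurable_sigma_sets[OF sets_partition_algebra])
  fix y assume "y \<in> {{P. partition_on (\<Union>P) P \<and> linked P i j} | i j. True}"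
  then obtain i j where y: "y = {P. partition_on (\<Union>P) P \<and> linked P i j}" by auto
  have "f -` y \<inter> space N = {\<omega>\<in>space N. linked (f \<omega>) i j}" using assms(1) by (auto simp: y)
  then show "f -` y \<inter> space N \<in> sets N" using assms(2)[of i j] by (simp add: pred_def)
qed (use assms(1) in auto)

lemma linked_restr: "linked (restr B P) a b \<longleftrightarrow> a \<in> B \<and> b \<in> B \<and> linked P a b"
proof
  assume "linked (restr B P) a b"
  then obtain C where "C \<in> restr B P" "a \<in> C" "b \<in> C" by (auto simp: linked_def)
  then show "a \<in> B \<and> b \<in> B \<and> linked P a b" by (auto simp: linked_def restr_def)
next
  assume "a \<in> B \<and> b \<in> B \<and> linked P a b"
  then obtain C where C: "C \<in> P" "a \<in> B \<inter> C" "b \<in> B \<inter> C" by (auto simp: linked_def)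
  then have "B \<inter> C \<in> restr B P" by (auto simp: restr_def)
  with C(2,3) show "linked (restr B P) a b" unfolding linked_def by (intro bexI[of _ "B \<inter> C"] conjI)
qed

lemma linked_fragment:
  "linked (fragment P w) a b \<longleftrightarrow> (\<exists>B\<in>P. a \<in> B \<and> b \<in> B \<and> linked (w (Inf B)) a b)"
proof -
  have "linked (fragment P w) a b \<longleftrightarrow> (\<exists>B\<in>P. linked (restr B (w (Inf B))) a b)"
    by (auto simp: fragment_def linked_def)
  then show ?thesis by (auto simp: linked_restr)
qed

lemma partition_on_fragment:
  assumes P: "partition_on (\<Union>P) P" and w: "\<And>n. partition_on (\<Union>(w n)) (w n)"
  shows "partition_on (\<Union>(fragment P w)) (fragment P w)"
proof -
  have "disjoint (fragment P w)"
  proof (rule disjointI)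
    fix C D assume C: "C \<in> fragment P w" and D: "D \<in> fragment P w" and ne: "C \<noteq> D"
    obtain B C' where 1: "B \<in> P" "C' \<in> w (Inf B)" "C = B \<inter> C'"
      using C by (auto simp: fragment_def restr_def)
    obtain B' D' where 2: "B' \<in> P" "D' \<in> w (Inf B')" "D = B' \<inter> D'"
      using D by (auto simp: fragment_def restr_def)
    show "C \<inter> D = {}"
    proof (cases "B = B'")
      case True
      then have "C' \<noteq> D'" using ne 1 2 by auto
      then have "C' \<inter> D' = {}" using w[of "Inf B"] 1 2 True
        unfolding partition_on_def disjoint_def by auto
      then show ?thesis using 1 2 by auto
    next
      case False
      then have "B \<inter> B' = {}" using P 1 2 unfolding partition_on_def disjoint_def by auto
      then show ?thesis using 1 2 by auto
    qed
  qed
  moreover have "{} \<notin> fragment P w" by (auto simp: fragment_def restr_def)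
  ultimately show ?thesis unfolding partition_on_def by auto
qed

text \<open>This is the label of the copy that \<open>fragment P\<close> uses inside the block of \<open>a\<close>.\<close>

definition block_min :: "nat set set \<Rightarrow> nat \<Rightarrow> nat" where
  "block_min P a = Inf (block_of P a)"

lemma block_of_eq:
  assumes "partition_on S P" "B \<in> P" "a \<in> B"
  shows "block_of P a = B"
  unfolding block_of_def
proof (rule the_equality)
  show "C = B" if "C \<in> P \<and> a \<in> C" for C
    using that assms unfolding partition_on_def disjoint_def by auto
qed (use assms in auto)

lemma block_of_in:
  assumes "partition_on S P" "a \<in> S"
  shows "block_of P a \<in> P" "a \<in> block_of P a"
proof -
  obtain B where "B \<in> P" "a \<in> B" using assms unfolding partition_on_def by auto
  then show "block_of P a \<in> P" "a \<in> block_of P a" using block_of_eq[OF assms(1), of B a] by simp_all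
qed

lemma linked_iff_mem_block:
  assumes "partition_on UNIV P"
  shows "linked P a b \<longleftrightarrow> b \<in> block_of P a"
  using block_of_in[OF assms, of a] block_of_eq[OF assms] unfolding linked_def by (metis UNIV_I)

text \<open>The least element identifies a block, so that a partition is recovered from a function of its labels.\<close>

lemma linked_iff_block_min:
  assumes P: "partition_on (\<Union>P) P" and a: "linked P a a" and b: "linked P b b"
  shows "linked P a b \<longleftrightarrow> block_min P a = block_min P b"
proof -
  obtain B C where B: "B \<in> P" "a \<in> B" and C: "C \<in> P" "b \<in> C" using a b by (auto simp: linked_def)
  have eq: "block_of P a = B" "block_of P b = C" using block_of_eq[OF P] B C by auto
  have "Inf B \<in> B" "Inf C \<in> C" using B C Inf_nat_def1 by auto
  then have "Inf B = Inf C \<longleftrightarrow> B = C" using B C block_of_eq[OF P] by metis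
  moreover have "linked P a b \<longleftrightarrow> B = C"
    using B C block_of_eq[OF P] unfolding linked_def by metis
  ultimately show ?thesis by (simp add: block_min_def eq)
qed

lemma linked_fragment_iff:
  assumes P: "partition_on (\<Union>P) P"
  shows "linked (fragment P w) a b \<longleftrightarrow> linked P a b \<and> linked (w (block_min P a)) a b"
  unfolding linked_fragment
  unfolding linked_def[of P] using block_of_eq[OF P] by (metis block_min_def)

section \<open>Products over blocks\<close>

text \<open>A triple \<open>(a, b, t)\<close> asks whether \<open>a\<close> and \<open>b\<close> lie in the same block at time \<open>t\<close>.\<close>

type_synonym query = "(nat \<times> nat \<times> real) set"

definition linked_on :: "(real \<Rightarrow> nat set set) \<Rightarrow> query \<Rightarrow> bool" where
  "linked_on x I \<longleftrightarrow> (\<forall>(a, b, t)\<in>I. linked (x t) a b)"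

definition related_on :: "(nat \<Rightarrow> nat \<Rightarrow> bool) \<Rightarrow> query \<Rightarrow> bool" where
  "related_on R I \<longleftrightarrow> (\<forall>(a, b, t)\<in>I. R a b)"

text \<open>The relation \<open>R\<close> says which labels share a block of the initial partition. The query is cut into the
parts that concern one block each; a triple is located by its first label, as the second
one is in the same block whenever the answer can be positive.\<close>

definition block_queries :: "(nat \<Rightarrow> nat \<Rightarrow> bool) \<Rightarrow> query \<Rightarrow> query set" where
  "block_queries R I = (\<lambda>x. {y\<in>I. R (fst x) (fst y)}) ` I"

text \<open>When \<open>q J\<close> is the probability that the homogeneous process, started from a single block,
answers \<open>J\<close> positively, this is the probability that independent copies run inside the blocks
of \<open>R\<close> answer \<open>I\<close> positively.\<close>

definition block_product :: "(query \<Rightarrow> real) \<Rightarrow> (nat \<Rightarrow> nat \<Rightarrow> bool) \<Rightarrow> query \<Rightarrow> real" where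
  "block_product q R I = of_bool (related_on R I) * (\<Prod>J\<in>block_queries R I. q J)"

lemma block_product_cong:
  assumes "\<And>a b. a \<in> fst ` I \<Longrightarrow> b \<in> fst ` I \<union> (fst \<circ> snd) ` I \<Longrightarrow> R a b \<longleftrightarrow> R' a b"
  shows "block_product q R I = block_product q R' I"
proof -
  have "related_on R I \<longleftrightarrow> related_on R' I" unfolding related_on_def using assms by force
  moreover have "block_queries R I = block_queries R' I"
    unfolding block_queries_def using assms by (intro image_cong refl) auto
  ultimately show ?thesis by (simp add: block_product_def)
qed

text \<open>If \<open>R\<close> is assembled from relations \<open>W k\<close> living on disjoint sets of labels, the sets where \<open>g\<close>
equals \<open>k\<close>, then each block of \<open>R\<close> is a block of exactly one \<open>W k\<close>, and the product over
the blocks of \<open>R\<close> factorizes. The two instances needed are a partition fragmented block by block, and the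
spinal partition sorted by detachment time.\<close>

lemma block_product_split:
  assumes fin: "finite I" "finite T" and g: "g ` fst ` I \<subseteq> T"
    and R: "\<And>x y. x \<in> I \<Longrightarrow> y \<in> I \<Longrightarrow>
      R (fst x) (fst y) \<longleftrightarrow> g (fst x) = g (fst y) \<and> W (g (fst x)) (fst x) (fst y)"
    and self: "\<And>a b t. (a, b, t) \<in> I \<Longrightarrow> R a b \<Longrightarrow> R a a"
    and R': "\<And>a b t. (a, b, t) \<in> I \<Longrightarrow> R a b \<longleftrightarrow> W (g a) a b"
  shows "block_product q R I = (\<Prod>k\<in>T. block_product q (W k) {x\<in>I. g (fst x) = k})"
proof -
  define I' where "I' k = {x\<in>I. g (fst x) = k}" for k
  have rel: "related_on R I \<longleftrightarrow> (\<forall>k\<in>T. related_on (W k) (I' k))"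
    using R' g unfolding related_on_def I'_def by fastforce
  show ?thesis
  proof (cases "related_on R I")
    case False
    then obtain k where "k \<in> T" "\<not> related_on (W k) (I' k)" using rel by auto
    then have "(\<Prod>k\<in>T. block_product q (W k) (I' k)) = 0"
      using fin(2) by (auto simp: prod_zero_iff block_product_def)
    then show ?thesis using False by (simp add: block_product_def I'_def)
  next
    case True
    have un: "block_queries R I = (\<Union>k\<in>T. block_queries (W k) (I' k))"
    proof -
      have eq: "{y\<in>I. R (fst x) (fst y)} = {y\<in>I' (g (fst x)). W (g (fst x)) (fst x) (fst y)}"
        if "x \<in> I" for x
        using R[OF that] by (auto simp: I'_def)
      have "block_queries R I = (\<lambda>x. {y\<in>I' (g (fst x)). W (g (fst x)) (fst x) (fst y)}) ` I"
        unfolding block_queries_def by (rule image_cong[OF refl eq])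
      also have "\<dots> = (\<Union>k\<in>T. block_queries (W k) (I' k))"
        using g unfolding block_queries_def I'_def by (auto simp: image_iff)
      finally show ?thesis .
    qed
    have fin': "finite (block_queries (W k) (I' k))" for k
      using fin by (simp add: block_queries_def I'_def)
    have in_k: "J \<noteq> {} \<and> J \<subseteq> I' k" if J: "J \<in> block_queries (W k) (I' k)" for J k
    proof -
      obtain x where x: "x \<in> I' k" "J = {y\<in>I' k. W k (fst x) (fst y)}"
        using J unfolding block_queries_def by blast
      obtain a b t where "x = (a, b, t)" by (metis prod.exhaust)
      then have "R (fst x) (fst x)" using self[of a b t] True x by (auto simp: related_on_def I'_def)
      then have "W k (fst x) (fst x)" using R[of x x] x by (auto simp: I'_def)
      then have "x \<in> J" using x by simp
      then show ?thesis unfolding x(2) by blast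
    qed
    have disj: "block_queries (W k) (I' k) \<inter> block_queries (W l) (I' l) = {}" if "k \<noteq> l" for k l
      using in_k[of _ k] in_k[of _ l] that by (fastforce simp: I'_def)
    have "(\<Prod>J\<in>block_queries R I. q J) = (\<Prod>k\<in>T. \<Prod>J\<in>block_queries (W k) (I' k). q J)"
      unfolding un using fin fin' disj by (intro prod.UNION_disjoint) auto
    then show ?thesis using True rel by (simp add: block_product_def I'_def)
  qed
qed

text \<open>The blocks may be indexed by any function of the labels that separates exactly the blocks;
indices in \<open>T\<close> that no label uses contribute \<open>q {} = 1\<close>.\<close>

lemma block_product_leader:
  assumes fin: "finite I" "finite T" and g: "g ` fst ` I \<subseteq> T" and q: "q {} = 1"
    and R: "\<And>a b. a \<in> fst ` I \<Longrightarrow> b \<in> fst ` I \<Longrightarrow> R a b \<longleftrightarrow> g a = g b"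
    and on: "related_on R I"
  shows "block_product q R I = (\<Prod>k\<in>T. q {x\<in>I. g (fst x) = k})"
proof -
  have "block_product q (\<lambda>_ _. True) J = q J" for J
  proof (cases "J = {}")
    case False
    then have "block_queries (\<lambda>_ _. True) J = {J}" by (auto simp: block_queries_def)
    then show ?thesis by (auto simp: block_product_def related_on_def)
  qed (simp add: block_product_def block_queries_def related_on_def q)
  moreover have "R a b" if "(a, b, t) \<in> I" for a b t using on that by (auto simp: related_on_def)
  moreover have "R a a" if "(a, b, t) \<in> I" for a b t using R[of a a] that by (force simp: image_iff)
  ultimately show ?thesis
    using block_product_split[OF fin g, of R "\<lambda>_ _ _. True" q] R by simp
qed

lemma block_product_bounds:
  assumes "\<And>J. 0 \<le> q J" "\<And>J. q J \<le> 1"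
  shows "0 \<le> block_product q R I" "block_product q R I \<le> 1"
proof -
  have "0 \<le> (\<Prod>J\<in>block_queries R I. q J)" "(\<Prod>J\<in>block_queries R I. q J) \<le> 1"
    using assms by (auto intro: prod_nonneg prod_le_1)
  then show "0 \<le> block_product q R I" "block_product q R I \<le> 1" by (auto simp: block_product_def)
qed

lemma measurable_block_product [measurable (raw)]:
  assumes fin: "finite I" and R [measurable]: "\<And>a b. Measurable.pred N (\<lambda>\<omega>. R \<omega> a b)"
  shows "(\<lambda>\<omega>. block_product q (R \<omega>) I) \<in> borel_measurable N"
proof -
  have sub: "block_queries S I \<subseteq> Pow I" for S by (auto simp: block_queries_def)
  have mem: "J \<in> block_queries S I \<longleftrightarrow> (\<exists>x\<in>I. \<forall>y\<in>I. y \<in> J \<longleftrightarrow> S (fst x) (fst y))"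
    if "J \<in> Pow I" for J S using that by (auto simp: block_queries_def image_iff)
  have "block_product q (R \<omega>) I = (if \<forall>x\<in>I. R \<omega> (fst x) (fst (snd x)) then
      (\<Prod>J\<in>Pow I. if \<exists>x\<in>I. \<forall>y\<in>I. y \<in> J \<longleftrightarrow> R \<omega> (fst x) (fst y) then q J else 1) else 0)" for \<omega>
  proof -
    have "(\<Prod>J\<in>block_queries (R \<omega>) I. q J) = (\<Prod>J\<in>Pow I. if J \<in> block_queries (R \<omega>) I then q J else 1)"
      using fin sub[of "R \<omega>"] by (subst prod.inter_restrict[symmetric]) (auto simp: Int_absorb1)
    also have "\<dots> = (\<Prod>J\<in>Pow I. if \<exists>x\<in>I. \<forall>y\<in>I. y \<in> J \<longleftrightarrow> R \<omega> (fst x) (fst y) then q J else 1)"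
      by (intro prod.cong refl) (simp add: mem)
    finally have "(\<Prod>J\<in>block_queries (R \<omega>) I. q J) =
      (\<Prod>J\<in>Pow I. if \<exists>x\<in>I. \<forall>y\<in>I. y \<in> J \<longleftrightarrow> R \<omega> (fst x) (fst y) then q J else 1)" .
    moreover have "related_on (R \<omega>) I \<longleftrightarrow> (\<forall>x\<in>I. R \<omega> (fst x) (fst (snd x)))"
      by (simp add: related_on_def case_prod_beta')
    ultimately show ?thesis by (simp add: block_product_def)
  qed
  then show ?thesis using fin by simp
qed

section \<open>The space of partition-valued paths\<close>

definition admissible :: "query \<Rightarrow> bool" where
  "admissible I \<longleftrightarrow> finite I \<and> (\<forall>(a, b, t)\<in>I. 0 \<le> t)"

lemma admissible_subset: "admissible I \<Longrightarrow> J \<subseteq> I \<Longrightarrow> admissible J"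
  unfolding admissible_def using finite_subset by blast

lemma pred_linked_on:
  assumes "\<And>t. 0 \<le> t \<Longrightarrow> (\<lambda>\<omega>. Y \<omega> t) \<in> N \<rightarrow>\<^sub>M partition_algebra" and I: "admissible I"
  shows "Measurable.pred N (\<lambda>\<omega>. linked_on (Y \<omega>) I)"
proof -
  have "Measurable.pred N (\<lambda>\<omega>. \<forall>x\<in>I. linked (Y \<omega> (snd (snd x))) (fst x) (fst (snd x)))"
    using assms by (intro pred_intros_finite pred_linked_comp) (auto simp: admissible_def)
  then show ?thesis by (simp add: linked_on_def case_prod_beta')
qed

lemma measurable_path_eval: "0 \<le> t \<Longrightarrow> (\<lambda>x. x t) \<in> path_algebra \<rightarrow>\<^sub>M partition_algebra"
  unfolding path_algebra_def by (rule measurable_component_singleton) auto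

lemma measurable_path:
  assumes "\<And>t. 0 \<le> t \<Longrightarrow> (\<lambda>\<omega>. Y \<omega> t) \<in> N \<rightarrow>\<^sub>M partition_algebra"
  shows "(\<lambda>\<omega>. \<lambda>t\<in>{0..}. Y \<omega> t) \<in> N \<rightarrow>\<^sub>M path_algebra"
  unfolding path_algebra_def using assms by (intro measurable_restrict) auto

definition path_event :: "query \<Rightarrow> (real \<Rightarrow> nat set set) set" where
  "path_event I = {x\<in>space path_algebra. linked_on x I}"

lemma path_event_in_sets: "admissible I \<Longrightarrow> path_event I \<in> sets path_algebra"
  unfolding path_event_def
  using pred_linked_on[OF measurable_path_eval] by (simp add: pred_def)

lemma path_event_empty: "path_event {} = space path_algebra"
  by (auto simp: path_event_def linked_on_def)

lemma path_event_Int: "path_event I \<inter> path_event J = path_event (I \<union> J)"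
  by (auto simp: path_event_def linked_on_def ball_Un)

lemma Int_stable_path_events: "Int_stable (path_event ` Collect admissible)"
  by (auto simp: Int_stable_def path_event_Int admissible_def intro!: imageI)

text \<open>The events of queries are closed under intersection because queries may be united; together with this
generation property it makes them determine a law on paths.\<close>

lemma sets_path_algebra:
  "sets path_algebra = sigma_sets (space path_algebra) (path_event ` Collect admissible)"
proof
  let ?S = "sigma (space path_algebra) (path_event ` Collect admissible)"
  have sub: "path_event ` Collect admissible \<subseteq> Pow (space path_algebra)"
    by (auto simp: path_event_def)
  have sets: "sets ?S = sigma_sets (space path_algebra) (path_event ` Collect admissible)"
    using sub by (rule sets_measure_of)
  have eval: "(\<lambda>x. x t) \<in> ?S \<rightarrow>\<^sub>M partition_algebra" if "0 \<le> t" for t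
  proof (rule measurable_partition_algebraI)
    have "{\<omega>\<in>space ?S. linked (\<omega> t) i j} = path_event {(i, j, t)}" for i j
      using sub by (auto simp: path_event_def linked_on_def)
    moreover have "path_event {(i, j, t)} \<in> sets ?S" for i j
      unfolding sets using that by (intro sigma_sets.Basic imageI) (auto simp: admissible_def)
    ultimately show "Measurable.pred ?S (\<lambda>\<omega>. linked (\<omega> t) i j)" for i j by (simp add: pred_def)
    show "partition_on (\<Union>(\<omega> t)) (\<omega> t)" if "\<omega> \<in> space ?S" for \<omega>
      using that \<open>0 \<le> t\<close> measurable_space[OF measurable_path_eval, of t \<omega>] sub
      by (auto simp: space_partition_algebra)
  qed
  have "{f \<in> space path_algebra. f i \<in> A} \<in> sets ?S" if "0 \<le> i" "A \<in> sets partition_algebra" for i A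
    using measurable_sets[OF eval[OF that(1)] that(2)] sub by (simp add: vimage_def Int_def conj_commute)
  then have "sigma_sets (space ?S) {{f \<in> space path_algebra. f i \<in> A} | i A. i \<in> {0..} \<and> A \<in> sets partition_algebra}
      \<subseteq> sets ?S"
    by (intro sets.sigma_sets_subset) auto
  moreover have "space ?S = space path_algebra" using sub by (rule space_measure_of)
  moreover have "sets path_algebra = sigma_sets (space path_algebra)
      {{f \<in> space path_algebra. f i \<in> A} | i A. i \<in> {0..} \<and> A \<in> sets partition_algebra}"
    unfolding path_algebra_def sets_PiM_single by (simp add: space_PiM)
  ultimately show "sets path_algebra \<subseteq> sigma_sets (space path_algebra) (path_event ` Collect admissible)"
    unfolding sets by simp
  show "sigma_sets (space path_algebra) (path_event ` Collect admissible) \<subseteq> sets path_algebra"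
    by (intro sets.sigma_sets_subset) (auto intro: path_event_in_sets)
qed

section \<open>Independent copies\<close>

text \<open>Only finitely many coordinates occur, so that the infinite product projects to a finite
one, where Fubini applies.\<close>

lemma integral_PiM_prod:
  fixes f :: "nat \<Rightarrow> 'c \<Rightarrow> real"
  assumes "prob_space \<mu>" and fin: "finite T"
    and f [measurable]: "\<And>k. f k \<in> borel_measurable \<mu>" and bd: "\<And>k x. \<bar>f k x\<bar> \<le> 1"
  shows "(\<integral>w. (\<Prod>k\<in>T. f k (w k)) \<partial>(PiM UNIV (\<lambda>_::nat. \<mu>))) = (\<Prod>k\<in>T. \<integral>x. f k x \<partial>\<mu>)"
proof -
  interpret \<mu>: prob_space \<mu> by fact
  interpret P: product_prob_space "\<lambda>_::nat. \<mu>" UNIV by unfold_locales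
  have restr: "PiM T (\<lambda>_::nat. \<mu>) = distr (PiM UNIV (\<lambda>_. \<mu>)) (PiM T (\<lambda>_. \<mu>)) (\<lambda>x. restrict x T)"
    using P.distr_PiM_restrict_finite[of T] fin by simp
  have "(\<integral>w. (\<Prod>k\<in>T. f k (w k)) \<partial>(PiM T (\<lambda>_. \<mu>))) =
      (\<integral>w. (\<Prod>k\<in>T. f k (restrict w T k)) \<partial>(PiM UNIV (\<lambda>_. \<mu>)))"
    by (subst restr, subst integral_distr) auto
  also have "\<dots> = (\<integral>w. (\<Prod>k\<in>T. f k (w k)) \<partial>(PiM UNIV (\<lambda>_. \<mu>)))"
    by (intro Bochner_Integration.integral_cong prod.cong) auto
  moreover have "(\<integral>w. (\<Prod>k\<in>T. f k (w k)) \<partial>(PiM T (\<lambda>_. \<mu>))) = (\<Prod>k\<in>T. \<integral>x. f k x \<partial>\<mu>)"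
    using fin bd by (intro P.product_integral_prod \<mu>.integrable_const_bound[where B=1]) auto
  ultimately show ?thesis by simp
qed

lemma measurable_fragment [measurable]:
  assumes P: "P \<in> space partition_algebra" and \<mu>: "sets \<mu> = sets partition_algebra"
  shows "fragment P \<in> PiM UNIV (\<lambda>_::nat. \<mu>) \<rightarrow>\<^sub>M partition_algebra"
proof (rule measurable_partition_algebraI)
  have P': "partition_on (\<Union>P) P" using P by (simp add: space_partition_algebra)
  have sp: "space \<mu> = space partition_algebra" using \<mu> by (rule sets_eq_imp_space_eq)
  show "partition_on (\<Union>(fragment P w)) (fragment P w)" if "w \<in> space (PiM UNIV (\<lambda>_. \<mu>))" for w
    using that by (intro partition_on_fragment P') (auto simp: space_PiM sp space_partition_algebra PiE_iff)
  have "(\<lambda>w. w n) \<in> PiM UNIV (\<lambda>_::nat. \<mu>) \<rightarrow>\<^sub>M partition_algebra" for n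
    using measurable_component_singleton[of n UNIV "\<lambda>_. \<mu>"]
    unfolding measurable_cong_sets[OF refl \<mu>] by simp
  then show "Measurable.pred (PiM UNIV (\<lambda>_::nat. \<mu>)) (\<lambda>w. linked (fragment P w) i j)" for i j
    unfolding linked_fragment_iff[OF P'] by measurable
qed

section \<open>Explicit transition probabilities\<close>

definition link_prob :: "'a measure \<Rightarrow> (real \<Rightarrow> 'a \<Rightarrow> nat set set) \<Rightarrow> query \<Rightarrow> real" where
  "link_prob M X I = measure M {\<omega>\<in>space M. linked_on (\<lambda>t. X t \<omega>) I}"

definition at_time :: "real \<Rightarrow> query \<Rightarrow> query" where
  "at_time s I = {x\<in>I. snd (snd x) = s}"

text \<open>The times are counted from \<open>s\<close> on, as they appear to the process restarted at \<open>s\<close>.\<close>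

definition after_time :: "real \<Rightarrow> query \<Rightarrow> query" where
  "after_time s I = (\<lambda>(a, b, t). (a, b, t - s)) ` {x\<in>I. s < snd (snd x)}"

lemma linked_on_split_time:
  assumes "\<And>a b t. (a, b, t) \<in> I \<Longrightarrow> s \<le> t"
  shows "linked_on x I \<longleftrightarrow> related_on (linked (x s)) (at_time s I) \<and> linked_on (\<lambda>u. x (s + u)) (after_time s I)"
proof -
  have I: "I = at_time s I \<union> {x\<in>I. s < snd (snd x)}" using assms unfolding at_time_def by fastforce
  have "linked_on x {x\<in>I. s < snd (snd x)} \<longleftrightarrow> linked_on (\<lambda>u. x (s + u)) (after_time s I)"
    by (auto simp: linked_on_def after_time_def)
  moreover have "linked_on x (at_time s I) \<longleftrightarrow> related_on (linked (x s)) (at_time s I)"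
    by (auto simp: linked_on_def related_on_def at_time_def)
  moreover have "linked_on x (A \<union> B) \<longleftrightarrow> linked_on x A \<and> linked_on x B" for A B
    by (simp add: linked_on_def ball_Un)
  ultimately show ?thesis by (subst I) simp
qed

lemma finite_at_after: "finite I \<Longrightarrow> finite (at_time s I)" "finite I \<Longrightarrow> finite (after_time s I)"
  by (auto simp: at_time_def after_time_def)

lemma admissible_at_after: "admissible I \<Longrightarrow> admissible (at_time s I)" "finite I \<Longrightarrow> admissible (after_time s I)"
  by (auto simp: at_time_def after_time_def admissible_def)

lemma block_product_linked:
  assumes P: "partition_on (\<Union>P) P" and I: "finite I" and q: "q {} = 1"
  shows "block_product q (linked P) I = of_bool (related_on (linked P) I) *
    (\<Prod>k\<in>block_min P ` fst ` I. q {x\<in>I. block_min P (fst x) = k})"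
proof (cases "related_on (linked P) I")
  case True
  have "linked P a a" if "a \<in> fst ` I" for a
    using that True by (fastforce simp: related_on_def linked_def)
  then have "block_product q (linked P) I = (\<Prod>k\<in>block_min P ` fst ` I. q {x\<in>I. block_min P (fst x) = k})"
    using True I q by (intro block_product_leader linked_iff_block_min[OF P]) auto
  then show ?thesis using True by simp
qed (simp add: block_product_def)

lemma pred_related_on:
  assumes "f \<in> N \<rightarrow>\<^sub>M partition_algebra" "finite J"
  shows "Measurable.pred N (\<lambda>\<omega>. related_on (linked (f \<omega>)) J)"
proof -
  have "Measurable.pred N (\<lambda>\<omega>. \<forall>x\<in>J. linked (f \<omega>) (fst x) (fst (snd x)))"
    using assms by (intro pred_intros_finite pred_linked_comp) auto
  then show ?thesis by (simp add: related_on_def case_prod_beta')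
qed

locale partition_process = prob_space M for M :: "'a measure" +
  fixes X :: "real \<Rightarrow> 'a \<Rightarrow> nat set set"
  assumes X_measurable: "0 \<le> t \<Longrightarrow> X t \<in> M \<rightarrow>\<^sub>M partition_algebra"
    and X_partition: "\<omega> \<in> space M \<Longrightarrow> 0 \<le> t \<Longrightarrow> partition_on UNIV (X t \<omega>)"
    and X_0: "\<omega> \<in> space M \<Longrightarrow> X 0 \<omega> = {UNIV}"
begin

abbreviation q :: "query \<Rightarrow> real" where
  "q \<equiv> link_prob M X"

lemma q_empty: "q {} = 1"
  by (simp add: link_prob_def linked_on_def prob_space)

lemma q_bounds: "0 \<le> q I" "q I \<le> 1"
  by (auto simp: link_prob_def)

lemma prob_space_path_law: "prob_space (path_law M X)"
  unfolding path_law_def by (intro prob_space_distr measurable_path X_measurable)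

lemma measure_path_law:
  assumes "admissible I"
  shows "measure (path_law M X) (path_event I) = q I"
proof -
  have "(\<lambda>\<omega>. \<lambda>t\<in>{0..}. X t \<omega>) -` path_event I \<inter> space M = {\<omega>\<in>space M. linked_on (\<lambda>t. X t \<omega>) I}"
    using measurable_space[OF measurable_path[of "\<lambda>\<omega> t. X t \<omega>" M], OF X_measurable] assms
    by (fastforce simp: path_event_def linked_on_def admissible_def)
  then show ?thesis
    unfolding path_law_def link_prob_def
    by (subst measure_distr) (auto intro!: measurable_path X_measurable path_event_in_sets assms)
qed

lemma measurable_frag_law_map:
  assumes P: "P \<in> space partition_algebra"
  shows "(\<lambda>w. \<lambda>t\<in>{0..}. fragment P (\<lambda>n. w n t)) \<in> PiM UNIV (\<lambda>_::nat. path_law M X) \<rightarrow>\<^sub>M path_algebra"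
proof (rule measurable_path)
  fix t :: real assume t: "0 \<le> t"
  have "(\<lambda>w. w n t) \<in> PiM UNIV (\<lambda>_::nat. path_law M X) \<rightarrow>\<^sub>M partition_algebra" for n
    using measurable_compose[OF measurable_component_singleton[of n UNIV "\<lambda>_. path_law M X"], of "\<lambda>x. x t" partition_algebra]
      measurable_path_eval[OF t] by (simp add: path_law_def)
  then have "(\<lambda>w n. w n t) \<in> PiM UNIV (\<lambda>_::nat. path_law M X) \<rightarrow>\<^sub>M PiM UNIV (\<lambda>_::nat. partition_algebra)"
    by (intro measurable_PiM_single') (auto dest: measurable_space)
  from measurable_compose[OF this measurable_fragment[OF P refl]]
  show "(\<lambda>w. fragment P (\<lambda>n. w n t)) \<in> PiM UNIV (\<lambda>_::nat. path_law M X) \<rightarrow>\<^sub>M partition_algebra" .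
qed

lemma prob_space_frag_law:
  "P \<in> space partition_algebra \<Longrightarrow> prob_space (frag_law M X P)"
  unfolding frag_law_def
  by (intro prob_space.prob_space_distr prob_space_PiM prob_space_path_law measurable_frag_law_map)

text \<open>The query cuts into parts that are put to distinct copies, indexed by the least elements of the
blocks of \<open>P\<close>, and distinct copies are independent.\<close>

lemma measure_frag_law:
  assumes P: "P \<in> space partition_algebra" and I: "admissible I"
  shows "measure (frag_law M X P) (path_event I) = block_product q (linked P) I"
proof -
  let ?D = "PiM UNIV (\<lambda>_::nat. path_law M X)"
  have P': "partition_on (\<Union>P) P" using P by (simp add: space_partition_algebra)
  have fin: "finite I" using I by (simp add: admissible_def)
  define T where "T = block_min P ` fst ` I"
  define I' where "I' k = {x\<in>I. block_min P (fst x) = k}" for k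
  have I'_adm: "admissible (I' k)" for k using I by (rule admissible_subset) (auto simp: I'_def)
  interpret D: prob_space ?D by (intro prob_space_PiM prob_space_path_law)
  have sp: "space ?D = (\<Pi>\<^sub>E n\<in>UNIV. space path_algebra)" by (simp add: space_PiM path_law_def)
  have meas: "(\<lambda>w. \<lambda>t\<in>{0..}. fragment P (\<lambda>n. w n t)) \<in> ?D \<rightarrow>\<^sub>M path_algebra"
    by (rule measurable_frag_law_map[OF P])
  have iff: "(\<lambda>t\<in>{0..}. fragment P (\<lambda>n. w n t)) \<in> path_event I \<longleftrightarrow>
      related_on (linked P) I \<and> (\<forall>k\<in>T. w k \<in> path_event (I' k))" if w: "w \<in> space ?D" for w
  proof -
    have "linked_on (\<lambda>t\<in>{0..}. fragment P (\<lambda>n. w n t)) I \<longleftrightarrow>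
        related_on (linked P) I \<and> (\<forall>k\<in>T. linked_on (w k) (I' k))"
      using I unfolding linked_on_def related_on_def admissible_def I'_def T_def
      by (auto simp: linked_fragment_iff[OF P'])
    then show ?thesis using w measurable_space[OF meas w] by (auto simp: path_event_def sp)
  qed
  have "measure (frag_law M X P) (path_event I) =
      measure ?D ((\<lambda>w. \<lambda>t\<in>{0..}. fragment P (\<lambda>n. w n t)) -` path_event I \<inter> space ?D)"
    unfolding frag_law_def by (rule measure_distr[OF meas path_event_in_sets[OF I]])
  also have "\<dots> = (\<integral>w. indicator ((\<lambda>w. \<lambda>t\<in>{0..}. fragment P (\<lambda>n. w n t)) -` path_event I \<inter> space ?D) w \<partial>?D)"
    by (subst Bochner_Integration.integral_indicator) auto
  also have "\<dots> = (\<integral>w. of_bool (related_on (linked P) I) * (\<Prod>k\<in>T. indicator (path_event (I' k)) (w k)) \<partial>?D)"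
  proof (rule Bochner_Integration.integral_cong[OF refl])
    fix w assume w: "w \<in> space ?D"
    have "(\<Prod>k\<in>T. indicator (path_event (I' k)) (w k) :: real) = of_bool (\<forall>k\<in>T. w k \<in> path_event (I' k))"
      using fin by (auto simp: T_def indicator_def prod_zero_iff intro!: prod.neutral)
    then show "indicator ((\<lambda>w. \<lambda>t\<in>{0..}. fragment P (\<lambda>n. w n t)) -` path_event I \<inter> space ?D) w =
        (of_bool (related_on (linked P) I) * (\<Prod>k\<in>T. indicator (path_event (I' k)) (w k)) :: real)"
      using iff[OF w] w by (auto simp: indicator_def)
  qed
  also have "\<dots> = of_bool (related_on (linked P) I) * (\<Prod>k\<in>T. q (I' k))"
  proof -
    have "(\<integral>w. (\<Prod>k\<in>T. indicator (path_event (I' k)) (w k)) \<partial>?D) =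
        (\<Prod>k\<in>T. \<integral>x. indicator (path_event (I' k)) x \<partial>path_law M X :: real)"
      using fin path_event_in_sets[OF I'_adm]
      by (intro integral_PiM_prod prob_space_path_law) (auto simp: T_def path_law_def indicator_def)
    then show ?thesis
      using measure_path_law[OF I'_adm] path_event_in_sets[OF I'_adm] by (simp add: path_law_def sets.Int_space_eq2)
  qed
  also have "\<dots> = block_product q (linked P) I"
    unfolding T_def I'_def by (rule block_product_linked[where q=q, OF P' fin q_empty, symmetric])
  finally show ?thesis .
qed

text \<open>Given that the process is in state \<open>Q\<close> at time \<open>s\<close>, this is the conditional probability that it answers
the query \<open>I\<close> positively, provided that the times of \<open>I\<close> are at least \<open>s\<close>.\<close>

definition renewal :: "real \<Rightarrow> query \<Rightarrow> nat set set \<Rightarrow> real" where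
  "renewal s I Q = of_bool (related_on (linked Q) (at_time s I)) * block_product q (linked Q) (after_time s I)"

lemma measurable_renewal [measurable]:
  assumes "finite I"
  shows "renewal s I \<in> borel_measurable partition_algebra"
proof -
  have [measurable]: "Measurable.pred partition_algebra (\<lambda>Q. related_on (linked Q) (at_time s I))"
    by (rule pred_related_on[OF measurable_ident finite_at_after(1)[OF assms], unfolded id_def])
  have [measurable]: "(\<lambda>Q. block_product q (linked Q) (after_time s I)) \<in> borel_measurable partition_algebra"
    using finite_at_after[OF assms] by (intro measurable_block_product) auto
  show ?thesis unfolding renewal_def by measurable
qed

lemma renewal_bounds: "0 \<le> renewal s I Q" "renewal s I Q \<le> 1" "\<bar>renewal s I Q\<bar> \<le> 1"
  using block_product_bounds[of q "linked Q", OF q_bounds] by (auto simp: renewal_def)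

lemma finite_range_renewal:
  assumes "finite I" shows "finite (range (renewal s I))"
proof (rule finite_subset)
  show "range (renewal s I) \<subseteq> (\<lambda>(b, J). of_bool b * (of_bool (fst J) * (\<Prod>J\<in>snd J. q J))) `
      (UNIV \<times> UNIV \<times> Pow (Pow (after_time s I)))"
  proof
    fix y assume "y \<in> range (renewal s I)"
    then obtain Q where "y = renewal s I Q" by auto
    then show "y \<in> (\<lambda>(b, J). of_bool b * (of_bool (fst J) * (\<Prod>J\<in>snd J. q J))) `
      (UNIV \<times> UNIV \<times> Pow (Pow (after_time s I)))"
      by (intro image_eqI[where x="(related_on (linked Q) (at_time s I),
          (related_on (linked Q) (after_time s I), block_queries (linked Q) (after_time s I)))"])
        (auto simp: renewal_def block_product_def block_queries_def)
  qed
  show "finite ((\<lambda>(b, J). of_bool b * (of_bool (fst J) * (\<Prod>J\<in>snd J. q J))) `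
      ((UNIV :: bool set) \<times> (UNIV :: bool set) \<times> Pow (Pow (after_time s I))))"
    using finite_at_after[OF assms] by simp
qed

text \<open>The renewal function of \<open>fragment P w\<close> is again a product over the blocks of \<open>P\<close>, by
\<open>block_product_split\<close>. This is the branching property behind the composition of two transition kernels.\<close>

lemma integral_frag_kernel:
  assumes P: "P \<in> space partition_algebra" and I: "finite I" and s: "0 \<le> s"
    and le: "\<And>a b t. (a, b, t) \<in> I \<Longrightarrow> s \<le> t"
  shows "(\<integral>Q. renewal s I Q \<partial>frag_kernel M X s P) = of_bool (related_on (linked P) I) *
    (\<Prod>k\<in>block_min P ` fst ` I. \<integral>\<omega>. renewal s {x\<in>I. block_min P (fst x) = k} (X s \<omega>) \<partial>M)"
proof -
  let ?\<mu> = "distr M partition_algebra (X s)"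
  let ?D = "PiM UNIV (\<lambda>_::nat. ?\<mu>)"
  have P': "partition_on (\<Union>P) P" using P by (simp add: space_partition_algebra)
  define T where "T = block_min P ` fst ` I"
  define I' where "I' k = {x\<in>I. block_min P (fst x) = k}" for k
  have finT: "finite T" using I by (simp add: T_def)
  have key: "renewal s I (fragment P w) = of_bool (related_on (linked P) I) * (\<Prod>k\<in>T. renewal s (I' k) (w k))" for w
  proof (cases "related_on (linked P) I")
    case False
    then obtain a b t where x: "(a, b, t) \<in> I" "\<not> linked P a b" by (auto simp: related_on_def)
    then have "\<not> related_on (linked (fragment P w)) (at_time s I) \<or> \<not> related_on (linked (fragment P w)) (after_time s I)"
      using le[OF x(1)] by (force simp: related_on_def at_time_def after_time_def linked_fragment_iff[OF P'])
    then show ?thesis using False by (auto simp: renewal_def block_product_def)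
  next
    case True
    have on: "linked P a b" if "(a, b, t) \<in> I" for a b t using that True by (auto simp: related_on_def)
    have self: "linked P a a" if "a \<in> fst ` I" for a using that on by (fastforce simp: linked_def)
    have 1: "related_on (linked (fragment P w)) (at_time s I) \<longleftrightarrow> (\<forall>k\<in>T. related_on (linked (w k)) (at_time s (I' k)))"
      using on by (auto simp: related_on_def at_time_def linked_fragment_iff[OF P'] I'_def T_def) metis
    have lab: "fst ` after_time s I \<subseteq> fst ` I" by (force simp: after_time_def)
    then have labT: "block_min P ` fst ` after_time s I \<subseteq> T" unfolding T_def by (rule image_mono)
    have sub: "{x\<in>after_time s I. block_min P (fst x) = k} = after_time s (I' k)" for k
      by (force simp: after_time_def I'_def)
    have "block_product q (linked (fragment P w)) (after_time s I) =
        (\<Prod>k\<in>T. block_product q (linked (w k)) {x\<in>after_time s I. block_min P (fst x) = k})"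
    proof (rule block_product_split)
      fix x y assume "x \<in> after_time s I" "y \<in> after_time s I"
      then have "linked P (fst x) (fst x)" "linked P (fst y) (fst y)" using lab self by blast+
      then show "linked (fragment P w) (fst x) (fst y) \<longleftrightarrow> block_min P (fst x) = block_min P (fst y) \<and>
          linked (w (block_min P (fst x))) (fst x) (fst y)"
        by (simp add: linked_fragment_iff[OF P'] linked_iff_block_min[OF P'])
    next
      fix a b t assume "(a, b, t) \<in> after_time s I"
      then have "linked P a b" using on by (auto simp: after_time_def)
      then show "linked (fragment P w) a b \<longleftrightarrow> linked (w (block_min P a)) a b"
        by (simp add: linked_fragment_iff[OF P'])
    qed (use labT finite_at_after[OF I] finT in \<open>auto simp: linked_def\<close>)
    moreover have "(of_bool (\<forall>k\<in>T. related_on (linked (w k)) (at_time s (I' k))) :: real) =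
        (\<Prod>k\<in>T. of_bool (related_on (linked (w k)) (at_time s (I' k))))"
      using finT by (auto intro!: prod.neutral[symmetric] simp: prod_zero_iff)
    ultimately show ?thesis using True by (simp add: renewal_def 1 sub prod.distrib)
  qed
  have meas: "fragment P \<in> ?D \<rightarrow>\<^sub>M partition_algebra" by (rule measurable_fragment[OF P]) simp
  have finI': "finite (I' k)" for k using I by (simp add: I'_def)
  have "(\<integral>Q. renewal s I Q \<partial>frag_kernel M X s P) = (\<integral>w. renewal s I (fragment P w) \<partial>?D)"
    unfolding frag_kernel_def by (rule integral_distr[OF meas measurable_renewal[OF I]])
  also have "\<dots> = of_bool (related_on (linked P) I) * (\<integral>w. (\<Prod>k\<in>T. renewal s (I' k) (w k)) \<partial>?D)"
    by (simp add: key)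
  also have "(\<integral>w. (\<Prod>k\<in>T. renewal s (I' k) (w k)) \<partial>?D) = (\<Prod>k\<in>T. \<integral>Q. renewal s (I' k) Q \<partial>?\<mu>)"
    using finT measurable_renewal[OF finI']
    by (intro integral_PiM_prod prob_space_distr X_measurable s renewal_bounds) auto
  also have "\<dots> = (\<Prod>k\<in>T. \<integral>\<omega>. renewal s (I' k) (X s \<omega>) \<partial>M)"
    by (intro prod.cong refl integral_distr X_measurable s measurable_renewal finI')
  finally show ?thesis by (simp add: T_def I'_def)
qed

end

section \<open>The Markov property at several times\<close>

text \<open>A function with finitely many values is a combination of indicators of events, and to each of these
events the defining property of the conditional law applies.\<close>

lemma cond_law_integral:
  fixes \<psi> :: "'b \<Rightarrow> real"
  assumes "prob_space M" and law: "has_cond_law M G Y N \<kappa>"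
    and \<psi>: "\<psi> \<in> borel_measurable N" and fin: "finite (range \<psi>)"
    and \<kappa>: "\<And>\<omega>. \<omega> \<in> space M \<Longrightarrow> sets (\<kappa> \<omega>) = sets N \<and> finite_measure (\<kappa> \<omega>)"
    and \<Psi>: "\<Psi> \<in> borel_measurable M" "\<And>\<omega>. \<omega> \<in> space M \<Longrightarrow> (\<integral>x. \<psi> x \<partial>\<kappa> \<omega>) = \<Psi> \<omega>"
    and H: "H \<in> sets G"
  shows "(\<integral>\<omega>. indicator H \<omega> * \<psi> (Y \<omega>) \<partial>M) = (\<integral>\<omega>. indicator H \<omega> * \<Psi> \<omega> \<partial>M)"
proof -
  interpret prob_space M by fact
  have sub: "subalgebra M G" and Y: "Y \<in> M \<rightarrow>\<^sub>M N" using law by (auto simp: has_cond_law_def)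
  interpret finite_measure_subalgebra M G by unfold_locales (rule sub)
  have H': "H \<in> sets M" using H sub by (auto simp: subalgebra_def)
  define V where "V = range \<psi>"
  define E where "E v = \<psi> -` {v} \<inter> space N" for v
  define c where "c v = real_cond_exp M G (indicator (Y -` E v \<inter> space M))" for v
  have E: "E v \<in> sets N" for v unfolding E_def by (intro measurable_sets[OF \<psi>]) simp
  have YE [measurable]: "Y -` E v \<inter> space M \<in> sets M" for v using measurable_sets[OF Y E] .
  have simple: "\<psi> x = (\<Sum>v\<in>V. v * indicator (E v) x)" if "x \<in> space N" for x
  proof -
    have "(\<Sum>v\<in>V. v * indicator (E v) x) = (\<Sum>v\<in>V. if v = \<psi> x then v else 0)"
      using that by (intro sum.cong) (auto simp: E_def indicator_def)
    then show ?thesis using fin by (simp add: V_def)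
  qed
  have int: "integrable M (\<lambda>\<omega>. indicator H \<omega> * indicator (Y -` E v \<inter> space M) \<omega> :: real)" for v
  proof (rule integrable_const_bound[where B=1])
    show "AE \<omega> in M. norm (indicator H \<omega> * indicator (Y -` E v \<inter> space M) \<omega> :: real) \<le> 1"
      by (simp add: indicator_def)
  qed (use H' in measurable)
  note cond = real_cond_exp_intg[OF int, of _, folded c_def, OF borel_measurable_indicator[OF H] borel_measurable_indicator[OF YE]]
  have "(\<integral>\<omega>. indicator H \<omega> * \<psi> (Y \<omega>) \<partial>M) =
      (\<integral>\<omega>. (\<Sum>v\<in>V. v * (indicator H \<omega> * indicator (Y -` E v \<inter> space M) \<omega>)) \<partial>M)"
    by (intro Bochner_Integration.integral_cong refl)
      (simp add: simple measurable_space[OF Y] sum_distrib_left indicator_def mult_ac)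
  also have "\<dots> = (\<Sum>v\<in>V. v * (\<integral>\<omega>. indicator H \<omega> * indicator (Y -` E v \<inter> space M) \<omega> \<partial>M))"
    using int by (subst Bochner_Integration.integral_sum) auto
  also have "\<dots> = (\<Sum>v\<in>V. v * (\<integral>\<omega>. indicator H \<omega> * c v \<omega> \<partial>M))"
    by (simp add: cond)
  also have "\<dots> = (\<integral>\<omega>. (\<Sum>v\<in>V. v * (indicator H \<omega> * c v \<omega>)) \<partial>M)"
    using cond(1) by (subst Bochner_Integration.integral_sum) auto
  also have "\<dots> = (\<integral>\<omega>. indicator H \<omega> * \<Psi> \<omega> \<partial>M)"
  proof (rule integral_cong_AE)
    have "AE \<omega> in M. \<forall>v\<in>V. c v \<omega> = measure (\<kappa> \<omega>) (E v)"
      using law E fin by (intro AE_finite_allI) (auto simp: has_cond_law_def c_def V_def)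
    then show "AE \<omega> in M. (\<Sum>v\<in>V. v * (indicator H \<omega> * c v \<omega>)) = indicator H \<omega> * \<Psi> \<omega>"
    proof eventually_elim
      case (elim \<omega>)
      show ?case
      proof (cases "\<omega> \<in> H")
        case True
        then have \<omega>: "\<omega> \<in> space M" using sets.sets_into_space[OF H'] by auto
        interpret \<kappa>: finite_measure "\<kappa> \<omega>" using \<kappa>[OF \<omega>] by auto
        have EK: "E v \<in> sets (\<kappa> \<omega>)" for v using E \<kappa>[OF \<omega>] by auto
        have sp: "space (\<kappa> \<omega>) = space N" using \<kappa>[OF \<omega>] sets_eq_imp_space_eq by blast
        have "\<Psi> \<omega> = (\<integral>x. (\<Sum>v\<in>V. v * indicator (E v) x) \<partial>\<kappa> \<omega>)"
          unfolding \<Psi>(2)[OF \<omega>, symmetric] by (intro Bochner_Integration.integral_cong refl simple) (simp add: sp)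
        also have "\<dots> = (\<Sum>v\<in>V. v * measure (\<kappa> \<omega>) (E v))"
          using EK sets.sets_into_space[OF EK]
          by (subst Bochner_Integration.integral_sum)
            (auto intro!: sum.cong \<kappa>.integrable_const_bound[where B=1] simp: Int_absorb2)
        finally show ?thesis using True elim by simp
      qed simp
    qed
  qed (use H' \<Psi>(1) in \<open>auto simp: c_def\<close>)
  finally show ?thesis .
qed

locale markov_partition_process = partition_process M X for M :: "'a measure" and X +
  fixes F :: "real \<Rightarrow> 'a measure"
  assumes filtration: "filtration (space M) F"
    and subalg: "subalgebra M (F t)"
    and markov: "markov_wrt M X F"
begin

lemma space_F: "space (F t) = space M"
  using subalg by (simp add: subalgebra_def)

lemma sets_F_mono: "s \<le> t \<Longrightarrow> sets (F s) \<subseteq> sets (F t)"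
  using filtration.sets_F_mono[OF filtration] .

lemma X_adapted: "0 \<le> t \<Longrightarrow> X t \<in> F t \<rightarrow>\<^sub>M partition_algebra"
  using markov by (simp add: markov_wrt_def)

lemma X_in_space: "\<omega> \<in> space M \<Longrightarrow> 0 \<le> t \<Longrightarrow> X t \<omega> \<in> space partition_algebra"
  using measurable_space[OF X_measurable] .

lemma finite_measure_frag_kernel:
  assumes "P \<in> space partition_algebra" "0 \<le> s"
  shows "sets (frag_kernel M X s P) = sets partition_algebra \<and> finite_measure (frag_kernel M X s P)"
proof -
  have "prob_space (frag_kernel M X s P)"
    unfolding frag_kernel_def using assms
    by (intro prob_space.prob_space_distr prob_space_PiM prob_space_distr X_measurable measurable_fragment) auto
  then show ?thesis by (simp add: prob_space_def frag_kernel_def)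
qed

text \<open>Induction on the number of distinct times of the query. With \<open>t\<close> the first of them, conditioning at
time \<open>s + t\<close> leaves a query with one time less, whose answer is \<open>renewal t I (X (s + t))\<close>; the transition
kernel from \<open>s\<close> to \<open>s + t\<close> then splits this into a product over the blocks of \<open>X s\<close>. Each
factor is \<open>q\<close> of the part of \<open>I\<close> in that block, by the same conditioning applied to the process
started at time \<open>0\<close>.\<close>

lemma markov_queries:
  assumes "admissible I" "0 \<le> s" "H \<in> sets (F s)"
  shows "measure M (H \<inter> {\<omega>\<in>space M. linked_on (\<lambda>u. X (s + u) \<omega>) I}) =
    (\<integral>\<omega>. indicator H \<omega> * block_product q (linked (X s \<omega>)) I \<partial>M)"
  using assms
proof (induction "card ((snd \<circ> snd) ` I)" arbitrary: I s H rule: less_induct)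
  case less
  have H_M: "H \<in> sets M" if "H \<in> sets (F r)" for H r using that subalg by (auto simp: subalgebra_def)
  have finI: "finite I" using less.prems by (simp add: admissible_def)
  show ?case
  proof (cases "I = {}")
    case True
    then show ?thesis
      using H_M[OF less.prems(3)] sets.sets_into_space[OF H_M[OF less.prems(3)]]
      by (simp add: linked_on_def block_product_def block_queries_def related_on_def Int_absorb2)
  next
    case False
    define t where "t = Min ((snd \<circ> snd) ` I)"
    have t_in: "t \<in> (snd \<circ> snd) ` I" unfolding t_def using False finI by (intro Min_in) auto
    have t_le: "t \<le> r" if "(a, b, r) \<in> I" for a b r
      unfolding t_def using finI that by (intro Min_le) (auto simp: image_iff intro!: bexI[of _ "(a, b, r)"])
    have t_nn: "0 \<le> t" using t_in less.prems(1) by (auto simp: admissible_def)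
    have step: "measure M (H \<inter> {\<omega>\<in>space M. linked_on (\<lambda>u. X (r + u) \<omega>) J}) =
        (\<integral>\<omega>. indicator H \<omega> * renewal t J (X (r + t) \<omega>) \<partial>M)"
      if J: "J \<subseteq> I" and r: "0 \<le> r" and H: "H \<in> sets (F r)" for J r H
    proof -
      define K where "K = {\<omega>\<in>space M. related_on (linked (X (r + t) \<omega>)) (at_time t J)}"
      have finJ: "finite J" using J finI finite_subset by auto
      have "K \<in> sets (F (r + t))"
        using pred_related_on[OF X_adapted finite_at_after(1)[OF finJ], of "r + t" t] r t_nn
        by (simp add: K_def pred_def space_F)
      moreover have "H \<in> sets (F (r + t))" using sets_F_mono[of r "r + t"] H t_nn by auto
      ultimately have HK: "H \<inter> K \<in> sets (F (r + t))" by simp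
      have "(snd \<circ> snd) ` after_time t J \<subseteq> (\<lambda>u. u - t) ` ((snd \<circ> snd) ` I - {t})"
        using J by (force simp: after_time_def)
      then have "card ((snd \<circ> snd) ` after_time t J) \<le> card ((snd \<circ> snd) ` I - {t})"
        using finI by (meson card_image_le card_mono dual_order.trans finite_Diff finite_imageI)
      also have "\<dots> < card ((snd \<circ> snd) ` I)" using t_in finI by (intro psubset_card_mono) auto
      finally have card: "card ((snd \<circ> snd) ` after_time t J) < card ((snd \<circ> snd) ` I)" .
      have "linked_on (\<lambda>u. X (r + u) \<omega>) J \<longleftrightarrow> related_on (linked (X (r + t) \<omega>)) (at_time t J) \<and>
          linked_on (\<lambda>u. X (r + t + u) \<omega>) (after_time t J)" for \<omega>
        using linked_on_split_time[of J t "\<lambda>u. X (r + u) \<omega>"] t_le J by (auto simp: add_ac)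
      then have "H \<inter> {\<omega>\<in>space M. linked_on (\<lambda>u. X (r + u) \<omega>) J} =
          (H \<inter> K) \<inter> {\<omega>\<in>space M. linked_on (\<lambda>u. X (r + t + u) \<omega>) (after_time t J)}"
        by (auto simp: K_def)
      then have "measure M (H \<inter> {\<omega>\<in>space M. linked_on (\<lambda>u. X (r + u) \<omega>) J}) =
          (\<integral>\<omega>. indicator (H \<inter> K) \<omega> * block_product q (linked (X (r + t) \<omega>)) (after_time t J) \<partial>M)"
        using less.hyps[OF card admissible_at_after(2)[OF finJ] _ HK] r t_nn by simp
      also have "\<dots> = (\<integral>\<omega>. indicator H \<omega> * renewal t J (X (r + t) \<omega>) \<partial>M)"
        by (intro Bochner_Integration.integral_cong refl) (auto simp: renewal_def K_def indicator_def)
      finally show ?thesis .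
    qed
    \<comment> \<open>The case \<open>r = 0\<close> of the previous identity, where the process starts from a single block.\<close>
    have q_step: "(\<integral>\<omega>. renewal t J (X t \<omega>) \<partial>M) = q J" if "J \<subseteq> I" for J
    proof -
      have "space M \<in> sets (F 0)" using sets.top[of "F 0"] by (simp add: space_F)
      from step[OF that _ this]
      have "q J = (\<integral>\<omega>. indicator (space M) \<omega> * renewal t J (X t \<omega>) \<partial>M)"
        by (simp add: link_prob_def Int_def)
      also have "\<dots> = (\<integral>\<omega>. renewal t J (X t \<omega>) \<partial>M)" by (intro Bochner_Integration.integral_cong refl) auto
      finally show ?thesis by simp
    qed
    have "(\<integral>\<omega>. indicator H \<omega> * renewal t I (X (s + t) \<omega>) \<partial>M) =
        (\<integral>\<omega>. indicator H \<omega> * block_product q (linked (X s \<omega>)) I \<partial>M)"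
    proof (rule cond_law_integral[OF prob_space_axioms, where Y = "X (s + t)" and \<psi> = "renewal t I"])
      show "has_cond_law M (F s) (X (s + t)) partition_algebra (\<lambda>\<omega>. frag_kernel M X t (X s \<omega>))"
        using markov less.prems(2) t_nn by (simp add: markov_wrt_def)
      show "(\<lambda>\<omega>. block_product q (linked (X s \<omega>)) I) \<in> borel_measurable M"
        using X_measurable[OF less.prems(2)] finI by (intro measurable_block_product pred_linked_comp) auto
      fix \<omega> assume \<omega>: "\<omega> \<in> space M"
      have P: "X s \<omega> \<in> space partition_algebra" using X_in_space \<omega> less.prems(2) by simp
      then have P': "partition_on (\<Union>(X s \<omega>)) (X s \<omega>)" by (simp add: space_partition_algebra)
      show "sets (frag_kernel M X t (X s \<omega>)) = sets partition_algebra \<and> finite_measure (frag_kernel M X t (X s \<omega>))"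
        by (rule finite_measure_frag_kernel[OF P t_nn])
      show "(\<integral>Q. renewal t I Q \<partial>frag_kernel M X t (X s \<omega>)) = block_product q (linked (X s \<omega>)) I"
        using integral_frag_kernel[OF P finI t_nn t_le] block_product_linked[where q=q, OF P' finI q_empty]
        by (simp add: q_step)
    qed (use less.prems finI measurable_renewal finite_range_renewal in auto)
    then show ?thesis using step[OF subset_refl less.prems(2,3)] by simp
  qed
qed

end

section \<open>The path and its detachment times\<close>

lemma partition_eqI:
  assumes P: "partition_on UNIV P" and Q: "partition_on UNIV Q" and "linked P = linked Q"
  shows "P = Q"
proof -
  have blocks: "R = range (block_of R)" if R: "partition_on UNIV R" for R
  proof
    show "R \<subseteq> range (block_of R)"
    proof
      fix B assume B: "B \<in> R"
      then obtain a where "a \<in> B" using partition_onD3[OF R] by (metis ex_in_conv)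
      then show "B \<in> range (block_of R)" using block_of_eq[OF R B] by blast
    qed
    show "range (block_of R) \<subseteq> R" using block_of_in(1)[OF R] by blast
  qed
  have "block_of P a = block_of Q a" for a
    using linked_iff_mem_block[OF P, of a] linked_iff_mem_block[OF Q, of a] assms(3) by auto
  then show ?thesis using blocks[OF P] blocks[OF Q] by simp
qed

lemma linked_sym: "linked P a b \<Longrightarrow> linked P b a"
  by (auto simp: linked_def)

lemma linked_trans:
  "partition_on S P \<Longrightarrow> linked P a b \<Longrightarrow> linked P b c \<Longrightarrow> linked P a c"
  unfolding linked_def using block_of_eq by metis

lemma linked_refl: "partition_on UNIV P \<Longrightarrow> linked P a a"
  using block_of_in by (metis UNIV_I linked_def)

locale markovian_spine = markov_partition_process M X F for M :: "'a measure" and X F +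
  fixes A :: "real \<Rightarrow> 'a \<Rightarrow> nat set"
  assumes refining: "\<omega> \<in> space M \<Longrightarrow> 0 \<le> s \<Longrightarrow> s \<le> t \<Longrightarrow> refines UNIV (X t \<omega>) (X s \<omega>)"
    and right_cont: "\<omega> \<in> space M \<Longrightarrow> right_cont_partitions (\<lambda>t. X t \<omega>)"
    and A_block: "\<omega> \<in> space M \<Longrightarrow> 0 \<le> t \<Longrightarrow> A t \<omega> \<in> X t \<omega>"
    and A_antimono: "\<omega> \<in> space M \<Longrightarrow> 0 \<le> s \<Longrightarrow> s \<le> t \<Longrightarrow> A t \<omega> \<subseteq> A s \<omega>"
    and A_adapted: "0 \<le> t \<Longrightarrow> A t \<in> F t \<rightarrow>\<^sub>M subset_algebra"
    and A_markovian: "0 \<le> s \<Longrightarrow> cond_indep M (F s)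
        (\<lambda>\<omega>. \<lambda>t\<in>{s..}. (A t \<omega>, restr (A s \<omega>) (X t \<omega>)))
          (PiM {s..} (\<lambda>_. subset_algebra \<Otimes>\<^sub>M partition_algebra))
        (\<lambda>\<omega>. \<lambda>t\<in>{s..}. restr (- A s \<omega>) (X t \<omega>)) (PiM {s..} (\<lambda>_. partition_algebra))"
begin

lemma linked_antimono:
  assumes "\<omega> \<in> space M" "0 \<le> s" "s \<le> t" "linked (X t \<omega>) a b"
  shows "linked (X s \<omega>) a b"
  using refining[OF assms(1-3)] assms(4) unfolding refines_def linked_def by blast

lemma A_closed:
  assumes \<omega>: "\<omega> \<in> space M" and t: "0 \<le> t" and ab: "linked (X t \<omega>) a b"
  shows "a \<in> A t \<omega> \<longleftrightarrow> b \<in> A t \<omega>"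
proof -
  obtain B where B: "B \<in> X t \<omega>" "a \<in> B" "b \<in> B" using ab by (auto simp: linked_def)
  then show ?thesis using block_of_eq[OF X_partition[OF \<omega> t]] A_block[OF \<omega> t] by metis
qed

lemma linked_A:
  "\<omega> \<in> space M \<Longrightarrow> 0 \<le> t \<Longrightarrow> a \<in> A t \<omega> \<Longrightarrow> b \<in> A t \<omega> \<Longrightarrow> linked (X t \<omega>) a b"
  using A_block by (auto simp: linked_def)

lemma A_0: "\<omega> \<in> space M \<Longrightarrow> A 0 \<omega> = UNIV"
  using A_block[of \<omega> 0] X_0 by auto

lemma linked_right_cont:
  assumes \<omega>: "\<omega> \<in> space M" and t: "0 \<le> t"
  shows "\<forall>\<^sub>F u in at_right t. linked (X u \<omega>) a b \<longleftrightarrow> linked (X t \<omega>) a b"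
proof -
  have "\<forall>\<^sub>F u in at_right t. restr {..max a b} (X u \<omega>) = restr {..max a b} (X t \<omega>)"
    using right_cont[OF \<omega>] t by (simp add: right_cont_partitions_def)
  then show ?thesis
  proof eventually_elim
    case (elim u)
    then show ?case using linked_restr[of "{..max a b}" _ a b] by (metis atMost_iff max.cobounded1 max.cobounded2)
  qed
qed

text \<open>A label \<open>k\<close> that stays on the path until \<open>t + 1\<close> is linked to \<open>n\<close> at time \<open>t\<close>. By right-continuity of
the partitions it remains linked to \<open>n\<close> for a while, and so keeps \<open>n\<close> on the path.\<close>

lemma A_right_cont:
  assumes \<omega>: "\<omega> \<in> space M" and t: "0 \<le> t" and n: "n \<in> A t \<omega>"
  shows "\<forall>\<^sub>F u in at_right t. n \<in> A u \<omega>"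
proof -
  have "A (t + 1) \<omega> \<noteq> {}" using A_block[OF \<omega>, of "t + 1"] X_partition[OF \<omega>, of "t + 1"] t
    by (auto simp: partition_on_def)
  \<comment> \<open>Any later time serves; the witness only has to remain on the path in a right neighbourhood of \<open>t\<close>.\<close>
  then obtain k where k: "k \<in> A (t + 1) \<omega>" by auto
  have "k \<in> A t \<omega>" using A_antimono[OF \<omega> t, of "t + 1"] k by auto
  then have "linked (X t \<omega>) n k" using linked_A \<omega> t n by auto
  then have "\<forall>\<^sub>F u in at_right t. linked (X u \<omega>) n k"
    using linked_right_cont[OF \<omega> t, of n k] by simp
  moreover have "\<forall>\<^sub>F u in at_right t. u \<in> {t<..<t + 1}" by (rule eventually_at_right_real) simp
  ultimately show ?thesis
  proof eventually_elim
    case (elim u)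
    then have "k \<in> A u \<omega>" using A_antimono[OF \<omega>, of u "t + 1"] k t by auto
    then show ?case using A_closed[OF \<omega>, of u n k] elim t by auto
  qed
qed

abbreviation \<sigma> :: "nat \<Rightarrow> 'a \<Rightarrow> ereal" where
  "\<sigma> \<equiv> detach_time A"

text \<open>Right-continuity of the path makes the infimum in the detachment time attained: at that time the
label has already left.\<close>

lemma mem_A_iff:
  assumes \<omega>: "\<omega> \<in> space M" and t: "0 \<le> t"
  shows "n \<in> A t \<omega> \<longleftrightarrow> ereal t < \<sigma> n \<omega>"
proof
  assume "n \<in> A t \<omega>"
  then obtain b where b: "t < b" "\<And>u. t < u \<Longrightarrow> u < b \<Longrightarrow> n \<in> A u \<omega>"
    using A_right_cont[OF \<omega> t] by (auto simp: eventually_at_right_field)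
  have "ereal b \<le> \<sigma> n \<omega>"
    unfolding detach_time_def
  proof (rule INF_greatest)
    fix u assume u: "u \<in> {t. 0 \<le> t \<and> n \<notin> A t \<omega>}"
    then have "t < u" using A_antimono[OF \<omega>, of u t] \<open>n \<in> A t \<omega>\<close> by (metis linorder_not_le mem_Collect_eq subsetD)
    then show "ereal b \<le> ereal u" using b(2)[of u] u by force
  qed
  moreover have "ereal t < ereal b" using b(1) by simp
  ultimately show "ereal t < \<sigma> n \<omega>" by (rule order.strict_trans2[rotated])
next
  assume "ereal t < \<sigma> n \<omega>"
  then show "n \<in> A t \<omega>" unfolding detach_time_def using t by (auto dest: less_INF_D)
qed

lemma \<sigma>_pos: "\<omega> \<in> space M \<Longrightarrow> 0 < \<sigma> n \<omega>"
  using mem_A_iff[of \<omega> 0 n] A_0 by (simp add: zero_ereal_def)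

lemma \<sigma>_cases:
  assumes "\<omega> \<in> space M"
  obtains (infinite) "\<sigma> n \<omega> = \<infinity>" | (finite) s where "\<sigma> n \<omega> = ereal s" "0 < s"
  using \<sigma>_pos[OF assms, of n] by (cases "\<sigma> n \<omega>") auto

text \<open>Labels that are linked when one of them leaves the path have been together before, and so
leave it together. This makes the spinal blocks a partition.\<close>

lemma \<sigma>_eq_if_linked:
  assumes \<omega>: "\<omega> \<in> space M" and a: "\<sigma> a \<omega> = ereal s" and t: "s \<le> t" and ab: "linked (X t \<omega>) a b"
  shows "\<sigma> b \<omega> = \<sigma> a \<omega>"
proof -
  have s: "0 < s" using \<sigma>_pos[OF \<omega>, of a] a by simp
  have "b \<notin> A s \<omega>"
    using A_closed[OF \<omega> _ linked_antimono[OF \<omega> _ t ab]] mem_A_iff[OF \<omega>, of s a] s a by auto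
  then have "\<sigma> b \<omega> \<le> ereal s" using mem_A_iff[OF \<omega>, of s b] s by auto
  moreover have "\<not> \<sigma> b \<omega> < ereal s"
  proof
    assume less: "\<sigma> b \<omega> < ereal s"
    then obtain r where r: "\<sigma> b \<omega> = ereal r" "0 < r" using \<sigma>_pos[OF \<omega>, of b] by (cases "\<sigma> b \<omega>") auto
    then have "r < s" using less by simp
    then have "a \<in> A r \<omega>" using mem_A_iff[OF \<omega>, of r a] r a by simp
    then have "b \<in> A r \<omega>"
      using A_closed[OF \<omega> _ linked_antimono[OF \<omega> _ _ ab], of r] r t \<open>r < s\<close> by simp
    then show False using mem_A_iff[OF \<omega>, of r b] r by simp
  qed
  ultimately show ?thesis using a by simp
qed

section \<open>The spinal partition\<close>

text \<open>The relation \<open>linked (spinal X A t \<omega>)\<close> expressed by the detachment times; see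
\<open>linked_spinal\<close>.\<close>

definition spine_linked :: "real \<Rightarrow> 'a \<Rightarrow> nat \<Rightarrow> nat \<Rightarrow> bool" where
  "spine_linked t \<omega> a b \<longleftrightarrow> \<sigma> a \<omega> = \<sigma> b \<omega> \<and>
     (if \<sigma> a \<omega> = \<infinity> then a = b else linked (X (real_of_ereal (\<sigma> a \<omega>) + t) \<omega>) a b)"

lemma linked_singletons: "linked (range (\<lambda>n. {n})) a b \<longleftrightarrow> a = b"
  by (auto simp: linked_def)

lemma partition_at_ext_time:
  assumes \<omega>: "\<omega> \<in> space M" and t: "0 \<le> t"
  shows "partition_on UNIV (at_ext_time X (\<sigma> n \<omega> + ereal t) \<omega>)"
proof (cases rule: \<sigma>_cases[OF \<omega>, of n])
  case 1
  then show ?thesis by (auto simp: at_ext_time_def partition_on_def disjoint_def)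
next
  case (2 s)
  then show ?thesis using X_partition[OF \<omega>, of "s + t"] t by (simp add: at_ext_time_def)
qed

lemma linked_at_ext_time:
  assumes \<omega>: "\<omega> \<in> space M" and t: "0 \<le> t"
  shows "linked (at_ext_time X (\<sigma> a \<omega> + ereal t) \<omega>) a b \<longleftrightarrow> spine_linked t \<omega> a b"
proof (cases rule: \<sigma>_cases[OF \<omega>, of a])
  case 1
  then show ?thesis by (auto simp: at_ext_time_def spine_linked_def linked_singletons)
next
  case (2 s)
  then show ?thesis using \<sigma>_eq_if_linked[OF \<omega>, of a s "s + t" b] t
    by (auto simp: at_ext_time_def spine_linked_def)
qed

lemma mem_spinal_block:
  assumes \<omega>: "\<omega> \<in> space M" and t: "0 \<le> t"
  shows "b \<in> block_of (at_ext_time X (\<sigma> a \<omega> + ereal t) \<omega>) a \<longleftrightarrow> spine_linked t \<omega> a b"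
  using linked_iff_mem_block[OF partition_at_ext_time[OF assms]] linked_at_ext_time[OF assms] by simp

lemma spine_linked_sym: "spine_linked t \<omega> a b \<Longrightarrow> spine_linked t \<omega> b a"
  unfolding spine_linked_def using linked_sym by metis

lemma spine_linked_equiv:
  assumes \<omega>: "\<omega> \<in> space M" and t: "0 \<le> t"
  shows "spine_linked t \<omega> a a"
    and "spine_linked t \<omega> a b \<Longrightarrow> spine_linked t \<omega> b c \<Longrightarrow> spine_linked t \<omega> a c"
proof -
  show "spine_linked t \<omega> a a"
    using mem_spinal_block[OF assms] block_of_in(2)[OF partition_at_ext_time[OF assms]] by blast
  assume "spine_linked t \<omega> a b" "spine_linked t \<omega> b c"
  then show "spine_linked t \<omega> a c"
    using linked_at_ext_time[OF assms, of a] linked_at_ext_time[OF assms, of b]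
      linked_trans[OF partition_at_ext_time[OF assms]] unfolding spine_linked_def by metis
qed

lemma spinal_eq:
  assumes \<omega>: "\<omega> \<in> space M" and t: "0 \<le> t"
  shows "spinal X A t \<omega> = range (\<lambda>n. Collect (spine_linked t \<omega> n))"
proof -
  have "block_of (at_ext_time X (\<sigma> n \<omega> + ereal t) \<omega>) n = Collect (spine_linked t \<omega> n)" for n
    using mem_spinal_block[OF assms] by auto
  then show ?thesis by (simp add: spinal_def)
qed

lemma linked_spinal:
  assumes \<omega>: "\<omega> \<in> space M" and t: "0 \<le> t"
  shows "linked (spinal X A t \<omega>) a b \<longleftrightarrow> spine_linked t \<omega> a b"
proof -
  have "linked (spinal X A t \<omega>) a b \<longleftrightarrow> (\<exists>n. spine_linked t \<omega> n a \<and> spine_linked t \<omega> n b)"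
    unfolding spinal_eq[OF assms] linked_def by auto
  then show ?thesis
    using spine_linked_equiv[OF assms] spine_linked_sym[of t \<omega>] by metis
qed

lemma partition_spinal:
  assumes \<omega>: "\<omega> \<in> space M" and t: "0 \<le> t"
  shows "partition_on UNIV (spinal X A t \<omega>)"
proof (rule partition_onI)
  show "\<Union>(spinal X A t \<omega>) = UNIV"
    unfolding spinal_eq[OF assms] using spine_linked_equiv(1)[OF assms] by auto
  show "{} \<notin> spinal X A t \<omega>"
    unfolding spinal_eq[OF assms] using spine_linked_equiv(1)[OF assms] by auto
  fix B C assume "B \<in> spinal X A t \<omega>" "C \<in> spinal X A t \<omega>" "B \<noteq> C"
  then obtain b c where "B = Collect (spine_linked t \<omega> b)" "C = Collect (spine_linked t \<omega> c)"
    unfolding spinal_eq[OF assms] by auto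
  have "spine_linked t \<omega> b y \<longleftrightarrow> spine_linked t \<omega> c y"
    if x: "spine_linked t \<omega> b x" "spine_linked t \<omega> c x" for x y
  proof -
    note trans = spine_linked_equiv(2)[OF assms]
    have "spine_linked t \<omega> b c" "spine_linked t \<omega> c b"
      using trans[OF x(1) spine_linked_sym[OF x(2)]] trans[OF x(2) spine_linked_sym[OF x(1)]] .
    then show ?thesis using trans by blast
  qed
  then have "B = C" if "x \<in> B" "x \<in> C" for x
    using that \<open>B = _\<close> \<open>C = _\<close> by (simp add: set_eq_iff)
  then show "disjnt B C" using \<open>B \<noteq> C\<close> unfolding disjnt_def by blast
qed

lemma spinal_in_space:
  assumes "\<omega> \<in> space M" "0 \<le> t"
  shows "spinal X A t \<omega> \<in> space partition_algebra"
  using partition_spinal[OF assms] by (simp add: space_partition_algebra partition_on_def)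

text \<open>The right-hand side is \<open>fragment (spinal X A 0 \<omega>) w\<close> with \<open>w k\<close> the partition at time \<open>\<sigma> k + t\<close>. Both
sides are partitions and link the same labels, since \<open>\<sigma>\<close> is constant on the blocks of the spinal partition.\<close>

lemma spinal_fragments:
  assumes \<omega>: "\<omega> \<in> space M" and t: "0 \<le> t"
  shows "spinal X A t \<omega> = (\<Union>B\<in>spinal X A 0 \<omega>. restr B (at_ext_time X (\<sigma> (Inf B) \<omega> + ereal t) \<omega>))"
proof -
  define w where "w k = at_ext_time X (\<sigma> k \<omega> + ereal t) \<omega>" for k
  let ?P = "spinal X A 0 \<omega>"
  have P: "partition_on UNIV ?P" using partition_spinal[OF \<omega>] by simp
  then have P': "partition_on (\<Union>?P) ?P" by (simp add: partition_on_def)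
  have lk: "linked (fragment ?P w) a b \<longleftrightarrow> spine_linked t \<omega> a b" for a b
  proof -
    have "block_of ?P a \<in> ?P" "a \<in> block_of ?P a" using block_of_in[OF P] by auto
    moreover then have "block_min ?P a \<in> block_of ?P a" unfolding block_min_def using Inf_nat_def1 by blast
    ultimately have "linked ?P a (block_min ?P a)" by (auto simp: linked_def)
    then have "\<sigma> (block_min ?P a) \<omega> = \<sigma> a \<omega>" using linked_spinal[OF \<omega>] by (simp add: spine_linked_def)
    then have "linked (w (block_min ?P a)) a b \<longleftrightarrow> spine_linked t \<omega> a b"
      using linked_at_ext_time[OF assms, of a b] by (simp add: w_def)
    moreover have "spine_linked 0 \<omega> a b" if "spine_linked t \<omega> a b"
    proof (cases rule: \<sigma>_cases[OF \<omega>, of a])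
      case (2 s)
      have st: "real_of_ereal (\<sigma> a \<omega>) = s" "\<sigma> a \<omega> \<noteq> \<infinity>" using 2 by simp_all
      have "\<sigma> a \<omega> = \<sigma> b \<omega>" "linked (X (s + t) \<omega>) a b"
        using that st unfolding spine_linked_def by metis+
      then show ?thesis
        using linked_antimono[OF \<omega>, of s "s + t" a b] t 2(2) st unfolding spine_linked_def by simp
    qed (use that in \<open>auto simp: spine_linked_def\<close>)
    ultimately show ?thesis
      using linked_fragment_iff[OF P', of w a b] linked_spinal[OF \<omega>, of 0 a b] by auto
  qed
  have w: "partition_on (\<Union>(w k)) (w k)" for k
    using partition_at_ext_time[OF assms, of k] by (simp add: w_def partition_on_def)
  have "partition_on (\<Union>(fragment ?P w)) (fragment ?P w)" by (rule partition_on_fragment[OF P' w])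
  moreover have "linked (fragment ?P w) a a" for a using lk spine_linked_equiv(1)[OF assms] by simp
  then have "\<Union>(fragment ?P w) = UNIV" by (fastforce simp: linked_def)
  ultimately have "partition_on UNIV (fragment ?P w)" by simp
  then have "spinal X A t \<omega> = fragment ?P w"
    using partition_spinal[OF assms] lk linked_spinal[OF assms] by (intro partition_eqI ext) auto
  then show ?thesis by (simp add: fragment_def w_def)
qed

section \<open>Freezing the pieces that leave the path on a grid\<close>

lemma A_measurable: "0 \<le> t \<Longrightarrow> Measurable.pred (F t) (\<lambda>\<omega>. n \<in> A t \<omega>)"
proof -
  have "{B. n \<in> B} \<in> sets subset_algebra"
    unfolding subset_algebra_def by (auto intro: sigma_sets.Basic)
  then show "0 \<le> t \<Longrightarrow> Measurable.pred (F t) (\<lambda>\<omega>. n \<in> A t \<omega>)"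
    using measurable_sets[OF A_adapted, of t "{B. n \<in> B}"] by (simp add: pred_def vimage_def Int_def conj_commute)
qed

lemma pred_F_M: "Measurable.pred (F t) P \<Longrightarrow> Measurable.pred M P"
  by (rule measurable_from_subalg[OF subalg])

lemma pred_F_mono:
  assumes "Measurable.pred (F s) P" "s \<le> t"
  shows "Measurable.pred (F t) P"
  using assms sets_F_mono[of s t] by (auto simp: pred_def space_F)

abbreviation spine_path :: "real \<Rightarrow> 'a \<Rightarrow> real \<Rightarrow> nat set \<times> nat set set" where
  "spine_path r \<omega> \<equiv> \<lambda>t\<in>{r..}. (A t \<omega>, restr (A r \<omega>) (X t \<omega>))"

abbreviation spine_space :: "real \<Rightarrow> (real \<Rightarrow> nat set \<times> nat set set) measure" where
  "spine_space r \<equiv> PiM {r..} (\<lambda>_. subset_algebra \<Otimes>\<^sub>M partition_algebra)"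

text \<open>Here \<open>U\<close> collects what is known at time \<open>r\<close>, the event \<open>E\<close> concerns the path and the fragments of
its current block, and the query is put to the fragments of the complement. Given \<open>F r\<close>, the last two are
independent, and the query has the conditional probability supplied by \<open>markov_queries\<close>. It can thus be
replaced by this probability, which is known at time \<open>r\<close>, while \<open>E\<close> is left untouched.\<close>

lemma detached_step:
  assumes r: "0 \<le> r" and I: "admissible I" and U: "U \<in> borel_measurable (F r)" "\<And>\<omega>. \<bar>U \<omega>\<bar> \<le> 1"
    and E: "E \<in> sets (spine_space r)"
  shows "(\<integral>\<omega>. U \<omega> * indicator E (spine_path r \<omega>) * of_bool (linked_on (\<lambda>u. restr (- A r \<omega>) (X (r + u) \<omega>)) I) \<partial>M) =
    (\<integral>\<omega>. U \<omega> * indicator E (spine_path r \<omega>) *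
       (of_bool (\<forall>(a, b, t)\<in>I. a \<notin> A r \<omega> \<and> b \<notin> A r \<omega>) * block_product q (linked (X r \<omega>)) I) \<partial>M)"
    (is "_ = (\<integral>\<omega>. _ * ?K \<omega> \<partial>M)")
proof -
  interpret sub: finite_measure_subalgebra M "F r" by unfold_locales (rule subalg)
  let ?Z = "\<lambda>\<omega>. \<lambda>t\<in>{r..}. restr (- A r \<omega>) (X t \<omega>)"
  let ?N = "PiM {r..} (\<lambda>_::real. partition_algebra)"
  define D where "D = {z\<in>space ?N. linked_on (\<lambda>u. z (r + u)) I}"
  have "(\<lambda>z. z (r + t)) \<in> ?N \<rightarrow>\<^sub>M partition_algebra" if "0 \<le> t" for t
    using that by (intro measurable_component_singleton) simp
  then have "D \<in> sets ?N"
    using pred_linked_on[of "\<lambda>z u. z (r + u)" ?N I] I by (simp add: D_def pred_def)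
  note indep = A_markovian[OF r, unfolded cond_indep_def]
  have Y: "spine_path r \<in> M \<rightarrow>\<^sub>M spine_space r" and Z: "?Z \<in> M \<rightarrow>\<^sub>M ?N" using indep by auto
  define SY where "SY = spine_path r -` E \<inter> space M"
  define SZ where "SZ = ?Z -` D \<inter> space M"
  have SY: "SY \<in> sets M" unfolding SY_def using measurable_sets[OF Y E] .
  have SZ: "SZ \<in> sets M" unfolding SZ_def using measurable_sets[OF Z \<open>D \<in> sets ?N\<close>] .
  have prod: "AE \<omega> in M. real_cond_exp M (F r) (indicator (SY \<inter> SZ)) \<omega> =
      real_cond_exp M (F r) (indicator SY) \<omega> * real_cond_exp M (F r) (indicator SZ) \<omega>"
  proof -
    have eq: "SY \<inter> SZ = spine_path r -` E \<inter> ?Z -` D \<inter> space M" by (auto simp: SY_def SZ_def)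
    show ?thesis unfolding eq unfolding SY_def SZ_def
      using indep[THEN conjunct2, THEN conjunct2, THEN conjunct2, rule_format, OF E \<open>D \<in> sets ?N\<close>] .
  qed
  have SZ_iff: "\<omega> \<in> SZ \<longleftrightarrow> linked_on (\<lambda>u. restr (- A r \<omega>) (X (r + u) \<omega>)) I" if \<omega>: "\<omega> \<in> space M" for \<omega>
  proof -
    have "linked_on (\<lambda>u. ?Z \<omega> (r + u)) I \<longleftrightarrow> linked_on (\<lambda>u. restr (- A r \<omega>) (X (r + u) \<omega>)) I"
      using I by (auto simp: linked_on_def admissible_def)
    then show ?thesis using measurable_space[OF Z \<omega>] \<omega> by (simp add: SZ_def D_def)
  qed
  define C where "C = {\<omega>\<in>space M. \<forall>(a, b, t)\<in>I. a \<notin> A r \<omega> \<and> b \<notin> A r \<omega>}"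
  have finI: "finite I" using I by (simp add: admissible_def)
  have C: "C \<in> sets (F r)"
  proof -
    have "Measurable.pred (F r) (\<lambda>\<omega>. \<forall>x\<in>I. fst x \<notin> A r \<omega> \<and> fst (snd x) \<notin> A r \<omega>)"
      using A_measurable[OF r] finI by measurable
    then show ?thesis by (simp add: C_def pred_def space_F case_prod_beta')
  qed
  have K_F: "?K \<in> borel_measurable (F r)"
  proof -
    have "(\<lambda>\<omega>. block_product q (linked (X r \<omega>)) I) \<in> borel_measurable (F r)"
      using X_adapted[OF r] finI by (intro measurable_block_product pred_linked_comp)
    moreover have "Measurable.pred (F r) (\<lambda>\<omega>. \<forall>(a, b, t)\<in>I. a \<notin> A r \<omega> \<and> b \<notin> A r \<omega>)"
      using C by (simp add: C_def pred_def space_F)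
    ultimately show ?thesis by measurable
  qed
  have K_M: "?K \<in> borel_measurable M" by (rule measurable_from_subalg[OF subalg K_F])
  have bp: "0 \<le> block_product q R I" "block_product q R I \<le> 1" for R
    using block_product_bounds[of q R I, OF q_bounds] .
  have K_bd: "\<bar>?K \<omega>\<bar> \<le> 1" for \<omega> using bp[of "linked (X r \<omega>)"] by (simp add: of_bool_def)
  have U_M: "U \<in> borel_measurable M" by (rule measurable_from_subalg[OF subalg U(1)])
  have cond_Z: "AE \<omega> in M. real_cond_exp M (F r) (indicator SZ) \<omega> = ?K \<omega>"
  proof (rule sub.real_cond_exp_charact)
    fix H assume H: "H \<in> sets (F r)"
    then have H_M: "H \<in> sets M" using subalg by (auto simp: subalgebra_def)
    have "\<omega> \<in> SZ \<longleftrightarrow> \<omega> \<in> C \<and> linked_on (\<lambda>u. X (r + u) \<omega>) I" if "\<omega> \<in> space M" for \<omega>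
      using that SZ_iff[OF that]
      by (simp add: linked_on_def linked_restr C_def case_prod_beta' ball_conj_distrib conj_ac)
    then have "H \<inter> SZ = (H \<inter> C) \<inter> {\<omega>\<in>space M. linked_on (\<lambda>u. X (r + u) \<omega>) I}"
      using sets.sets_into_space[OF SZ] sets.sets_into_space[OF H_M] by blast
    then have "measure M (H \<inter> SZ) = (\<integral>\<omega>. indicator (H \<inter> C) \<omega> * block_product q (linked (X r \<omega>)) I \<partial>M)"
      using markov_queries[OF I r, of "H \<inter> C"] H C by simp
    also have "\<dots> = (\<integral>\<omega>. indicator H \<omega> * ?K \<omega> \<partial>M)"
      using sets.sets_into_space[OF H_M]
      by (intro Bochner_Integration.integral_cong refl) (auto simp: indicator_def C_def)
    finally show "(\<integral>\<omega>\<in>H. indicator SZ \<omega> \<partial>M) = (\<integral>\<omega>\<in>H. ?K \<omega> \<partial>M)"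
      using H_M SZ by (simp add: set_lebesgue_integral_def indicator_inter_arith[symmetric])
  qed (use SZ K_F K_M K_bd in \<open>auto intro!: integrable_const_bound[where B=1]\<close>)
  have intY: "integrable M (\<lambda>\<omega>. g \<omega> * indicator S \<omega>)"
    if "g \<in> borel_measurable M" "S \<in> sets M" "\<And>\<omega>. \<bar>g \<omega>\<bar> \<le> 1" for g :: "'a \<Rightarrow> real" and S
    using that by (intro integrable_const_bound[where B=1]) (auto simp: indicator_def abs_mult)
  have UK_bd: "\<bar>U \<omega> * ?K \<omega>\<bar> \<le> 1" for \<omega>
    using mult_le_one[OF U(2) abs_ge_zero K_bd, of \<omega> \<omega>] by (simp only: abs_mult)
  have "(\<integral>\<omega>. U \<omega> * indicator E (spine_path r \<omega>) * of_bool (linked_on (\<lambda>u. restr (- A r \<omega>) (X (r + u) \<omega>)) I) \<partial>M) =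
      (\<integral>\<omega>. U \<omega> * indicator (SY \<inter> SZ) \<omega> \<partial>M)"
    by (intro Bochner_Integration.integral_cong refl) (auto simp: SZ_iff SY_def indicator_def)
  also have "\<dots> = (\<integral>\<omega>. U \<omega> * real_cond_exp M (F r) (indicator (SY \<inter> SZ)) \<omega> \<partial>M)"
    using SY SZ by (intro sub.real_cond_exp_intg(2)[symmetric] intY U U_M) auto
  also have "\<dots> = (\<integral>\<omega>. (U \<omega> * ?K \<omega>) * real_cond_exp M (F r) (indicator SY) \<omega> \<partial>M)"
  proof (rule integral_cong_AE)
    show "AE \<omega> in M. U \<omega> * real_cond_exp M (F r) (indicator (SY \<inter> SZ)) \<omega> =
        (U \<omega> * ?K \<omega>) * real_cond_exp M (F r) (indicator SY) \<omega>"
      using prod cond_Z by eventually_elim simp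
  qed (use U_M K_M in measurable)
  also have "\<dots> = (\<integral>\<omega>. (U \<omega> * ?K \<omega>) * indicator SY \<omega> \<partial>M)"
    using SY U U_M K_F K_M UK_bd by (intro sub.real_cond_exp_intg(2) intY) auto
  also have "\<dots> = (\<integral>\<omega>. U \<omega> * indicator E (spine_path r \<omega>) * ?K \<omega> \<partial>M)"
    by (intro Bochner_Integration.integral_cong refl) (auto simp: SY_def indicator_def)
  finally show ?thesis .
qed

text \<open>The schedule \<open>s\<close> prescribes the first grid index at which each label of \<open>L\<close> is off the path; the
predicate says that at grid index \<open>i\<close> the path agrees with it.\<close>

definition on_schedule :: "real \<Rightarrow> nat set \<Rightarrow> (nat \<Rightarrow> nat) \<Rightarrow> nat \<Rightarrow> 'a \<Rightarrow> bool" where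
  "on_schedule \<delta> L s i \<omega> \<longleftrightarrow> (\<forall>n\<in>L. n \<in> A (real i * \<delta>) \<omega> \<longleftrightarrow> i < s n)"

lemma pred_on_schedule:
  assumes "0 < \<delta>" "finite L"
  shows "Measurable.pred (F (real i * \<delta>)) (on_schedule \<delta> L s i)"
proof -
  have [measurable]: "Measurable.pred (F (real i * \<delta>)) (\<lambda>\<omega>. n \<in> A (real i * \<delta>) \<omega>)" for n
    using assms by (intro A_measurable) simp
  have [measurable]: "Measurable.pred (F (real i * \<delta>)) (\<lambda>_. i < s n)" for n by simp
  show ?thesis unfolding on_schedule_def using assms(2) by measurable
qed

text \<open>The pieces with schedule at most \<open>j\<close> have been replaced by their conditional probabilities, those
with a later schedule still run. In the step from \<open>j\<close> to \<open>Suc j\<close> the labels scheduled for \<open>Suc j\<close> lie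
outside of \<open>A r\<close>, with \<open>r = Suc j * \<delta>\<close>, and those scheduled later lie inside, so that
\<open>detached_step\<close> applies at time \<open>r\<close>.\<close>

lemma scheduled_pieces:
  assumes \<delta>: "0 < \<delta>" and L: "finite L" and I: "admissible I"
    and labels: "\<And>a b t. (a, b, t) \<in> I \<Longrightarrow> a \<in> L \<and> b \<in> L \<and> s a = s b"
    and j: "j \<le> J"
  shows "(\<integral>\<omega>. of_bool (\<forall>i\<in>{1..J}. on_schedule \<delta> L s i \<omega> \<and>
        linked_on (\<lambda>u. X (real i * \<delta> + u) \<omega>) {x\<in>I. s (fst x) = i}) \<partial>M) =
    (\<integral>\<omega>. (\<Prod>i\<in>{1..j}. of_bool (on_schedule \<delta> L s i \<omega>) *
          block_product q (linked (X (real i * \<delta>) \<omega>)) {x\<in>I. s (fst x) = i}) *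
        of_bool (\<forall>i\<in>{j<..J}. on_schedule \<delta> L s i \<omega> \<and>
          linked_on (\<lambda>u. X (real i * \<delta> + u) \<omega>) {x\<in>I. s (fst x) = i}) \<partial>M)"
  using j
proof (induction j)
  case 0
  have "{0<..J} = {1..J}" by auto
  then show ?case by simp
next
  case (Suc j)
  define I' where "I' i = {x\<in>I. s (fst x) = i}" for i
  define r where "r = real (Suc j) * \<delta>"
  have r: "0 \<le> r" using \<delta> by (simp add: r_def)
  have I': "admissible (I' i)" "finite (I' i)" for i
    using admissible_subset[OF I, of "I' i"] by (auto simp: I'_def admissible_def)
  define k where "k i \<omega> = of_bool (on_schedule \<delta> L s i \<omega>) * block_product q (linked (X (real i * \<delta>) \<omega>)) (I' i)" for i \<omega>
  define U where "U \<omega> = (\<Prod>i\<in>{1..j}. k i \<omega>) * of_bool (on_schedule \<delta> L s (Suc j) \<omega>)" for \<omega>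
  have bp: "0 \<le> block_product q R I" "block_product q R I \<le> 1" for R I
    using block_product_bounds[of q R I, OF q_bounds] .
  have k01: "0 \<le> k i \<omega>" "k i \<omega> \<le> 1" for i \<omega> using bp by (auto simp: k_def)
  have U_bd: "\<bar>U \<omega>\<bar> \<le> 1" for \<omega>
    using k01 by (auto simp: U_def abs_prod intro!: prod_le_1)
  have k_meas: "k i \<in> borel_measurable (F r)" if "i \<le> Suc j" for i
  proof -
    have le: "real i * \<delta> \<le> r" "0 \<le> real i * \<delta>" using that \<delta> by (auto simp: r_def intro!: mult_right_mono)
    have [measurable]: "Measurable.pred (F r) (on_schedule \<delta> L s i)"
      by (rule pred_F_mono[OF pred_on_schedule[OF \<delta> L] le(1)])
    have "Measurable.pred (F r) (\<lambda>\<omega>. linked (X (real i * \<delta>) \<omega>) a b)" for a b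
      by (rule pred_F_mono[OF pred_linked_comp[OF X_adapted[OF le(2)]] le(1)])
    then have [measurable]: "(\<lambda>\<omega>. block_product q (linked (X (real i * \<delta>) \<omega>)) (I' i)) \<in> borel_measurable (F r)"
      by (intro measurable_block_product I')
    show ?thesis unfolding k_def by measurable
  qed
  have U_meas: "U \<in> borel_measurable (F r)"
  proof -
    have [measurable]: "Measurable.pred (F r) (on_schedule \<delta> L s (Suc j))"
      unfolding r_def by (rule pred_on_schedule[OF \<delta> L])
    have [measurable]: "(\<lambda>\<omega>. \<Prod>i\<in>{1..j}. k i \<omega>) \<in> borel_measurable (F r)"
      using k_meas by (intro borel_measurable_prod) auto
    show ?thesis unfolding U_def by measurable
  qed
  define later where "later y \<longleftrightarrow> (\<forall>i\<in>{Suc j<..J}. (\<forall>n\<in>L. n \<in> fst (y (real i * \<delta>)) \<longleftrightarrow> i < s n) \<and>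
      linked_on (\<lambda>u. snd (y (real i * \<delta> + u))) (I' i))" for y :: "real \<Rightarrow> nat set \<times> nat set set"
  \<comment> \<open>The answers of the pieces that detach later, read off from the path and the fragments inside \<open>A r\<close>.\<close>
  define E where "E = {y\<in>space (spine_space r). later y}"
  have E: "E \<in> sets (spine_space r)"
  proof -
    have comp: "(\<lambda>y. y t) \<in> spine_space r \<rightarrow>\<^sub>M subset_algebra \<Otimes>\<^sub>M partition_algebra" if "r \<le> t" for t
      using that by (intro measurable_component_singleton) simp
    have grid: "r \<le> real i * \<delta>" if "i \<in> {Suc j<..J}" for i
      using that \<delta> by (auto simp: r_def intro!: mult_right_mono)
    have "{B. n \<in> B} \<in> sets subset_algebra" for n
      unfolding subset_algebra_def by (auto intro: sigma_sets.Basic)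
    then have mem: "Measurable.pred subset_algebra (\<lambda>B. n \<in> B)" for n
      by (simp add: pred_def subset_algebra_def)
    have sched: "Measurable.pred (spine_space r) (\<lambda>y. \<forall>n\<in>L. n \<in> fst (y (real i * \<delta>)) \<longleftrightarrow> i < s n)"
      if "i \<in> {Suc j<..J}" for i
    proof -
      have "(\<lambda>y. fst (y (real i * \<delta>))) \<in> spine_space r \<rightarrow>\<^sub>M subset_algebra"
        using measurable_compose[OF comp[OF grid[OF that]] measurable_fst] .
      then have [measurable]: "Measurable.pred (spine_space r) (\<lambda>y. n \<in> fst (y (real i * \<delta>)))" for n
        using measurable_compose[OF _ mem] by blast
      show ?thesis using L by measurable
    qed
    have links: "Measurable.pred (spine_space r) (\<lambda>y. linked_on (\<lambda>u. snd (y (real i * \<delta> + u))) (I' i))"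
      if i: "i \<in> {Suc j<..J}" for i
    proof (rule pred_linked_on[OF _ I'(1)])
      fix t :: real assume "0 \<le> t"
      then have "r \<le> real i * \<delta> + t" using grid[OF i] by simp
      then show "(\<lambda>y. snd (y (real i * \<delta> + t))) \<in> spine_space r \<rightarrow>\<^sub>M partition_algebra"
        using measurable_compose[OF comp measurable_snd] by blast
    qed
    have "Measurable.pred (spine_space r) later"
      unfolding later_def using sched links
      by (intro pred_intros_finite(3)) (auto simp: pred_def intro: sets.sets_Collect_conj)
    then show ?thesis by (simp add: E_def pred_def)
  qed
  have Y: "spine_path r \<in> M \<rightarrow>\<^sub>M spine_space r" using A_markovian[OF r] by (simp add: cond_indep_def)
  let ?future = "\<lambda>\<omega>. \<forall>i\<in>{Suc j<..J}. on_schedule \<delta> L s i \<omega> \<and> linked_on (\<lambda>u. X (real i * \<delta> + u) \<omega>) (I' i)"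
  have later_iff: "spine_path r \<omega> \<in> E \<longleftrightarrow> ?future \<omega>"
    if \<omega>: "\<omega> \<in> space M" and on: "on_schedule \<delta> L s (Suc j) \<omega>" for \<omega>
  proof -
    have "((\<forall>n\<in>L. n \<in> fst (spine_path r \<omega> (real i * \<delta>)) \<longleftrightarrow> i < s n) \<and>
        linked_on (\<lambda>u. snd (spine_path r \<omega> (real i * \<delta> + u))) (I' i)) \<longleftrightarrow>
        (on_schedule \<delta> L s i \<omega> \<and> linked_on (\<lambda>u. X (real i * \<delta> + u) \<omega>) (I' i))"
      if i: "i \<in> {Suc j<..J}" for i
    proof -
      have ri: "r \<le> real i * \<delta>" using i \<delta> by (auto simp: r_def intro!: mult_right_mono)
      have "a \<in> A r \<omega> \<and> b \<in> A r \<omega> \<and> r \<le> real i * \<delta> + t" if ab: "(a, b, t) \<in> I' i" for a b t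
      proof -
        have "0 \<le> t" using ab I by (auto simp: I'_def admissible_def)
        then show ?thesis
          using ab labels[of a b t] on i ri by (auto simp: I'_def on_schedule_def r_def)
      qed
      then have "linked_on (\<lambda>u. snd (spine_path r \<omega> (real i * \<delta> + u))) (I' i) \<longleftrightarrow>
          linked_on (\<lambda>u. X (real i * \<delta> + u) \<omega>) (I' i)"
        unfolding linked_on_def using ri by (intro ball_cong refl) (auto simp: linked_restr)
      then show ?thesis using ri by (simp add: on_schedule_def)
    qed
    then show ?thesis using measurable_space[OF Y \<omega>] by (simp add: E_def later_def)
  qed
  have detached: "a \<notin> A r \<omega> \<and> b \<notin> A r \<omega>"
    if on: "on_schedule \<delta> L s (Suc j) \<omega>" and ab: "(a, b, t) \<in> I' (Suc j)" for \<omega> a b t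
  proof -
    have "a \<in> L" "b \<in> L" "\<not> Suc j < s a" "\<not> Suc j < s b"
      using ab labels[of a b t] by (auto simp: I'_def)
    then show ?thesis using on unfolding on_schedule_def r_def by blast
  qed
  have split: "{j<..J} = insert (Suc j) {Suc j<..J}" using Suc.prems by auto
  have "(\<integral>\<omega>. (\<Prod>i\<in>{1..j}. k i \<omega>) * of_bool (\<forall>i\<in>{j<..J}. on_schedule \<delta> L s i \<omega> \<and>
          linked_on (\<lambda>u. X (real i * \<delta> + u) \<omega>) (I' i)) \<partial>M) =
      (\<integral>\<omega>. U \<omega> * indicator E (spine_path r \<omega>) *
        of_bool (linked_on (\<lambda>u. restr (- A r \<omega>) (X (r + u) \<omega>)) (I' (Suc j))) \<partial>M)"
  proof (intro Bochner_Integration.integral_cong refl)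
    fix \<omega> assume \<omega>: "\<omega> \<in> space M"
    show "(\<Prod>i\<in>{1..j}. k i \<omega>) * of_bool (\<forall>i\<in>{j<..J}. on_schedule \<delta> L s i \<omega> \<and>
          linked_on (\<lambda>u. X (real i * \<delta> + u) \<omega>) (I' i)) = U \<omega> * indicator E (spine_path r \<omega>) *
        of_bool (linked_on (\<lambda>u. restr (- A r \<omega>) (X (r + u) \<omega>)) (I' (Suc j)))"
    proof (cases "on_schedule \<delta> L s (Suc j) \<omega>")
      case True
      have "linked_on (\<lambda>u. restr (- A r \<omega>) (X (r + u) \<omega>)) (I' (Suc j)) \<longleftrightarrow>
          linked_on (\<lambda>u. X (r + u) \<omega>) (I' (Suc j))"
        unfolding linked_on_def using detached[OF True]
        by (intro ball_cong refl) (auto simp: linked_restr)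
      then show ?thesis
        unfolding split using True later_iff[OF \<omega> True] by (simp add: U_def indicator_def r_def[symmetric] del: of_nat_Suc) blast
    qed (unfold split, simp add: U_def)
  qed
  also have "\<dots> = (\<integral>\<omega>. U \<omega> * indicator E (spine_path r \<omega>) *
       (of_bool (\<forall>(a, b, t)\<in>I' (Suc j). a \<notin> A r \<omega> \<and> b \<notin> A r \<omega>) *
         block_product q (linked (X r \<omega>)) (I' (Suc j))) \<partial>M)"
    by (rule detached_step[OF r I'(1) U_meas U_bd E])
  also have "\<dots> = (\<integral>\<omega>. (\<Prod>i\<in>{1..Suc j}. k i \<omega>) * of_bool (?future \<omega>) \<partial>M)"
  proof (intro Bochner_Integration.integral_cong refl)
    fix \<omega> assume \<omega>: "\<omega> \<in> space M"
    show "U \<omega> * indicator E (spine_path r \<omega>) *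
       (of_bool (\<forall>(a, b, t)\<in>I' (Suc j). a \<notin> A r \<omega> \<and> b \<notin> A r \<omega>) *
         block_product q (linked (X r \<omega>)) (I' (Suc j))) =
      (\<Prod>i\<in>{1..Suc j}. k i \<omega>) * of_bool (?future \<omega>)"
    proof (cases "on_schedule \<delta> L s (Suc j) \<omega>")
      case True
      have "\<forall>(a, b, t)\<in>I' (Suc j). a \<notin> A r \<omega> \<and> b \<notin> A r \<omega>" using detached[OF True] by blast
      then show ?thesis
        using True later_iff[OF \<omega> True] by (simp add: U_def indicator_def k_def r_def[symmetric] del: of_nat_Suc)
    qed (simp add: U_def k_def)
  qed
  finally show ?case using Suc by (simp add: k_def I'_def)
qed

text \<open>The index \<open>Suc J\<close> stands for never: it is taken by the labels that are on the path at the last grid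
point.\<close>

definition grid_index :: "real \<Rightarrow> nat \<Rightarrow> nat \<Rightarrow> 'a \<Rightarrow> nat" where
  "grid_index \<delta> J n \<omega> = (LEAST i. J < i \<or> n \<notin> A (real i * \<delta>) \<omega>)"

definition grid_time :: "real \<Rightarrow> nat \<Rightarrow> nat \<Rightarrow> 'a \<Rightarrow> ereal" where
  "grid_time \<delta> J n \<omega> = (if grid_index \<delta> J n \<omega> = Suc J then \<infinity> else ereal (real (grid_index \<delta> J n \<omega>) * \<delta>))"

text \<open>The counterpart of \<open>spine_linked\<close> with the detachment times rounded up to the grid.\<close>

definition grid_linked :: "real \<Rightarrow> nat \<Rightarrow> real \<Rightarrow> 'a \<Rightarrow> nat \<Rightarrow> nat \<Rightarrow> bool" where
  "grid_linked \<delta> J t \<omega> a b \<longleftrightarrow> grid_index \<delta> J a \<omega> = grid_index \<delta> J b \<omega> \<and>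
     (if grid_index \<delta> J a \<omega> = Suc J then a = b
      else linked (X (real (grid_index \<delta> J a \<omega>) * \<delta> + t) \<omega>) a b)"

lemma grid_index_le: "grid_index \<delta> J n \<omega> \<le> Suc J"
  unfolding grid_index_def by (rule Least_le) simp

lemma mem_A_grid:
  assumes \<omega>: "\<omega> \<in> space M" and \<delta>: "0 < \<delta>" and i: "i \<le> J"
  shows "n \<in> A (real i * \<delta>) \<omega> \<longleftrightarrow> i < grid_index \<delta> J n \<omega>"
proof
  assume mem: "n \<in> A (real i * \<delta>) \<omega>"
  show "i < grid_index \<delta> J n \<omega>"
  proof (rule ccontr)
    let ?k = "grid_index \<delta> J n \<omega>"
    assume "\<not> i < ?k"
    then have k: "?k \<le> i" by simp
    have "J < ?k \<or> n \<notin> A (real ?k * \<delta>) \<omega>"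
      unfolding grid_index_def by (rule LeastI[of _ "Suc J"]) simp
    then have "n \<notin> A (real ?k * \<delta>) \<omega>" using k i by simp
    moreover have "A (real i * \<delta>) \<omega> \<subseteq> A (real ?k * \<delta>) \<omega>"
      using \<delta> k by (intro A_antimono \<omega> mult_right_mono) auto
    ultimately show False using mem by auto
  qed
next
  assume "i < grid_index \<delta> J n \<omega>"
  then show "n \<in> A (real i * \<delta>) \<omega>" using not_less_Least unfolding grid_index_def by blast
qed

lemma grid_index_pos: "\<omega> \<in> space M \<Longrightarrow> 0 < \<delta> \<Longrightarrow> 1 \<le> grid_index \<delta> J n \<omega>"
  using mem_A_grid[of \<omega> \<delta> 0 J n] A_0 by (simp add: Suc_le_eq)

lemma measurable_grid_index:
  assumes "0 < \<delta>"
  shows "grid_index \<delta> J n \<in> M \<rightarrow>\<^sub>M count_space UNIV"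
proof -
  have "Measurable.pred M (\<lambda>\<omega>. n \<in> A (real i * \<delta>) \<omega>)" for i
    using assms by (intro pred_F_M[OF A_measurable]) simp
  then have "Measurable.pred M (\<lambda>\<omega>. J < i \<or> n \<notin> A (real i * \<delta>) \<omega>)" for i by measurable
  then show ?thesis unfolding grid_index_def by (intro measurable_Least)
qed

lemma pred_grid_index: "0 < \<delta> \<Longrightarrow> Measurable.pred M (\<lambda>\<omega>. grid_index \<delta> J n \<omega> = k)"
  using measurable_grid_index[of \<delta> J n] by measurable

lemma pred_grid_linked:
  assumes \<delta>: "0 < \<delta>" and t: "0 \<le> t"
  shows "Measurable.pred M (\<lambda>\<omega>. grid_linked \<delta> J t \<omega> a b)"
proof -
  have link: "Measurable.pred M (\<lambda>\<omega>. linked (X (real k * \<delta> + t) \<omega>) a b)" for k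
    using \<delta> t by (intro pred_linked_comp X_measurable) simp
  have "Measurable.pred M (\<lambda>\<omega>. \<exists>k\<in>{..Suc J}. (grid_index \<delta> J a \<omega> = k \<and> grid_index \<delta> J b \<omega> = k) \<and>
      (k = Suc J \<and> a = b \<or> k \<noteq> Suc J \<and> linked (X (real k * \<delta> + t) \<omega>) a b))"
    using pred_grid_index[OF \<delta>] link by (intro pred_intros_finite pred_intros_logic) auto
  moreover have "grid_linked \<delta> J t \<omega> a b \<longleftrightarrow>
      (\<exists>k\<in>{..Suc J}. (grid_index \<delta> J a \<omega> = k \<and> grid_index \<delta> J b \<omega> = k) \<and>
        (k = Suc J \<and> a = b \<or> k \<noteq> Suc J \<and> linked (X (real k * \<delta> + t) \<omega>) a b))" for \<omega>
    using grid_index_le[of \<delta> J a \<omega>] unfolding grid_linked_def by auto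
  ultimately show ?thesis by simp
qed

text \<open>If the schedule contradicts the query, by separating two labels that should be linked or by never
detaching two distinct ones, both sides vanish. Otherwise \<open>scheduled_pieces\<close> with \<open>j = J\<close> gives a product over
the grid points, which \<open>block_product_split\<close> recognizes as the product for the assembled relation.\<close>

lemma grid_law_on_schedule:
  assumes \<delta>: "0 < \<delta>" and L: "finite L" and I: "admissible I"
    and labels: "\<And>a b t. (a, b, t) \<in> I \<Longrightarrow> a \<in> L \<and> b \<in> L"
    and s: "\<And>n. n \<in> L \<Longrightarrow> 1 \<le> s n \<and> s n \<le> Suc J"
  shows "(\<integral>\<omega>. of_bool (\<forall>n\<in>L. grid_index \<delta> J n \<omega> = s n) * of_bool (\<forall>(a, b, t)\<in>I. grid_linked \<delta> J t \<omega> a b) \<partial>M) =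
    (\<integral>\<omega>. of_bool (\<forall>n\<in>L. grid_index \<delta> J n \<omega> = s n) * block_product q (grid_linked \<delta> J 0 \<omega>) I \<partial>M)"
proof (cases "\<forall>(a, b, t)\<in>I. s a = s b \<and> (s a = Suc J \<longrightarrow> a = b)")
  case False
  then obtain a b t where x: "(a, b, t) \<in> I" "\<not> (s a = s b \<and> (s a = Suc J \<longrightarrow> a = b))" by fast
  have no: "\<not> grid_linked \<delta> J u \<omega> a b" if "\<forall>n\<in>L. grid_index \<delta> J n \<omega> = s n" for \<omega> u
    using that labels[OF x(1)] x(2) by (auto simp: grid_linked_def)
  have lhs: "of_bool (\<forall>n\<in>L. grid_index \<delta> J n \<omega> = s n) * of_bool (\<forall>(a, b, t)\<in>I. grid_linked \<delta> J t \<omega> a b) = (0 :: real)" for \<omega>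
  proof -
    have "\<not> (\<forall>(a, b, t)\<in>I. grid_linked \<delta> J t \<omega> a b)" if "\<forall>n\<in>L. grid_index \<delta> J n \<omega> = s n"
      using no[OF that] x(1) by fast
    then show ?thesis by auto
  qed
  have rhs: "of_bool (\<forall>n\<in>L. grid_index \<delta> J n \<omega> = s n) * block_product q (grid_linked \<delta> J 0 \<omega>) I = 0" for \<omega>
  proof -
    have "\<not> related_on (grid_linked \<delta> J 0 \<omega>) I" if "\<forall>n\<in>L. grid_index \<delta> J n \<omega> = s n"
      using no[OF that] x(1) unfolding related_on_def by fast
    then show ?thesis by (auto simp: block_product_def)
  qed
  show ?thesis by (simp only: lhs rhs)
next
  case True
  have same: "a \<in> L \<and> b \<in> L \<and> s a = s b" if "(a, b, t) \<in> I" for a b t using True labels that by fast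
  have last: "a = b" if "(a, b, t) \<in> I" "s a = Suc J" for a b t using True that by fast
  define I' where "I' i = {x\<in>I. s (fst x) = i}" for i
  have finI: "finite I" using I by (simp add: admissible_def)
  have sched: "(\<forall>i\<in>{1..J}. on_schedule \<delta> L s i \<omega>) \<longleftrightarrow> (\<forall>n\<in>L. grid_index \<delta> J n \<omega> = s n)"
    if \<omega>: "\<omega> \<in> space M" for \<omega>
  proof
    assume on: "\<forall>i\<in>{1..J}. on_schedule \<delta> L s i \<omega>"
    show "\<forall>n\<in>L. grid_index \<delta> J n \<omega> = s n"
    proof
      fix n assume n: "n \<in> L"
      have iff: "i < grid_index \<delta> J n \<omega> \<longleftrightarrow> i < s n" if "i \<in> {1..J}" for i
        using on n that mem_A_grid[OF \<omega> \<delta>, of i J n] by (auto simp: on_schedule_def)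
      show "grid_index \<delta> J n \<omega> = s n"
        using iff[of "s n"] iff[of "grid_index \<delta> J n \<omega>"] s[OF n] grid_index_le[of \<delta> J n \<omega>]
          grid_index_pos[OF \<omega> \<delta>, of J n] by (auto simp: le_Suc_eq)
    qed
  qed (use mem_A_grid[OF \<omega> \<delta>] in \<open>auto simp: on_schedule_def\<close>)
  have lhs: "of_bool (\<forall>n\<in>L. grid_index \<delta> J n \<omega> = s n) * of_bool (\<forall>(a, b, t)\<in>I. grid_linked \<delta> J t \<omega> a b) =
      (of_bool (\<forall>i\<in>{1..J}. on_schedule \<delta> L s i \<omega> \<and> linked_on (\<lambda>u. X (real i * \<delta> + u) \<omega>) (I' i)) :: real)"
    if \<omega>: "\<omega> \<in> space M" for \<omega>
  proof -
    have "(\<forall>(a, b, t)\<in>I. grid_linked \<delta> J t \<omega> a b) \<longleftrightarrow>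
        (\<forall>i\<in>{1..J}. linked_on (\<lambda>u. X (real i * \<delta> + u) \<omega>) (I' i))"
      if idx: "\<forall>n\<in>L. grid_index \<delta> J n \<omega> = s n"
    proof -
      have "grid_linked \<delta> J t \<omega> a b \<longleftrightarrow> (s a \<in> {1..J} \<longrightarrow> linked (X (real (s a) * \<delta> + t) \<omega>) a b)"
        if ab: "(a, b, t) \<in> I" for a b t
      proof -
        have ids: "grid_index \<delta> J a \<omega> = s a" "grid_index \<delta> J b \<omega> = s a" using same[OF ab] idx by auto
        have "s a \<in> {1..J} \<longleftrightarrow> s a \<noteq> Suc J" using s[of a] same[OF ab] by auto
        then show ?thesis using last[OF ab] by (auto simp: grid_linked_def ids)
      qed
      then have "(\<forall>(a, b, t)\<in>I. grid_linked \<delta> J t \<omega> a b) \<longleftrightarrow>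
          (\<forall>(a, b, t)\<in>I. s a \<in> {1..J} \<longrightarrow> linked (X (real (s a) * \<delta> + t) \<omega>) a b)" by fast
      also have "\<dots> \<longleftrightarrow> (\<forall>i\<in>{1..J}. linked_on (\<lambda>u. X (real i * \<delta> + u) \<omega>) (I' i))"
        unfolding linked_on_def I'_def by fastforce
      finally show ?thesis .
    qed
    then show ?thesis using sched[OF \<omega>] by (auto simp: of_bool_def)
  qed
  have rhs: "of_bool (\<forall>n\<in>L. grid_index \<delta> J n \<omega> = s n) * block_product q (grid_linked \<delta> J 0 \<omega>) I =
      (\<Prod>i\<in>{1..J}. of_bool (on_schedule \<delta> L s i \<omega>) * block_product q (linked (X (real i * \<delta>) \<omega>)) (I' i)) *
        of_bool (\<forall>i\<in>{J<..J}. on_schedule \<delta> L s i \<omega> \<and> linked_on (\<lambda>u. X (real i * \<delta> + u) \<omega>) (I' i))"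
    if \<omega>: "\<omega> \<in> space M" for \<omega>
  proof -
    have of_prod: "(\<Prod>i\<in>{1..J}. of_bool (on_schedule \<delta> L s i \<omega>) :: real) = of_bool (\<forall>i\<in>{1..J}. on_schedule \<delta> L s i \<omega>)"
      by (auto simp: prod_zero_iff intro!: prod.neutral)
    have "block_product q (grid_linked \<delta> J 0 \<omega>) I = (\<Prod>i\<in>{1..J}. block_product q (linked (X (real i * \<delta>) \<omega>)) (I' i))"
      if idx: "\<forall>n\<in>L. grid_index \<delta> J n \<omega> = s n"
    proof -
      \<comment> \<open>The labels that never detach form singletons, whose queries always hold.\<close>
      define W where "W i = (if i = Suc J then (=) else linked (X (real i * \<delta>) \<omega>))" for i
      have gl: "grid_linked \<delta> J 0 \<omega> a b \<longleftrightarrow> s a = s b \<and> W (s a) a b" if "a \<in> L" "b \<in> L" for a b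
        using idx that by (auto simp: grid_linked_def W_def)
      have "block_product q (grid_linked \<delta> J 0 \<omega>) I = (\<Prod>i\<in>{1..Suc J}. block_product q (W i) (I' i))"
        unfolding I'_def
      proof (rule block_product_split[OF finI])
        show "s ` fst ` I \<subseteq> {1..Suc J}" using s labels by fastforce
        fix x y assume "x \<in> I" "y \<in> I"
        then have "fst x \<in> L" "fst y \<in> L" using labels by (metis prod.collapse)+
        then show "grid_linked \<delta> J 0 \<omega> (fst x) (fst y) \<longleftrightarrow> s (fst x) = s (fst y) \<and> W (s (fst x)) (fst x) (fst y)"
          by (rule gl)
      next
        fix a b t assume ab: "(a, b, t) \<in> I"
        show "grid_linked \<delta> J 0 \<omega> a b \<longleftrightarrow> W (s a) a b" using same[OF ab] gl by auto
        show "grid_linked \<delta> J 0 \<omega> a a"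
          using linked_refl[OF X_partition[OF \<omega>]] \<delta> by (simp add: grid_linked_def)
      qed simp
      also have "\<dots> = (\<Prod>i\<in>{1..J}. block_product q (W i) (I' i)) * block_product q (=) (I' (Suc J))"
        by (simp add: W_def)
      also have "block_product q (=) (I' (Suc J)) = 1"
      proof -
        have "q K = 1" if K: "K \<subseteq> I' (Suc J)" for K
        proof -
          have "linked_on (\<lambda>t. X t \<omega>) K" if "\<omega> \<in> space M" for \<omega>
            unfolding linked_on_def
          proof clarify
            fix a b t assume "(a, b, t) \<in> K"
            then have "(a, b, t) \<in> I" "s a = Suc J" using K by (auto simp: I'_def)
            then show "linked (X t \<omega>) a b"
              using last[of a b t] linked_refl[OF X_partition[OF that]] I by (auto simp: admissible_def)
          qed
          then show ?thesis by (simp add: link_prob_def prob_space cong: conj_cong)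
        qed
        moreover have "related_on (=) (I' (Suc J))" using last by (auto simp: related_on_def I'_def)
        ultimately show ?thesis
          by (auto simp: block_product_def block_queries_def intro!: prod.neutral)
      qed
      finally show ?thesis by (simp add: W_def)
    qed
    then show ?thesis
      unfolding prod.distrib of_prod sched[OF \<omega>]
      by (cases "\<forall>n\<in>L. grid_index \<delta> J n \<omega> = s n") simp_all
  qed
  have "(\<integral>\<omega>. of_bool (\<forall>n\<in>L. grid_index \<delta> J n \<omega> = s n) * of_bool (\<forall>(a, b, t)\<in>I. grid_linked \<delta> J t \<omega> a b) \<partial>M) =
    (\<integral>\<omega>. of_bool (\<forall>i\<in>{1..J}. on_schedule \<delta> L s i \<omega> \<and> linked_on (\<lambda>u. X (real i * \<delta> + u) \<omega>) (I' i)) \<partial>M :: real)"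
    by (rule Bochner_Integration.integral_cong[OF refl lhs])
  also have "\<dots> =
    (\<integral>\<omega>. (\<Prod>i\<in>{1..J}. of_bool (on_schedule \<delta> L s i \<omega>) * block_product q (linked (X (real i * \<delta>) \<omega>)) (I' i)) *
        of_bool (\<forall>i\<in>{J<..J}. on_schedule \<delta> L s i \<omega> \<and> linked_on (\<lambda>u. X (real i * \<delta> + u) \<omega>) (I' i)) \<partial>M)"
    unfolding I'_def by (rule scheduled_pieces[OF \<delta> L I same order_refl])
  also have "\<dots> = (\<integral>\<omega>. of_bool (\<forall>n\<in>L. grid_index \<delta> J n \<omega> = s n) * block_product q (grid_linked \<delta> J 0 \<omega>) I \<partial>M)"
    by (rule Bochner_Integration.integral_cong[OF refl]) (rule rhs[symmetric])
  finally show ?thesis .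
qed

text \<open>The grid indices of the labels in \<open>L\<close> take finitely many values, and on each of the corresponding
events the rounded times are constants.\<close>

lemma grid_law:
  fixes c :: "nat \<Rightarrow> ereal"
  assumes \<delta>: "0 < \<delta>" and L: "finite L" and D: "D \<subseteq> L" and I: "admissible I"
    and labels: "\<And>a b t. (a, b, t) \<in> I \<Longrightarrow> a \<in> L \<and> b \<in> L"
  shows "(\<integral>\<omega>. of_bool (\<forall>n\<in>D. grid_time \<delta> J n \<omega> < c n) * of_bool (\<forall>(a, b, t)\<in>I. grid_linked \<delta> J t \<omega> a b) \<partial>M) =
    (\<integral>\<omega>. of_bool (\<forall>n\<in>D. grid_time \<delta> J n \<omega> < c n) * block_product q (grid_linked \<delta> J 0 \<omega>) I \<partial>M)"
proof -
  define S where "S = PiE L (\<lambda>_. {1..Suc J})"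
  define e where "e s = (of_bool (\<forall>n\<in>D. (if s n = Suc J then \<infinity> else ereal (real (s n) * \<delta>)) < c n) :: real)" for s
  define C where "C s \<omega> = (of_bool (\<forall>n\<in>L. grid_index \<delta> J n \<omega> = s n) :: real)" for s \<omega>
  have finS: "finite S" unfolding S_def using L by (intro finite_PiE) auto
  have decomp: "of_bool (\<forall>n\<in>D. grid_time \<delta> J n \<omega> < c n) * f = (\<Sum>s\<in>S. e s * (C s \<omega> * f))"
    if \<omega>: "\<omega> \<in> space M" for \<omega> and f :: real
  proof -
    define s0 where "s0 = restrict (\<lambda>n. grid_index \<delta> J n \<omega>) L"
    have s0: "s0 \<in> S" unfolding S_def s0_def
      using grid_index_le[of \<delta> J _ \<omega>] grid_index_pos[OF \<omega> \<delta>] by auto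
    have "C s \<omega> = (if s = s0 then 1 else 0)" if "s \<in> S" for s
    proof -
      have "(\<forall>n\<in>L. grid_index \<delta> J n \<omega> = s n) \<longleftrightarrow> s = s0"
        using that by (auto simp: S_def s0_def PiE_iff extensional_def fun_eq_iff)
      then show ?thesis by (simp add: C_def)
    qed
    then have "(\<Sum>s\<in>S. e s * (C s \<omega> * f)) = (\<Sum>s\<in>S. if s = s0 then e s0 * f else 0)"
      by (intro sum.cong) auto
    also have "\<dots> = e s0 * f" using finS s0 by simp
    also have "e s0 = of_bool (\<forall>n\<in>D. grid_time \<delta> J n \<omega> < c n)"
      unfolding e_def s0_def grid_time_def using D by (intro arg_cong[where f=of_bool] ball_cong refl) auto
    finally show ?thesis by simp
  qed
  have C_meas [measurable]: "C s \<in> borel_measurable M" for s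
  proof -
    have "Measurable.pred M (\<lambda>\<omega>. \<forall>n\<in>L. grid_index \<delta> J n \<omega> = s n)"
      using L pred_grid_index[OF \<delta>] by (intro pred_intros_finite) auto
    then show ?thesis unfolding C_def by measurable
  qed
  have sum: "(\<integral>\<omega>. of_bool (\<forall>n\<in>D. grid_time \<delta> J n \<omega> < c n) * f \<omega> \<partial>M) = (\<Sum>s\<in>S. e s * (\<integral>\<omega>. C s \<omega> * f \<omega> \<partial>M))"
    if f: "f \<in> borel_measurable M" "\<And>\<omega>. \<bar>f \<omega>\<bar> \<le> 1" for f
  proof -
    have int: "integrable M (\<lambda>\<omega>. C s \<omega> * f \<omega>)" for s
    proof (rule integrable_const_bound[where B=1])
      show "AE \<omega> in M. norm (C s \<omega> * f \<omega>) \<le> 1" using f(2) by (simp add: C_def)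
    qed (use f(1) in measurable)
    have "(\<integral>\<omega>. of_bool (\<forall>n\<in>D. grid_time \<delta> J n \<omega> < c n) * f \<omega> \<partial>M) = (\<integral>\<omega>. (\<Sum>s\<in>S. e s * (C s \<omega> * f \<omega>)) \<partial>M)"
      by (intro Bochner_Integration.integral_cong refl decomp)
    also have "\<dots> = (\<Sum>s\<in>S. e s * (\<integral>\<omega>. C s \<omega> * f \<omega> \<partial>M))"
      using int by (subst Bochner_Integration.integral_sum) auto
    finally show ?thesis .
  qed
  have finI: "finite I" using I by (simp add: admissible_def)
  have m1: "(\<lambda>\<omega>. of_bool (\<forall>(a, b, t)\<in>I. grid_linked \<delta> J t \<omega> a b) :: real) \<in> borel_measurable M"
  proof -
    have "Measurable.pred M (\<lambda>\<omega>. \<forall>x\<in>I. grid_linked \<delta> J (snd (snd x)) \<omega> (fst x) (fst (snd x)))"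
      using I pred_grid_linked[OF \<delta>] by (intro pred_intros_finite) (auto simp: admissible_def)
    then show ?thesis by (simp add: case_prod_beta')
  qed
  have m2: "(\<lambda>\<omega>. block_product q (grid_linked \<delta> J 0 \<omega>) I) \<in> borel_measurable M"
    using finI pred_grid_linked[OF \<delta>] by (intro measurable_block_product) auto
  have b2: "\<bar>block_product q R I\<bar> \<le> 1" for R
    using block_product_bounds[of q R I, OF q_bounds] by simp
  have "(\<integral>\<omega>. C s \<omega> * of_bool (\<forall>(a, b, t)\<in>I. grid_linked \<delta> J t \<omega> a b) \<partial>M) =
      (\<integral>\<omega>. C s \<omega> * block_product q (grid_linked \<delta> J 0 \<omega>) I \<partial>M)" if "s \<in> S" for s
    unfolding C_def using that by (intro grid_law_on_schedule[OF \<delta> L I labels]) (auto simp: S_def PiE_iff)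
  then show ?thesis using sum[OF m1] sum[OF m2 b2] by simp
qed

section \<open>Refining the grid\<close>

lemma grid_index_infinite:
  assumes \<omega>: "\<omega> \<in> space M" and \<delta>: "0 < \<delta>" and "\<sigma> n \<omega> = \<infinity>"
  shows "grid_index \<delta> J n \<omega> = Suc J"
  using mem_A_grid[OF \<omega> \<delta> order_refl, of n J] mem_A_iff[OF \<omega>, of "real J * \<delta>" n]
    grid_index_le[of \<delta> J n \<omega>] \<delta> assms(3) by simp

lemma grid_index_finite:
  assumes \<omega>: "\<omega> \<in> space M" and \<delta>: "0 < \<delta>" and s: "\<sigma> n \<omega> = ereal s" and le: "s \<le> real J * \<delta>"
  shows "grid_index \<delta> J n \<omega> \<le> J" "s \<le> real (grid_index \<delta> J n \<omega>) * \<delta>"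
    "real (grid_index \<delta> J n \<omega>) * \<delta> < s + \<delta>"
proof -
  let ?k = "grid_index \<delta> J n \<omega>"
  have iff: "i < ?k \<longleftrightarrow> real i * \<delta> < s" if "i \<le> J" for i
    using mem_A_grid[OF \<omega> \<delta> that, of n] mem_A_iff[OF \<omega>, of "real i * \<delta>" n] s \<delta> by simp
  show k: "?k \<le> J" using iff[of J] le by simp
  show "s \<le> real ?k * \<delta>" using iff[OF k] by simp
  have "1 \<le> ?k" by (rule grid_index_pos[OF \<omega> \<delta>])
  then have "real (?k - 1) * \<delta> < s" using iff[of "?k - 1"] k by simp
  then show "real ?k * \<delta> < s + \<delta>" using \<open>1 \<le> ?k\<close> by (simp add: of_nat_diff algebra_simps)
qed

lemma grid_index_cong:
  assumes "\<omega> \<in> space M" "0 < \<delta>" "\<sigma> a \<omega> = \<sigma> b \<omega>"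
  shows "grid_index \<delta> J a \<omega> = grid_index \<delta> J b \<omega>"
  using assms by (simp add: grid_index_def mem_A_iff)

text \<open>A mesh that tends to \<open>0\<close>; the number of steps grows faster, so that the grid eventually covers
every bounded interval.\<close>

definition mesh :: "nat \<Rightarrow> real" where
  "mesh m = inverse (real (Suc m))"

definition steps :: "nat \<Rightarrow> nat" where
  "steps m = Suc m * Suc m"

lemma mesh_pos: "0 < mesh m"
  by (simp add: mesh_def)

lemma eventually_mesh_less:
  assumes "0 < e" shows "\<forall>\<^sub>F m in sequentially. mesh m < e"
  using order_tendstoD(2)[OF LIMSEQ_inverse_real_of_nat assms] by (simp add: mesh_def)

lemma eventually_grid_covers: "\<forall>\<^sub>F m in sequentially. s \<le> real (steps m) * mesh m"
proof -
  have eq: "real (steps m) * mesh m = real (Suc m)" for m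
    unfolding steps_def mesh_def of_nat_mult by (simp del: of_nat_Suc)
  obtain N where "s \<le> real N" using real_arch_simple by blast
  then have "s \<le> real (Suc m)" if "N \<le> m" for m using that by simp
  then show ?thesis unfolding eq by (rule eventually_sequentiallyI)
qed

lemma eventually_grid_index:
  assumes \<omega>: "\<omega> \<in> space M" and s: "\<sigma> n \<omega> = ereal s" and e: "0 < e"
  shows "\<forall>\<^sub>F m in sequentially. grid_index (mesh m) (steps m) n \<omega> \<le> steps m \<and>
    s \<le> real (grid_index (mesh m) (steps m) n \<omega>) * mesh m \<and>
    real (grid_index (mesh m) (steps m) n \<omega>) * mesh m < s + e"
  using eventually_grid_covers[of s] eventually_mesh_less[OF e]
proof eventually_elim
  case (elim m)
  then show ?case using grid_index_finite[OF \<omega> mesh_pos s, of "steps m" m] by simp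
qed

text \<open>Rounding up never decreases a time. Therefore strict upper bounds are the events whose indicators
converge at every point, also when the bound equals the time.\<close>

lemma eventually_grid_time:
  assumes \<omega>: "\<omega> \<in> space M"
  shows "\<forall>\<^sub>F m in sequentially. grid_time (mesh m) (steps m) n \<omega> < c \<longleftrightarrow> \<sigma> n \<omega> < c"
proof (cases rule: \<sigma>_cases[OF \<omega>, of n])
  case 1
  then show ?thesis using grid_index_infinite[OF \<omega> mesh_pos] by (simp add: grid_time_def)
next
  case (2 s)
  show ?thesis
  proof (cases "ereal s < c")
    case True
    then obtain r where r: "s < r" "ereal r < c" using ereal_dense2[of "ereal s" c] by auto
    then have "0 < r - s" by simp
    from eventually_grid_index[OF \<omega> 2(1) this] show ?thesis
    proof eventually_elim
      case (elim m)
      then have "grid_time (mesh m) (steps m) n \<omega> < ereal r" by (simp add: grid_time_def)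
      then show ?case using r(2) True 2(1) by (simp add: order.strict_trans)
    qed
  next
    case False
    from eventually_grid_index[OF \<omega> 2(1) zero_less_one] show ?thesis
    proof eventually_elim
      case (elim m)
      then have "ereal s \<le> grid_time (mesh m) (steps m) n \<omega>" by (simp add: grid_time_def)
      then have "c \<le> grid_time (mesh m) (steps m) n \<omega>" using False by (meson not_less order.trans)
      then show ?case using 2(1) False by (metis not_less)
    qed
  qed
qed

text \<open>Labels with equal detachment times have equal grid indices on every grid, and the rounded times approach
the common value from the right, where the partition restricted to the two labels is
constant. Labels with different detachment times are separated by a sufficiently fine grid.\<close>

lemma eventually_grid_linked:
  assumes \<omega>: "\<omega> \<in> space M" and t: "0 \<le> t"
  shows "\<forall>\<^sub>F m in sequentially. grid_linked (mesh m) (steps m) t \<omega> a b \<longleftrightarrow> spine_linked t \<omega> a b"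
proof (cases "\<sigma> a \<omega> = \<sigma> b \<omega>")
  case True
  show ?thesis
  proof (cases rule: \<sigma>_cases[OF \<omega>, of a])
    case 1
    then show ?thesis
      using True grid_index_infinite[OF \<omega> mesh_pos] by (simp add: grid_linked_def spine_linked_def)
  next
    case (2 s)
    have sp: "spine_linked t \<omega> a b \<longleftrightarrow> linked (X (s + t) \<omega>) a b"
      unfolding spine_linked_def True[symmetric] 2(1) by simp
    have "0 \<le> s + t" using 2 t by simp
    from linked_right_cont[OF \<omega> this, of a b] obtain d where d: "s + t < d"
      "\<And>u. s + t < u \<Longrightarrow> u < d \<Longrightarrow> linked (X u \<omega>) a b \<longleftrightarrow> linked (X (s + t) \<omega>) a b"
      by (auto simp: eventually_at_right_field)
    then have "0 < d - (s + t)" by simp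
    from eventually_grid_index[OF \<omega> 2(1) this] show ?thesis
    proof eventually_elim
      case (elim m)
      let ?u = "real (grid_index (mesh m) (steps m) a \<omega>) * mesh m"
      have "linked (X (?u + t) \<omega>) a b \<longleftrightarrow> linked (X (s + t) \<omega>) a b"
        using elim d(2)[of "?u + t"] by (cases "?u = s") auto
      moreover have "grid_linked (mesh m) (steps m) t \<omega> a b \<longleftrightarrow> linked (X (?u + t) \<omega>) a b"
        using elim grid_index_cong[OF \<omega> mesh_pos True] by (simp add: grid_linked_def)
      ultimately show ?case using sp by simp
    qed
  qed
next
  case False
  have "\<forall>\<^sub>F m in sequentially. grid_index (mesh m) (steps m) a \<omega> \<noteq> grid_index (mesh m) (steps m) b \<omega>"
  proof (cases rule: \<sigma>_cases[OF \<omega>, of a])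
    case 1
    then obtain s where s: "\<sigma> b \<omega> = ereal s" using False \<sigma>_cases[OF \<omega>, of b] by metis
    from eventually_grid_index[OF \<omega> s zero_less_one] show ?thesis
      by eventually_elim (use grid_index_infinite[OF \<omega> mesh_pos 1] in auto)
  next
    case (2 s)
    show ?thesis
    proof (cases rule: \<sigma>_cases[OF \<omega>, of b])
      case 1
      from eventually_grid_index[OF \<omega> 2(1) zero_less_one] show ?thesis
        by eventually_elim (use grid_index_infinite[OF \<omega> mesh_pos 1] in auto)
    next
      case b: (2 s')
      then have "0 < \<bar>s - s'\<bar>" using False 2 by auto
      from eventually_grid_index[OF \<omega> 2(1) this] eventually_grid_index[OF \<omega> b(1) this]
      show ?thesis by eventually_elim auto
    qed
  qed
  then show ?thesis by eventually_elim (use False in \<open>simp add: grid_linked_def spine_linked_def\<close>)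
qed

lemma pred_spine_linked:
  assumes t: "0 \<le> t"
  shows "Measurable.pred M (\<lambda>\<omega>. spine_linked t \<omega> a b)"
proof -
  have "Measurable.pred M (\<lambda>\<omega>. \<exists>N. \<forall>m\<in>{N..}. grid_linked (mesh m) (steps m) t \<omega> a b)"
    using pred_grid_linked[OF mesh_pos t] by measurable
  moreover have "(\<exists>N. \<forall>m\<in>{N..}. grid_linked (mesh m) (steps m) t \<omega> a b) \<longleftrightarrow> spine_linked t \<omega> a b"
    if \<omega>: "\<omega> \<in> space M" for \<omega>
  proof -
    obtain N where N: "\<And>m. N \<le> m \<Longrightarrow> grid_linked (mesh m) (steps m) t \<omega> a b \<longleftrightarrow> spine_linked t \<omega> a b"
      using eventually_grid_linked[OF \<omega> t, of a b] by (auto simp: eventually_sequentially)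
    show ?thesis
    proof
      assume "\<exists>N. \<forall>m\<in>{N..}. grid_linked (mesh m) (steps m) t \<omega> a b"
      then obtain N' where "\<forall>m\<in>{N'..}. grid_linked (mesh m) (steps m) t \<omega> a b" by auto
      then have "grid_linked (mesh (max N N')) (steps (max N N')) t \<omega> a b" by simp
      then show "spine_linked t \<omega> a b" using N[of "max N N'"] by simp
    qed (use N in \<open>auto intro!: exI[of _ N]\<close>)
  qed
  ultimately show ?thesis by (simp cong: measurable_cong)
qed

lemma measurable_detach_time: "\<sigma> n \<in> borel_measurable M"
proof (rule borel_measurableI_greater)
  fix y :: ereal
  show "{\<omega>\<in>space M. y < \<sigma> n \<omega>} \<in> sets M"
  proof (cases "0 \<le> y")
    case False
    then have "{\<omega>\<in>space M. y < \<sigma> n \<omega>} = space M" using \<sigma>_pos by (auto simp: not_le intro: order.strict_trans[of y 0])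
    then show ?thesis by simp
  next
    case True
    show ?thesis
    proof (cases y)
      case (real r)
      then have "{\<omega>\<in>space M. y < \<sigma> n \<omega>} = {\<omega>\<in>space M. n \<in> A r \<omega>}" using True mem_A_iff[of _ r n] by auto
      then show ?thesis using pred_F_M[OF A_measurable[of r n]] real True by (simp add: pred_def)
    qed (use True in auto)
  qed
qed

lemma spine_law:
  fixes c :: "nat \<Rightarrow> ereal"
  assumes D: "finite D" and I: "admissible I"
  shows "(\<integral>\<omega>. of_bool (\<forall>n\<in>D. \<sigma> n \<omega> < c n) * of_bool (\<forall>(a, b, t)\<in>I. spine_linked t \<omega> a b) \<partial>M) =
    (\<integral>\<omega>. of_bool (\<forall>n\<in>D. \<sigma> n \<omega> < c n) * block_product q (spine_linked 0 \<omega>) I \<partial>M)"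
proof -
  define L where "L = D \<union> fst ` I \<union> (fst \<circ> snd) ` I"
  have finI: "finite I" using I by (simp add: admissible_def)
  have L: "finite L" "D \<subseteq> L" using D finI by (auto simp: L_def)
  have labels: "a \<in> L \<and> b \<in> L" if "(a, b, t) \<in> I" for a b t using that by (force simp: L_def)
  define T where "T S \<omega> = (of_bool (\<forall>n\<in>D. S n \<omega> < c n) :: real)" for S :: "nat \<Rightarrow> 'a \<Rightarrow> ereal" and \<omega>
  define f where "f R \<omega> = (of_bool (\<forall>(a, b, t)\<in>I. R t \<omega> a b) :: real)" for R :: "real \<Rightarrow> 'a \<Rightarrow> nat \<Rightarrow> nat \<Rightarrow> bool" and \<omega>
  define g where "g R \<omega> = block_product q (R (0 :: real) \<omega>) I" for R :: "real \<Rightarrow> 'a \<Rightarrow> nat \<Rightarrow> nat \<Rightarrow> bool" and \<omega>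
  define S where "S m = grid_time (mesh m) (steps m)" for m
  define R where "R m = grid_linked (mesh m) (steps m)" for m
  have bp: "\<bar>block_product q Q I\<bar> \<le> 1" for Q
    using block_product_bounds[of q Q I, OF q_bounds] by simp
  have ev_T: "\<forall>\<^sub>F m in sequentially. T (S m) \<omega> = T \<sigma> \<omega>" if "\<omega> \<in> space M" for \<omega>
  proof -
    have "\<forall>\<^sub>F m in sequentially. \<forall>n\<in>D. S m n \<omega> < c n \<longleftrightarrow> \<sigma> n \<omega> < c n"
      unfolding S_def using D eventually_grid_time[OF that] by (intro eventually_ball_finite) auto
    then show ?thesis by eventually_elim (auto simp: T_def)
  qed
  have ev_f: "\<forall>\<^sub>F m in sequentially. f (R m) \<omega> = f spine_linked \<omega>" if "\<omega> \<in> space M" for \<omega>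
  proof -
    have "\<forall>\<^sub>F m in sequentially. \<forall>x\<in>I. R m (snd (snd x)) \<omega> (fst x) (fst (snd x)) \<longleftrightarrow>
        spine_linked (snd (snd x)) \<omega> (fst x) (fst (snd x))"
      unfolding R_def using I eventually_grid_linked[OF that]
      by (intro eventually_ball_finite) (auto simp: admissible_def)
    then show ?thesis by eventually_elim (simp add: f_def case_prod_beta')
  qed
  have ev_g: "\<forall>\<^sub>F m in sequentially. g (R m) \<omega> = g spine_linked \<omega>" if "\<omega> \<in> space M" for \<omega>
  proof -
    have "\<forall>\<^sub>F m in sequentially. \<forall>x\<in>L \<times> L. R m 0 \<omega> (fst x) (snd x) \<longleftrightarrow> spine_linked 0 \<omega> (fst x) (snd x)"
      unfolding R_def using L eventually_grid_linked[OF that order_refl] by (intro eventually_ball_finite) auto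
    then show ?thesis
    proof eventually_elim
      case (elim m)
      then show ?case unfolding g_def by (intro block_product_cong) (auto simp: L_def)
    qed
  qed
  have T_meas: "T (S m) \<in> borel_measurable M" for m
  proof -
    have meas: "S m n \<in> borel_measurable M" for n
    proof -
      have [measurable]: "grid_index (mesh m) (steps m) n \<in> M \<rightarrow>\<^sub>M count_space UNIV"
        by (rule measurable_grid_index[OF mesh_pos])
      have "(\<lambda>k. if k = Suc (steps m) then \<infinity> else ereal (real k * mesh m)) \<in> count_space UNIV \<rightarrow>\<^sub>M borel"
        by simp
      from measurable_compose[OF measurable_grid_index[OF mesh_pos] this]
      show ?thesis unfolding S_def grid_time_def .
    qed
    have "Measurable.pred M (\<lambda>\<omega>. \<forall>n\<in>D. S m n \<omega> < c n)"
      using D meas by (intro pred_intros_finite borel_measurable_pred_less) auto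
    then show ?thesis unfolding T_def by measurable
  qed
  have "Measurable.pred M (\<lambda>\<omega>. \<forall>n\<in>D. \<sigma> n \<omega> < c n)"
    using D measurable_detach_time by (intro pred_intros_finite borel_measurable_pred_less) auto
  then have T\<sigma>_meas: "T \<sigma> \<in> borel_measurable M" unfolding T_def by measurable
  have f_meas: "f Q \<in> borel_measurable M" if "\<And>t a b. 0 \<le> t \<Longrightarrow> Measurable.pred M (\<lambda>\<omega>. Q t \<omega> a b)" for Q
  proof -
    have "Measurable.pred M (\<lambda>\<omega>. \<forall>x\<in>I. Q (snd (snd x)) \<omega> (fst x) (fst (snd x)))"
      using I that by (intro pred_intros_finite) (auto simp: admissible_def)
    then show ?thesis unfolding f_def by (simp add: case_prod_beta')
  qed
  have g_meas: "g Q \<in> borel_measurable M" if "\<And>t a b. 0 \<le> t \<Longrightarrow> Measurable.pred M (\<lambda>\<omega>. Q t \<omega> a b)" for Q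
    unfolding g_def using finI that by (intro measurable_block_product) auto
  have R_pred: "Measurable.pred M (\<lambda>\<omega>. R m t \<omega> a b)" if "0 \<le> t" for m t a b
    unfolding R_def by (rule pred_grid_linked[OF mesh_pos that])
  have lim: "(\<lambda>m. \<integral>\<omega>. T (S m) \<omega> * h (R m) \<omega> \<partial>M) \<longlonglongrightarrow> (\<integral>\<omega>. T \<sigma> \<omega> * h spine_linked \<omega> \<partial>M)"
    if h: "h = f \<or> h = g" for h
  proof (rule integral_dominated_convergence[where w="\<lambda>_. 1"])
    show "(\<lambda>\<omega>. T \<sigma> \<omega> * h spine_linked \<omega>) \<in> borel_measurable M"
      using h T\<sigma>_meas f_meas[OF pred_spine_linked] g_meas[OF pred_spine_linked] by auto
    show "(\<lambda>\<omega>. T (S m) \<omega> * h (R m) \<omega>) \<in> borel_measurable M" for m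
      using h T_meas f_meas[OF R_pred] g_meas[OF R_pred] by auto
    show "AE \<omega> in M. (\<lambda>m. T (S m) \<omega> * h (R m) \<omega>) \<longlonglongrightarrow> T \<sigma> \<omega> * h spine_linked \<omega>"
    proof (rule AE_I2)
      fix \<omega> assume \<omega>: "\<omega> \<in> space M"
      have "\<forall>\<^sub>F m in sequentially. h (R m) \<omega> = h spine_linked \<omega>" using h ev_f[OF \<omega>] ev_g[OF \<omega>] by auto
      with ev_T[OF \<omega>] have "\<forall>\<^sub>F m in sequentially. T (S m) \<omega> * h (R m) \<omega> = T \<sigma> \<omega> * h spine_linked \<omega>"
        by eventually_elim simp
      then show "(\<lambda>m. T (S m) \<omega> * h (R m) \<omega>) \<longlonglongrightarrow> T \<sigma> \<omega> * h spine_linked \<omega>" by (rule tendsto_eventually)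
    qed
    have "\<bar>h Q \<omega>\<bar> \<le> 1" for Q \<omega> using h bp by (auto simp: f_def g_def)
    then show "AE \<omega> in M. norm (T (S m) \<omega> * h (R m) \<omega>) \<le> 1" for m by (simp add: T_def)
  qed simp
  have "(\<integral>\<omega>. T (S m) \<omega> * f (R m) \<omega> \<partial>M) = (\<integral>\<omega>. T (S m) \<omega> * g (R m) \<omega> \<partial>M)" for m
    unfolding T_def f_def g_def S_def R_def by (rule grid_law[OF mesh_pos L I labels])
  then have "(\<integral>\<omega>. T \<sigma> \<omega> * f spine_linked \<omega> \<partial>M) = (\<integral>\<omega>. T \<sigma> \<omega> * g spine_linked \<omega> \<partial>M)"
    using LIMSEQ_unique[OF lim[of f]] lim[of g] by simp
  then show ?thesis by (simp add: T_def f_def g_def)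
qed

section \<open>From queries to conditional laws\<close>

lemma measurable_spinal: "0 \<le> t \<Longrightarrow> spinal X A t \<in> M \<rightarrow>\<^sub>M partition_algebra"
proof (rule measurable_partition_algebraI)
  show "partition_on (\<Union>(spinal X A t \<omega>)) (spinal X A t \<omega>)" if "0 \<le> t" "\<omega> \<in> space M" for \<omega>
    using spinal_in_space[OF that(2,1)] by (simp add: space_partition_algebra)
  show "Measurable.pred M (\<lambda>\<omega>. linked (spinal X A t \<omega>) i j)" if "0 \<le> t" for i j
    using pred_spine_linked[OF that] by (simp add: linked_spinal that cong: measurable_cong)
qed

text \<open>A fragmentation started from \<open>P\<close> is in the state \<open>P\<close> at time \<open>0\<close>, so that conditions on the initial
partition can be absorbed into the query.\<close>

lemma block_product_time_0:
  assumes P: "partition_on UNIV P" and I: "admissible I" and K: "finite K" "\<And>a b t. (a, b, t) \<in> K \<Longrightarrow> t = 0"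
  shows "block_product q (linked P) (I \<union> K) = of_bool (related_on (linked P) K) * block_product q (linked P) I"
proof (cases "related_on (linked P) (I \<union> K)")
  case False
  then show ?thesis by (auto simp: block_product_def related_on_def ball_Un)
next
  case True
  define g where "g = block_min P"
  define T where "T = g ` fst ` (I \<union> K)"
  have P': "partition_on (\<Union>P) P" using P by (simp add: partition_on_def)
  have finI: "finite I" using I by (simp add: admissible_def)
  have lk: "linked P a b \<longleftrightarrow> g a = g b" for a b
    unfolding g_def by (rule linked_iff_block_min[OF P' linked_refl[OF P] linked_refl[OF P]])
  have on: "related_on (linked P) I" "related_on (linked P) K" using True by (auto simp: related_on_def)
  have q_eq: "q (J \<union> N) = q J" if "N \<subseteq> K" for J N
  proof -
    have "linked_on (\<lambda>t. X t \<omega>) N" if "\<omega> \<in> space M" for \<omega>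
      unfolding linked_on_def
    proof clarify
      fix a b t assume "(a, b, t) \<in> N"
      then have "t = 0" using K \<open>N \<subseteq> K\<close> by auto
      then show "linked (X t \<omega>) a b" using X_0[OF that] by (simp add: linked_def)
    qed
    moreover have "linked_on x (J \<union> N) \<longleftrightarrow> linked_on x J \<and> linked_on x N" for x
      by (simp add: linked_on_def ball_Un)
    ultimately have "{\<omega>\<in>space M. linked_on (\<lambda>t. X t \<omega>) (J \<union> N)} = {\<omega>\<in>space M. linked_on (\<lambda>t. X t \<omega>) J}"
      by auto
    then show ?thesis by (simp add: link_prob_def)
  qed
  have "block_product q (linked P) (I \<union> K) = (\<Prod>k\<in>T. q {x\<in>I \<union> K. g (fst x) = k})"
    using finI K(1) q_empty by (intro block_product_leader lk True) (simp_all add: T_def)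
  also have "\<dots> = (\<Prod>k\<in>T. q {x\<in>I. g (fst x) = k})"
  proof (rule prod.cong[OF refl])
    fix k
    have "{x\<in>I \<union> K. g (fst x) = k} = {x\<in>I. g (fst x) = k} \<union> {x\<in>K. g (fst x) = k}" by auto
    then show "q {x\<in>I \<union> K. g (fst x) = k} = q {x\<in>I. g (fst x) = k}" using q_eq by simp
  qed
  also have "\<dots> = block_product q (linked P) I"
    using finI K(1) q_empty by (intro block_product_leader[symmetric] lk on(1)) (simp_all add: T_def image_mono)
  finally show ?thesis using on by simp
qed

lemma measurable_frag_law: "frag_law M X \<in> partition_algebra \<rightarrow>\<^sub>M prob_algebra path_algebra"
proof (rule measurable_prob_algebra_generated[OF sets_path_algebra Int_stable_path_events])
  show "path_event ` Collect admissible \<subseteq> Pow (space path_algebra)" by (auto simp: path_event_def)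
  fix P :: "nat set set" assume P: "P \<in> space partition_algebra"
  show "prob_space (frag_law M X P)" by (rule prob_space_frag_law[OF P])
  show "sets (frag_law M X P) = sets path_algebra" by (simp add: frag_law_def)
next
  fix E assume "E \<in> path_event ` Collect admissible"
  then obtain I where I: "admissible I" and E: "E = path_event I" by auto
  have "emeasure (frag_law M X P) E = ennreal (block_product q (linked P) I)"
    if P: "P \<in> space partition_algebra" for P
  proof -
    interpret P: prob_space "frag_law M X P" by (rule prob_space_frag_law[OF P])
    show ?thesis using measure_frag_law[OF P I] by (simp add: E P.emeasure_eq_measure)
  qed
  moreover have "(\<lambda>P. block_product q (linked P) I) \<in> borel_measurable partition_algebra"
    using I by (intro measurable_block_product pred_linked) (simp add: admissible_def)
  ultimately show "(\<lambda>P. emeasure (frag_law M X P) E) \<in> borel_measurable partition_algebra"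
    by (simp cong: measurable_cong)
qed

text \<open>These events form a \<open>\<pi>\<close>-system generating the \<open>\<sigma>\<close>-algebra of the conditioning. The condition on the
spinal partition is a query at time \<open>0\<close>, so that it can be united with a query about the path.\<close>

definition spine_event :: "nat set \<Rightarrow> (nat \<Rightarrow> ereal) \<Rightarrow> query \<Rightarrow> 'a set" where
  "spine_event D c K = {\<omega>\<in>space M. (\<forall>n\<in>D. \<sigma> n \<omega> < c n) \<and> related_on (spine_linked 0 \<omega>) K}"

definition spine_events :: "'a set set" where
  "spine_events = {spine_event D c K | D c K. finite D \<and> finite K \<and> (\<forall>(a, b, t)\<in>K. t = 0)}"

lemma spine_events_sub: "spine_events \<subseteq> Pow (space M)"
  by (auto simp: spine_events_def spine_event_def)

lemma space_in_spine_events: "space M \<in> spine_events"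
proof -
  have "space M = spine_event {} (\<lambda>_. 0) {}" by (auto simp: spine_event_def related_on_def)
  then show ?thesis unfolding spine_events_def by blast
qed

lemma Int_stable_spine_events: "Int_stable spine_events"
proof (rule Int_stableI)
  fix G H assume "G \<in> spine_events" "H \<in> spine_events"
  then obtain D c K D' c' K' where G: "G = spine_event D c K" "finite D" "finite K" "\<forall>(a, b, t)\<in>K. t = 0"
    and H: "H = spine_event D' c' K'" "finite D'" "finite K'" "\<forall>(a, b, t)\<in>K'. t = 0"
    unfolding spine_events_def by auto
  define e where "e n = (if n \<in> D \<inter> D' then min (c n) (c' n) else if n \<in> D then c n else c' n)" for n
  have "(\<forall>n\<in>D \<union> D'. \<sigma> n \<omega> < e n) \<longleftrightarrow> (\<forall>n\<in>D. \<sigma> n \<omega> < c n) \<and> (\<forall>n\<in>D'. \<sigma> n \<omega> < c' n)" for \<omega>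
    by (auto simp: e_def split: if_splits)
  moreover have "related_on R (K \<union> K') \<longleftrightarrow> related_on R K \<and> related_on R K'" for R
    by (simp add: related_on_def ball_Un)
  ultimately have "G \<inter> H = spine_event (D \<union> D') e (K \<union> K')"
    unfolding G H spine_event_def by auto
  moreover have "finite (D \<union> D')" "finite (K \<union> K')" "\<forall>(a, b, t)\<in>K \<union> K'. t = 0" using G H by auto
  ultimately show "G \<inter> H \<in> spine_events" unfolding spine_events_def by blast
qed

lemma spine_event_in_sets:
  assumes "finite D" "finite K"
  shows "spine_event D c K \<in> sets M"
proof -
  have "Measurable.pred M (\<lambda>\<omega>. \<forall>n\<in>D. \<sigma> n \<omega> < c n)"
    using assms measurable_detach_time by (intro pred_intros_finite borel_measurable_pred_less) auto
  moreover have "Measurable.pred M (\<lambda>\<omega>. \<forall>x\<in>K. spine_linked 0 \<omega> (fst x) (fst (snd x)))"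
    using assms pred_spine_linked by (intro pred_intros_finite) auto
  ultimately show ?thesis
    unfolding spine_event_def related_on_def case_prod_beta' pred_def by (intro sets.sets_Collect_conj)
qed

abbreviation spinal_data :: "'a \<Rightarrow> nat set set \<times> (nat \<Rightarrow> ereal)" where
  "spinal_data \<omega> \<equiv> (spinal X A 0 \<omega>, \<lambda>n. \<sigma> n \<omega>)"

abbreviation data_space :: "(nat set set \<times> (nat \<Rightarrow> ereal)) measure" where
  "data_space \<equiv> partition_algebra \<Otimes>\<^sub>M PiM UNIV (\<lambda>_. borel)"

lemma measurable_spinal_dataI:
  assumes "spinal X A 0 \<in> N \<rightarrow>\<^sub>M partition_algebra" "\<And>n. \<sigma> n \<in> borel_measurable N"
  shows "spinal_data \<in> N \<rightarrow>\<^sub>M data_space"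
  using assms by (intro measurable_Pair measurable_PiM_single') auto

lemma spinal_data_in_space: "spinal_data \<in> space M \<rightarrow> space data_space"
  using spinal_in_space by (auto simp: space_pair_measure space_PiM)

lemma sets_spinal_algebra:
  "sets (spinal_algebra M X A) = {spinal_data -` E \<inter> space M | E. E \<in> sets data_space}"
  unfolding spinal_algebra_def by (rule sets_vimage_algebra2[OF spinal_data_in_space])

lemma subalgebra_spinal_algebra: "subalgebra M (spinal_algebra M X A)"
proof -
  have "spinal_data \<in> M \<rightarrow>\<^sub>M data_space"
    by (rule measurable_spinal_dataI[OF measurable_spinal[OF order_refl] measurable_detach_time])
  then show ?thesis
    unfolding subalgebra_def sets_spinal_algebra using measurable_sets
    by (auto simp: spinal_algebra_def)
qed

lemma spinal_algebra_generated: "sets (spinal_algebra M X A) \<subseteq> sigma_sets (space M) spine_events"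
proof -
  let ?G = "sigma (space M) spine_events"
  have sets: "sets ?G = sigma_sets (space M) spine_events" and space: "space ?G = space M"
    using spine_events_sub by (auto simp: sets_measure_of space_measure_of)
  have basic: "spine_event D c K \<in> sets ?G" if "finite D" "finite K" "\<forall>(a, b, t)\<in>K. t = 0" for D c K
    unfolding sets using that by (intro sigma_sets.Basic) (auto simp: spine_events_def)
  have "spinal X A 0 \<in> ?G \<rightarrow>\<^sub>M partition_algebra"
  proof (rule measurable_partition_algebraI)
    show "partition_on (\<Union>(spinal X A 0 \<omega>)) (spinal X A 0 \<omega>)" if "\<omega> \<in> space ?G" for \<omega>
      using spinal_in_space[of \<omega> 0] that by (simp add: space space_partition_algebra)
    have "{\<omega>\<in>space ?G. linked (spinal X A 0 \<omega>) i j} = spine_event {} (\<lambda>_. 0) {(i, j, 0)}" for i j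
      by (auto simp: space spine_event_def related_on_def linked_spinal)
    then show "Measurable.pred ?G (\<lambda>\<omega>. linked (spinal X A 0 \<omega>) i j)" for i j
      unfolding pred_def using basic[of "{}" "{(i, j, 0)}"] by simp
  qed
  moreover have "\<sigma> n \<in> borel_measurable ?G" for n
  proof (rule borel_measurableI_less)
    fix y
    have "{\<omega>\<in>space ?G. \<sigma> n \<omega> < y} = spine_event {n} (\<lambda>_. y) {}"
      by (auto simp: space spine_event_def related_on_def)
    then show "{\<omega>\<in>space ?G. \<sigma> n \<omega> < y} \<in> sets ?G" using basic[of "{n}" "{}"] by simp
  qed
  ultimately have "spinal_data \<in> ?G \<rightarrow>\<^sub>M data_space" by (rule measurable_spinal_dataI)
  then have "spinal_data -` E \<inter> space M \<in> sets ?G" if "E \<in> sets data_space" for E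
    using measurable_sets[of spinal_data ?G data_space E] that by (simp add: space)
  then show ?thesis unfolding sets_spinal_algebra sets[symmetric] by auto
qed

abbreviation spinal_path :: "'a \<Rightarrow> real \<Rightarrow> nat set set" where
  "spinal_path \<omega> \<equiv> \<lambda>t\<in>{0..}. spinal X A t \<omega>"

abbreviation spinal_law :: "'a \<Rightarrow> (real \<Rightarrow> nat set set) measure" where
  "spinal_law \<omega> \<equiv> frag_law M X (spinal X A 0 \<omega>)"

lemma measurable_spinal_path: "spinal_path \<in> M \<rightarrow>\<^sub>M path_algebra"
  by (rule measurable_path[OF measurable_spinal])

lemma spinal_path_event:
  assumes \<omega>: "\<omega> \<in> space M" and I: "admissible I"
  shows "spinal_path \<omega> \<in> path_event I \<longleftrightarrow> (\<forall>(a, b, t)\<in>I. spine_linked t \<omega> a b)"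
proof -
  have "linked_on (spinal_path \<omega>) I \<longleftrightarrow> (\<forall>(a, b, t)\<in>I. spine_linked t \<omega> a b)"
    unfolding linked_on_def using I linked_spinal[OF \<omega>]
    by (intro ball_cong refl) (auto simp: admissible_def)
  then show ?thesis using measurable_space[OF measurable_spinal_path \<omega>] by (simp add: path_event_def)
qed

lemma emeasure_spinal_law:
  assumes \<omega>: "\<omega> \<in> space M" and I: "admissible I"
  shows "emeasure (spinal_law \<omega>) (path_event I) = ennreal (block_product q (spine_linked 0 \<omega>) I)"
proof -
  have P: "spinal X A 0 \<omega> \<in> space partition_algebra" using spinal_in_space[OF \<omega>] by simp
  interpret P: prob_space "spinal_law \<omega>" by (rule prob_space_frag_law[OF P])
  have "linked (spinal X A 0 \<omega>) = spine_linked 0 \<omega>"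
    using linked_spinal[OF \<omega>] by (intro ext) simp
  then show ?thesis using measure_frag_law[OF P I] by (simp add: P.emeasure_eq_measure)
qed

text \<open>The part of the event that concerns the spinal partition is moved into the query, on the left because
the spinal path starts from the spinal partition and on the right by \<open>block_product_time_0\<close>;
then \<open>spine_law\<close> applies.\<close>

lemma spinal_law_on_generators:
  assumes H: "H \<in> spine_events" and I: "admissible I"
  shows "(\<integral>\<^sup>+\<omega>. indicator H \<omega> * indicator (path_event I) (spinal_path \<omega>) \<partial>M) =
    (\<integral>\<^sup>+\<omega>. indicator H \<omega> * emeasure (spinal_law \<omega>) (path_event I) \<partial>M)"
proof -
  obtain D c K where H_eq: "H = spine_event D c K" and D: "finite D" and K: "finite K" "\<forall>(a, b, t)\<in>K. t = 0"
    using H unfolding spine_events_def by auto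
  have H_M: "H \<in> sets M" unfolding H_eq by (rule spine_event_in_sets[OF D K(1)])
  have finI: "finite I" using I by (simp add: admissible_def)
  have IK: "admissible (I \<union> K)" using I K by (auto simp: admissible_def)
  let ?T = "\<lambda>\<omega>. of_bool (\<forall>n\<in>D. \<sigma> n \<omega> < c n) :: real"
  let ?bp = "\<lambda>\<omega>. block_product q (spine_linked 0 \<omega>) I"
  have bp: "0 \<le> block_product q Q J" "block_product q Q J \<le> 1" for Q J
    using block_product_bounds[of q Q J, OF q_bounds] .
  have bp_meas [measurable]: "?bp \<in> borel_measurable M"
    using finI pred_spine_linked by (intro measurable_block_product) auto
  have path_set: "{\<omega>\<in>space M. spinal_path \<omega> \<in> path_event I} \<in> sets M"
    using measurable_sets[OF measurable_spinal_path path_event_in_sets[OF I]]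
    by (simp add: vimage_def Int_def conj_commute)
  have lhs: "indicator H \<omega> * indicator (path_event I) (spinal_path \<omega>) =
      ?T \<omega> * of_bool (\<forall>(a, b, t)\<in>I \<union> K. spine_linked t \<omega> a b)" if \<omega>: "\<omega> \<in> space M" for \<omega>
  proof -
    have "related_on (spine_linked 0 \<omega>) K \<longleftrightarrow> (\<forall>(a, b, t)\<in>K. spine_linked t \<omega> a b)"
      unfolding related_on_def using K(2) by fastforce
    then show ?thesis
      using spinal_path_event[OF \<omega> I] \<omega> unfolding H_eq spine_event_def indicator_def ball_Un by simp
  qed
  have rhs: "indicator H \<omega> * ?bp \<omega> = ?T \<omega> * block_product q (spine_linked 0 \<omega>) (I \<union> K)"
    if \<omega>: "\<omega> \<in> space M" for \<omega>
  proof -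
    have "linked (spinal X A 0 \<omega>) = spine_linked 0 \<omega>" using linked_spinal[OF \<omega>] by (intro ext) simp
    moreover have "t = 0" if "(a, b, t) \<in> K" for a b t using K(2) that by fast
    ultimately have "block_product q (spine_linked 0 \<omega>) (I \<union> K) = of_bool (related_on (spine_linked 0 \<omega>) K) * ?bp \<omega>"
      using block_product_time_0[OF partition_spinal[OF \<omega> order_refl] I K(1)] by simp
    then show ?thesis using \<omega> unfolding H_eq spine_event_def indicator_def by simp
  qed
  have "(\<integral>\<^sup>+\<omega>. indicator H \<omega> * indicator (path_event I) (spinal_path \<omega>) \<partial>M) =
      (\<integral>\<^sup>+\<omega>. ennreal (indicator H \<omega> * indicator (path_event I) (spinal_path \<omega>)) \<partial>M)"
    by (intro nn_integral_cong) (auto simp: indicator_def)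
  also have "\<dots> = ennreal (\<integral>\<omega>. indicator H \<omega> * indicator (path_event I) (spinal_path \<omega>) \<partial>M)"
  proof (intro nn_integral_eq_integral integrable_const_bound[where B=1])
    have "(\<lambda>\<omega>. indicator (path_event I) (spinal_path \<omega>) :: real) \<in> borel_measurable M"
      using measurable_spinal_path path_event_in_sets[OF I] by measurable
    then show "(\<lambda>\<omega>. indicator H \<omega> * indicator (path_event I) (spinal_path \<omega>) :: real) \<in> borel_measurable M"
      using H_M by measurable
  qed (auto simp: indicator_def)
  also have "(\<integral>\<omega>. indicator H \<omega> * indicator (path_event I) (spinal_path \<omega>) \<partial>M) = (\<integral>\<omega>. indicator H \<omega> * ?bp \<omega> \<partial>M)"
  proof -
    have "(\<integral>\<omega>. indicator H \<omega> * indicator (path_event I) (spinal_path \<omega>) \<partial>M) =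
        (\<integral>\<omega>. ?T \<omega> * of_bool (\<forall>(a, b, t)\<in>I \<union> K. spine_linked t \<omega> a b) \<partial>M)"
      by (rule Bochner_Integration.integral_cong[OF refl lhs])
    also have "\<dots> = (\<integral>\<omega>. ?T \<omega> * block_product q (spine_linked 0 \<omega>) (I \<union> K) \<partial>M)"
      by (rule spine_law[OF D IK])
    also have "\<dots> = (\<integral>\<omega>. indicator H \<omega> * ?bp \<omega> \<partial>M)"
      by (rule Bochner_Integration.integral_cong[OF refl rhs[symmetric]])
    finally show ?thesis .
  qed
  also have "ennreal \<dots> = (\<integral>\<^sup>+\<omega>. ennreal (indicator H \<omega> * ?bp \<omega>) \<partial>M)"
  proof (intro nn_integral_eq_integral[symmetric] integrable_const_bound[where B=1])
    show "(\<lambda>\<omega>. indicator H \<omega> * ?bp \<omega>) \<in> borel_measurable M" using H_M by measurable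
  qed (use bp in \<open>auto simp: indicator_def\<close>)
  also have "\<dots> = (\<integral>\<^sup>+\<omega>. indicator H \<omega> * emeasure (spinal_law \<omega>) (path_event I) \<partial>M)"
    by (intro nn_integral_cong) (auto simp: emeasure_spinal_law[OF _ I] indicator_def)
  finally show ?thesis .
qed

lemma measurable_spinal_law:
  assumes "spinal X A 0 \<in> N \<rightarrow>\<^sub>M partition_algebra"
  shows "spinal_law \<in> N \<rightarrow>\<^sub>M subprob_algebra path_algebra"
  using measurable_compose[OF assms measurable_frag_law] by (rule measurable_prob_algebraD)

text \<open>Both sides are finite measures in \<open>E\<close> that agree on the events of queries.\<close>

lemma spinal_law_on_events:
  assumes H: "H \<in> spine_events" and E: "E \<in> sets path_algebra"
  shows "(\<integral>\<^sup>+\<omega>. indicator H \<omega> * indicator E (spinal_path \<omega>) \<partial>M) =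
    (\<integral>\<^sup>+\<omega>. indicator H \<omega> * emeasure (spinal_law \<omega>) E \<partial>M)"
proof -
  have H_M [measurable]: "H \<in> sets M" using H spine_event_in_sets unfolding spine_events_def by auto
  let ?D = "density M (indicator H)"
  have Y: "spinal_path \<in> ?D \<rightarrow>\<^sub>M path_algebra" using measurable_spinal_path by simp
  have \<kappa>: "spinal_law \<in> ?D \<rightarrow>\<^sub>M subprob_algebra path_algebra"
    using measurable_spinal_law[OF measurable_spinal[OF order_refl]] by simp
  have ne: "space ?D \<noteq> {}" using not_empty by simp
  have m1: "emeasure (distr ?D path_algebra spinal_path) F = (\<integral>\<^sup>+\<omega>. indicator H \<omega> * indicator F (spinal_path \<omega>) \<partial>M)"
    if F: "F \<in> sets path_algebra" for F
  proof -
    have "emeasure (distr ?D path_algebra spinal_path) F = emeasure ?D (spinal_path -` F \<inter> space M)"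
      using emeasure_distr[OF Y F] by simp
    also have "\<dots> = (\<integral>\<^sup>+\<omega>. indicator H \<omega> * indicator (spinal_path -` F \<inter> space M) \<omega> \<partial>M)"
      by (rule emeasure_density) (use measurable_sets[OF measurable_spinal_path F] in auto)
    also have "\<dots> = (\<integral>\<^sup>+\<omega>. indicator H \<omega> * indicator F (spinal_path \<omega>) \<partial>M)"
      by (intro nn_integral_cong) (auto simp: indicator_def)
    finally show ?thesis .
  qed
  have m2: "emeasure (?D \<bind> spinal_law) F = (\<integral>\<^sup>+\<omega>. indicator H \<omega> * emeasure (spinal_law \<omega>) F \<partial>M)"
    if F: "F \<in> sets path_algebra" for F
  proof -
    have [measurable]: "(\<lambda>\<omega>. emeasure (spinal_law \<omega>) F) \<in> borel_measurable M"
      using measurable_emeasure_kernel[OF measurable_spinal_law[OF measurable_spinal[OF order_refl]] F] .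
    show ?thesis unfolding emeasure_bind[OF ne \<kappa> F] by (rule nn_integral_density) measurable
  qed
  have "distr ?D path_algebra spinal_path = ?D \<bind> spinal_law"
  proof (rule measure_eqI_generator_eq[OF Int_stable_path_events, of "space path_algebra" _ _ "\<lambda>_. path_event {}"])
    show "path_event ` Collect admissible \<subseteq> Pow (space path_algebra)" by (auto simp: path_event_def)
    show "emeasure (distr ?D path_algebra spinal_path) F = emeasure (?D \<bind> spinal_law) F"
      if "F \<in> path_event ` Collect admissible" for F
      using that spinal_law_on_generators[OF H] m1 m2 path_event_in_sets by auto
    show "sets (distr ?D path_algebra spinal_path) = sigma_sets (space path_algebra) (path_event ` Collect admissible)"
      by (simp add: sets_path_algebra)
    show "sets (?D \<bind> spinal_law) = sigma_sets (space path_algebra) (path_event ` Collect admissible)"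
      using sets_bind[OF _ ne, of spinal_law path_algebra] by (simp add: frag_law_def sets_path_algebra)
    show "range (\<lambda>_::nat. path_event {}) \<subseteq> path_event ` Collect admissible" by (auto simp: admissible_def)
    show "(\<Union>i::nat. path_event {}) = space path_algebra" by (simp add: path_event_empty)
    have "(\<integral>\<^sup>+\<omega>. indicator H \<omega> * indicator (path_event {}) (spinal_path \<omega>) \<partial>M) \<le> (\<integral>\<^sup>+\<omega>. 1 \<partial>M)"
      by (intro nn_integral_mono) (auto simp: indicator_def)
    also have "\<dots> = 1" by (simp add: emeasure_space_1)
    finally show "emeasure (distr ?D path_algebra spinal_path) (path_event {}) \<noteq> \<infinity>"
      using m1[of "path_event {}"] by (auto simp: path_event_empty top_unique)
  qed
  then show ?thesis using m1[OF E] m2[OF E] by simp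
qed

text \<open>Both sides are finite measures in \<open>H\<close> that agree on the generating events.\<close>

lemma spinal_law_conditionally:
  assumes E: "E \<in> sets path_algebra" and H: "H \<in> sets (spinal_algebra M X A)"
  shows "(\<integral>\<^sup>+\<omega>. indicator H \<omega> * indicator E (spinal_path \<omega>) \<partial>M) =
    (\<integral>\<^sup>+\<omega>. indicator H \<omega> * emeasure (spinal_law \<omega>) E \<partial>M)"
proof -
  let ?G = "sigma (space M) spine_events"
  have sets: "sets ?G = sigma_sets (space M) spine_events" and space: "space ?G = space M"
    using spine_events_sub by (auto simp: sets_measure_of space_measure_of)
  have gen_M: "spine_events \<subseteq> sets M" using spine_event_in_sets unfolding spine_events_def by auto
  then have G_M: "sets ?G \<subseteq> sets M" unfolding sets by (rule sets.sigma_sets_subset)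
  have id: "(\<lambda>\<omega>. \<omega>) \<in> M \<rightarrow>\<^sub>M ?G"
    using G_M sets.sets_into_space by (auto simp: measurable_def space Int_absorb2)
  have f: "(\<lambda>\<omega>. indicator E (spinal_path \<omega>) :: ennreal) \<in> borel_measurable M"
    using measurable_spinal_path E by measurable
  have g: "(\<lambda>\<omega>. emeasure (spinal_law \<omega>) E) \<in> borel_measurable M"
    using measurable_emeasure_kernel[OF measurable_spinal_law[OF measurable_spinal[OF order_refl]] E] .
  have m: "emeasure (distr (density M h) ?G (\<lambda>\<omega>. \<omega>)) F = (\<integral>\<^sup>+\<omega>. indicator F \<omega> * h \<omega> \<partial>M)"
    if h: "h \<in> borel_measurable M" and F: "F \<in> sets ?G" for h F
  proof -
    have F_M: "F \<in> sets M" using F G_M by auto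
    have "emeasure (distr (density M h) ?G (\<lambda>\<omega>. \<omega>)) F = emeasure (density M h) F"
      using sets.sets_into_space[OF F_M] id F by (subst emeasure_distr) (auto simp: Int_absorb2)
    also have "\<dots> = (\<integral>\<^sup>+\<omega>. h \<omega> * indicator F \<omega> \<partial>M)" by (rule emeasure_density[OF h F_M])
    finally show ?thesis by (simp add: mult.commute)
  qed
  have "distr (density M (\<lambda>\<omega>. indicator E (spinal_path \<omega>))) ?G (\<lambda>\<omega>. \<omega>) =
      distr (density M (\<lambda>\<omega>. emeasure (spinal_law \<omega>) E)) ?G (\<lambda>\<omega>. \<omega>)" (is "?\<mu> = ?\<nu>")
  proof (rule measure_eqI_generator_eq[OF Int_stable_spine_events spine_events_sub, of _ _ "\<lambda>_. space M"])
    show "emeasure ?\<mu> F = emeasure ?\<nu> F" if F: "F \<in> spine_events" for F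
    proof -
      have "F \<in> sets ?G" unfolding sets using F by (rule sigma_sets.Basic)
      then show ?thesis using m[OF f] m[OF g] spinal_law_on_events[OF F E] by simp
    qed
    show "sets ?\<mu> = sigma_sets (space M) spine_events" "sets ?\<nu> = sigma_sets (space M) spine_events"
      using sets by simp_all
    show "range (\<lambda>_::nat. space M) \<subseteq> spine_events" using space_in_spine_events by auto
    have "(\<integral>\<^sup>+\<omega>. indicator (space M) \<omega> * indicator E (spinal_path \<omega>) \<partial>M) \<le> (\<integral>\<^sup>+\<omega>. 1 \<partial>M)"
      by (intro nn_integral_mono) (auto simp: indicator_def)
    also have "\<dots> = 1" by (simp add: emeasure_space_1)
    finally show "emeasure ?\<mu> (space M) \<noteq> \<infinity>"
      using m[OF f, of "space M"] sets.top[of ?G] by (auto simp: space top_unique)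
  qed simp
  moreover have "H \<in> sets ?G" using H spinal_algebra_generated unfolding sets by auto
  ultimately show ?thesis using m[OF f, of H] m[OF g, of H] by simp
qed

lemma spinal_has_cond_law:
  "has_cond_law M (spinal_algebra M X A) spinal_path path_algebra spinal_law"
  unfolding has_cond_law_def
proof (intro conjI ballI)
  show sub: "subalgebra M (spinal_algebra M X A)" by (rule subalgebra_spinal_algebra)
  show "spinal_path \<in> M \<rightarrow>\<^sub>M path_algebra" by (rule measurable_spinal_path)
  fix E assume E: "E \<in> sets path_algebra"
  interpret sub: finite_measure_subalgebra M "spinal_algebra M X A" by unfold_locales (rule sub)
  let ?S = "spinal_path -` E \<inter> space M"
  have S: "?S \<in> sets M" using measurable_sets[OF measurable_spinal_path E] .
  have prob: "prob_space (spinal_law \<omega>)" if "\<omega> \<in> space M" for \<omega>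
    using prob_space_frag_law spinal_in_space[OF that order_refl] by blast
  have spinal_0: "spinal X A 0 \<in> spinal_algebra M X A \<rightarrow>\<^sub>M partition_algebra"
    using measurable_compose[OF measurable_vimage_algebra1[OF spinal_data_in_space] measurable_fst]
    by (simp add: spinal_algebra_def)
  have meas: "(\<lambda>\<omega>. measure (spinal_law \<omega>) E) \<in> borel_measurable (spinal_algebra M X A)"
    unfolding measure_def using measurable_emeasure_kernel[OF measurable_spinal_law[OF spinal_0] E] by measurable
  have meas_M: "(\<lambda>\<omega>. measure (spinal_law \<omega>) E) \<in> borel_measurable M"
    by (rule measurable_from_subalg[OF sub meas])
  have bd: "AE \<omega> in M. norm (measure (spinal_law \<omega>) E) \<le> 1"
    by (rule AE_I2) (use prob prob_space.prob_le_1 in auto)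
  show "AE \<omega> in M. real_cond_exp M (spinal_algebra M X A) (indicator ?S) \<omega> = measure (spinal_law \<omega>) E"
  proof (rule sub.real_cond_exp_charact[OF _ _ _ meas])
    fix H assume H: "H \<in> sets (spinal_algebra M X A)"
    then have H_M: "H \<in> sets M" using sub by (auto simp: subalgebra_def)
    have "(\<integral>\<omega>\<in>H. indicator ?S \<omega> \<partial>M) = enn2real (\<integral>\<^sup>+\<omega>. ennreal (indicator H \<omega> * indicator ?S \<omega>) \<partial>M)"
      unfolding set_lebesgue_integral_def real_scaleR_def using H_M S
      by (intro integral_eq_nn_integral) auto
    also have "(\<integral>\<^sup>+\<omega>. ennreal (indicator H \<omega> * indicator ?S \<omega>) \<partial>M) =
        (\<integral>\<^sup>+\<omega>. indicator H \<omega> * indicator E (spinal_path \<omega>) \<partial>M)"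
      by (intro nn_integral_cong) (auto simp: indicator_def)
    also have "\<dots> = (\<integral>\<^sup>+\<omega>. indicator H \<omega> * emeasure (spinal_law \<omega>) E \<partial>M)"
      by (rule spinal_law_conditionally[OF E H])
    also have "\<dots> = (\<integral>\<^sup>+\<omega>. ennreal (indicator H \<omega> * measure (spinal_law \<omega>) E) \<partial>M)"
    proof (intro nn_integral_cong)
      fix \<omega> assume "\<omega> \<in> space M"
      then interpret P: prob_space "spinal_law \<omega>" by (rule prob)
      show "indicator H \<omega> * emeasure (spinal_law \<omega>) E = ennreal (indicator H \<omega> * measure (spinal_law \<omega>) E)"
        by (simp add: P.emeasure_eq_measure indicator_def)
    qed
    also have "enn2real \<dots> = (\<integral>\<omega>\<in>H. measure (spinal_law \<omega>) E \<partial>M)"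
      unfolding set_lebesgue_integral_def real_scaleR_def using H_M meas_M
      by (intro integral_eq_nn_integral[symmetric]) auto
    finally show "(\<integral>\<omega>\<in>H. indicator ?S \<omega> \<partial>M) = (\<integral>\<omega>\<in>H. measure (spinal_law \<omega>) E \<partial>M)" .
  qed (use S meas_M bd in \<open>auto intro: integrable_const_bound[where B=1]\<close>)
qed

end

theorem lemma21:
  fixes M :: "'a measure"
    and X :: "real \<Rightarrow> 'a \<Rightarrow> nat set set"
    and A :: "real \<Rightarrow> 'a \<Rightarrow> nat set"
  assumes "prob_space M"
    and "fragmentation_process M X"
    and "markovian_path M X A"
  shows "(\<forall>\<omega>\<in>space M. \<forall>t\<ge>0.
            spinal X A t \<omega> =
            (\<Union>B\<in>spinal X A 0 \<omega>. restr B (at_ext_time X (detach_time A (Inf B) \<omega> + ereal t) \<omega>))) \<and>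
         has_cond_law M (spinal_algebra M X A)
           (\<lambda>\<omega>. \<lambda>t\<in>{0..}. spinal X A t \<omega>) path_algebra
           (\<lambda>\<omega>. frag_law M X (spinal X A 0 \<omega>))"
proof -
  interpret prob_space M by fact
  obtain F where F: "filtration (space M) F" "\<forall>t. subalgebra M (F t)" "markov_wrt M X F"
      "\<forall>t\<ge>0. A t \<in> F t \<rightarrow>\<^sub>M subset_algebra"
      "\<forall>s\<ge>0. cond_indep M (F s)
           (\<lambda>\<omega>. \<lambda>t\<in>{s..}. (A t \<omega>, restr (A s \<omega>) (X t \<omega>)))
             (PiM {s..} (\<lambda>_. subset_algebra \<Otimes>\<^sub>M partition_algebra))
           (\<lambda>\<omega>. \<lambda>t\<in>{s..}. restr (- A s \<omega>) (X t \<omega>))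
             (PiM {s..} (\<lambda>_. partition_algebra))"
    and path: "path_in M X A"
    using assms(3) unfolding markovian_path_def by auto
  have frag: "\<forall>t\<ge>0. X t \<in> M \<rightarrow>\<^sub>M partition_algebra"
      "\<forall>\<omega>\<in>space M. X 0 \<omega> = {UNIV} \<and> (\<forall>s t. 0 \<le> s \<longrightarrow> s \<le> t \<longrightarrow> refines UNIV (X t \<omega>) (X s \<omega>)) \<and>
        right_cont_partitions (\<lambda>t. X t \<omega>)"
    using assms(2) unfolding fragmentation_process_def by auto
  interpret markovian_spine M X F A
  proof unfold_locales
    show "partition_on UNIV (X t \<omega>)" if "\<omega> \<in> space M" "0 \<le> t" for \<omega> t
      using frag(2) that unfolding refines_def by blast
    show "space (F t) = space M" for t by (rule filtration.space_F[OF F(1)])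
    show "sets (F s) \<subseteq> sets (F t)" if "s \<le> t" for s t by (rule filtration.sets_F_mono[OF F(1) that])
  qed (use frag F path in \<open>auto simp: path_in_def\<close>)
  show ?thesis using spinal_fragments spinal_has_cond_law by blast
qed

end
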